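(* Let $p>2$ be a prime and let $n>2$ be an integer. Let $P$ be a $p$-group of maximal class of order $p^n$. (1) If $n>p+1$, then the exponent of $P$ is $p^k$, where $k$ is the least integer greater than or equal to $(n-1)/(p-1)$. (2) If $n=p+1$, then $P$ has exponent $p^2$. (3) If $n\leq p$, then $P$ has exponent $p$ or $p^2$, and both possibilities arise: for each prime $p>2$ and each integer $n$ with $2<n\leq p$, there is a group of maximal class of order $p^n$ with exponent $p$, and there is a group of maximal class of order $p^n$ with exponent $p^2$.
   Context: A finite $p$-group of order $p^n$ is said to be of maximal class if its nilpotency class is $n-1$. The exponent of a finite group $G$ is the least positive integer $e$ such that $g^e=1$ for all $g\in G$. *)

theory Defs
  imports Complex_Main "HOL-Algebra.Algebra"
begin

text \<open>
  The index is shifted by one with respect to the usual convention: \<open>lower_central G i\<close> is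
  the term usually written \<open>\<gamma>\<^sub>i\<^sub>+\<^sub>1(G)\<close>, so that a group has class at most \<open>c\<close> iff
  \<open>lower_central G c\<close> is trivial. The commutators are written in the convention of the
  library's \<^term>\<open>derived\<close>.
\<close>

primrec lower_central :: "('a, 'b) monoid_scheme \<Rightarrow> nat \<Rightarrow> 'a set" where
  "lower_central G 0 = carrier G"
| "lower_central G (Suc i) =
     generate G (\<Union>h \<in> lower_central G i. \<Union>g \<in> carrier G.
       {h \<otimes>\<^bsub>G\<^esub> g \<otimes>\<^bsub>G\<^esub> inv\<^bsub>G\<^esub> h \<otimes>\<^bsub>G\<^esub> inv\<^bsub>G\<^esub> g})"

definition nilpotent :: "('a, 'b) monoid_scheme \<Rightarrow> bool" where
  "nilpotent G \<longleftrightarrow> group G \<and> (\<exists>c. lower_central G c = {\<one>\<^bsub>G\<^esub>})"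

definition nilpotency_class :: "('a, 'b) monoid_scheme \<Rightarrow> nat" where
  "nilpotency_class G = (LEAST c. lower_central G c = {\<one>\<^bsub>G\<^esub>})"

text \<open>
  For a prime \<open>p\<close> the condition on \<^term>\<open>order G\<close> forces the carrier to be finite, because the
  library assigns order 0 to infinite groups.
\<close>

definition maximal_class :: "nat \<Rightarrow> nat \<Rightarrow> ('a, 'b) monoid_scheme \<Rightarrow> bool" where
  "maximal_class p n G \<longleftrightarrow>
     group G \<and> Factorial_Ring.prime p \<and> order G = p ^ n \<and> nilpotent G \<and> nilpotency_class G = n - 1"

definition group_exponent :: "('a, 'b) monoid_scheme \<Rightarrow> nat" where
  "group_exponent G = (LEAST e. 0 < e \<and> (\<forall>g \<in> carrier G. g [^]\<^bsub>G\<^esub> e = \<one>\<^bsub>G\<^esub>))"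

end

theory Submission
  imports Defs "HOL-Number_Theory.Residues"
begin

text \<open>
  Let \<open>gam i\<close> denote the \<open>i\<close>-th term of the lower central series, with \<open>gam 1\<close> the whole group. If \<open>G\<close> carries a filtration with
  \<open>[F k, F l] \<subseteq> F (k + l)\<close>, the sequences whose iterated differences descend through the filtration form
  a group. Their Taylor expansions give the Hall-Petrescu formula: \<open>(y x) ^ p\<close> agrees with
  \<open>y ^ p x ^ p\<close> up to \<open>p\<close>-th powers from \<open>F 2\<close> and elements of \<open>F p\<close>. For suitable filtrations this yields
  \<open>gam i ^ p \<subseteq> gam (i + p - 1)\<close> for \<open>i \<ge> 2\<close> and \<open>x ^ p \<in> gam p\<close> for all \<open>x\<close>, hence the upper bounds.

  For the lower bound it suffices to find \<open>x\<close> with \<open>x ^ p \<notin> gam (p + 1)\<close>: taking commutators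
  then shows that \<open>p\<close>-th powers descend by exactly \<open>p - 1\<close> steps. If there were no such \<open>x\<close>, expanding
  \<open>(x ^ t s) ^ p\<close> for all \<open>t\<close> simultaneously and isolating the part linear in \<open>t\<close> would give the Engel
  congruence \<open>[s, \<dots>, s, x] \<in> gam (p + 1)\<close> (with \<open>p - 1\<close> factors \<open>s\<close>), which fails as soon as \<open>s\<close> avoids the
  two-step centralizers.
\<close>

section \<open>Commutators and the lower central series\<close>

text \<open>A single instance of the expansion modulo \<open>gam (p + 1)\<close> mixes all degrees
  in \<open>x\<close>, and only their sum is known to vanish. Replacing \<open>x\<close> by
  \<open>x [^] t\<close> scales the part of degree \<open>i\<close> by \<open>t ^ i\<close>, and
  dividing by \<open>s [^] p\<close> removes degree 0. In weight \<open>p\<close> only the degrees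
  from 1 to \<open>p - 1\<close> remain, so summing against \<open>t ^ (p - 2)\<close>, the inverse
  of \<open>t\<close> modulo \<open>p\<close>, kills every degree except 1. This is why filtrations
  carry a second index next to the weight. The other recurring difficulty is the last term of the
  filtration in the Hall-Petrescu formula. The evident choice, \<open>gam (i + k - 1)\<close> in
  weight \<open>k\<close>, suffices for the upper bounds but stops one step short for the lower
  bounds, which need filtrations that descend faster. Upper bounds for \<open>gam 2\<close> are
  special as well: for \<open>i >= 3\<close>, \<open>gam i\<close> is generated by commutators with
  elements of \<open>gam (i - 1)\<close>, whose \<open>p\<close>-th powers are already controlled,
  whereas \<open>gam 2\<close> comes from the whole group.\<close>

context group
begin

definition commutator :: "'a \<Rightarrow> 'a \<Rightarrow> 'a" where
  "commutator x y = x \<otimes> y \<otimes> inv x \<otimes> inv y"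

lemma commutator_closed [simp]:
  "x \<in> carrier G \<Longrightarrow> y \<in> carrier G \<Longrightarrow> commutator x y \<in> carrier G"
  by (simp add: commutator_def)

lemma inv_cancel_left:
  "x \<in> carrier G \<Longrightarrow> y \<in> carrier G \<Longrightarrow> x \<otimes> (inv x \<otimes> y) = y"
  "x \<in> carrier G \<Longrightarrow> y \<in> carrier G \<Longrightarrow> inv x \<otimes> (x \<otimes> y) = y"
  by (simp_all flip: m_assoc)

text \<open>Together with the default simp rules these equations decide the word problem of free groups.\<close>
lemmas word_simps = m_assoc inv_mult_group inv_cancel_left

lemma commutator_one [simp]:
  "x \<in> carrier G \<Longrightarrow> commutator x \<one> = \<one>" "x \<in> carrier G \<Longrightarrow> commutator \<one> x = \<one>"
  "x \<in> carrier G \<Longrightarrow> commutator x x = \<one>"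
  by (simp_all add: commutator_def word_simps)

lemma inv_commutator:
  "x \<in> carrier G \<Longrightarrow> y \<in> carrier G \<Longrightarrow> inv (commutator x y) = commutator y x"
  by (simp add: commutator_def word_simps)

lemma commutator_mult_left:
  "\<lbrakk>x \<in> carrier G; y \<in> carrier G; z \<in> carrier G\<rbrakk> \<Longrightarrow>
    commutator (x \<otimes> y) z = x \<otimes> commutator y z \<otimes> inv x \<otimes> commutator x z"
  by (simp add: commutator_def word_simps)

lemma commutator_mult_right:
  "\<lbrakk>x \<in> carrier G; y \<in> carrier G; z \<in> carrier G\<rbrakk> \<Longrightarrow>
    commutator x (y \<otimes> z) = commutator x y \<otimes> (y \<otimes> commutator x z \<otimes> inv y)"
  by (simp add: commutator_def word_simps)

lemma commutator_inv_left:
  "\<lbrakk>x \<in> carrier G; z \<in> carrier G\<rbrakk> \<Longrightarrow>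
    commutator (inv x) z = inv x \<otimes> inv (commutator x z) \<otimes> x"
  by (simp add: commutator_def word_simps)

lemma commutator_inv_right:
  "\<lbrakk>x \<in> carrier G; z \<in> carrier G\<rbrakk> \<Longrightarrow>
    commutator z (inv x) = inv x \<otimes> inv (commutator z x) \<otimes> x"
  by (simp add: commutator_def word_simps)

lemma conj_commutator:
  "\<lbrakk>g \<in> carrier G; x \<in> carrier G; y \<in> carrier G\<rbrakk> \<Longrightarrow>
    g \<otimes> commutator x y \<otimes> inv g = commutator (g \<otimes> x \<otimes> inv g) (g \<otimes> y \<otimes> inv g)"
  by (simp add: commutator_def word_simps)

lemma conj_mult:
  "\<lbrakk>g \<in> carrier G; x \<in> carrier G; y \<in> carrier G\<rbrakk> \<Longrightarrow>
    g \<otimes> (x \<otimes> y) \<otimes> inv g = (g \<otimes> x \<otimes> inv g) \<otimes> (g \<otimes> y \<otimes> inv g)"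
  by (simp add: word_simps)

lemma conj_pow:
  "\<lbrakk>g \<in> carrier G; x \<in> carrier G\<rbrakk> \<Longrightarrow> (g \<otimes> x \<otimes> inv g) [^] (n::nat) = g \<otimes> x [^] n \<otimes> inv g"
  by (induction n) (simp_all add: word_simps)

lemma normal_conjD:
  "N \<lhd> G \<Longrightarrow> g \<in> carrier G \<Longrightarrow> x \<in> N \<Longrightarrow> g \<otimes> x \<otimes> inv g \<in> N"
  "N \<lhd> G \<Longrightarrow> g \<in> carrier G \<Longrightarrow> x \<in> N \<Longrightarrow> inv g \<otimes> x \<otimes> g \<in> N"
  by (simp_all add: normal.inv_op_closed1 normal.inv_op_closed2)

lemma subgroup_closed:
  assumes "subgroup H G"
  shows "\<one> \<in> H" "x \<in> H \<Longrightarrow> inv x \<in> H" "x \<in> H \<Longrightarrow> y \<in> H \<Longrightarrow> x \<otimes> y \<in> H"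
    "x \<in> H \<Longrightarrow> x \<in> carrier G" "x \<in> H \<Longrightarrow> x [^] (n::nat) \<in> H"
    "x \<in> H \<Longrightarrow> y \<in> H \<Longrightarrow> commutator x y \<in> H"
proof -
  interpret H: subgroup H G by fact
  show 1: "\<one> \<in> H" "x \<in> H \<Longrightarrow> inv x \<in> H" "x \<in> H \<Longrightarrow> y \<in> H \<Longrightarrow> x \<otimes> y \<in> H" "x \<in> H \<Longrightarrow> x \<in> carrier G"
    by auto
  show p: "x \<in> H \<Longrightarrow> x [^] (n::nat) \<in> H" for n by (induction n) auto
  show "x \<in> H \<Longrightarrow> y \<in> H \<Longrightarrow> commutator x y \<in> H" by (simp add: commutator_def)
qed

lemma normal_mult_cancel:
  assumes "subgroup N G" "a \<in> N" "b \<in> carrier G"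
  shows "a \<otimes> b \<in> N \<longleftrightarrow> b \<in> N" "b \<otimes> a \<in> N \<longleftrightarrow> b \<in> N"
proof -
  interpret N: subgroup N G by fact
  have a: "a \<in> carrier G" using assms by auto
  have "b \<in> N" if "a \<otimes> b \<in> N"
  proof -
    have "inv a \<otimes> (a \<otimes> b) \<in> N" using that assms by auto
    then show ?thesis using a assms by (simp add: inv_cancel_left)
  qed
  then show "a \<otimes> b \<in> N \<longleftrightarrow> b \<in> N" using assms by auto
  have "b \<in> N" if "b \<otimes> a \<in> N"
  proof -
    have "(b \<otimes> a) \<otimes> inv a \<in> N" using that assms by auto
    then show ?thesis using a assms by (simp add: m_assoc)
  qed
  then show "b \<otimes> a \<in> N \<longleftrightarrow> b \<in> N" using assms by auto
qed

lemma normal_commutator: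
  assumes "N \<lhd> G" "x \<in> N" "y \<in> carrier G"
  shows "commutator x y \<in> N" "commutator y x \<in> N"
proof -
  interpret N: normal N G by fact
  have x: "x \<in> carrier G" using assms by auto
  have "commutator x y = x \<otimes> (y \<otimes> inv x \<otimes> inv y)" using x assms by (simp add: commutator_def word_simps)
  then show 1: "commutator x y \<in> N" using assms normal_conjD(1)[OF assms(1,3)] by auto
  then show "commutator y x \<in> N" using inv_commutator[OF x assms(3)] N.m_inv_closed by metis
qed

text \<open>Being a subgroup, such a centralizer contains a generated subgroup as soon as it
  contains the generators; many inclusions below are proved this way.\<close>

lemma centralizer_mod_subgroup:
  assumes N: "N \<lhd> G" and S: "S \<subseteq> carrier G"
  shows "subgroup {v \<in> carrier G. \<forall>u\<in>S. commutator u v \<in> N} G" (is "subgroup ?C G")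
proof -
  interpret N: normal N G by fact
  show ?thesis
  proof (rule subgroupI)
    show "?C \<subseteq> carrier G" by auto
    show "?C \<noteq> {}" using S by (auto intro!: exI[of _ \<one>])
    have Sc: "u \<in> carrier G" if "u \<in> S" for u using S that by blast
    show "inv a \<in> ?C" if a: "a \<in> ?C" for a
    proof -
      have "commutator u (inv a) \<in> N" if u: "u \<in> S" for u
        using normal_conjD(2)[OF N, of a "inv (commutator u a)"] a u Sc[OF u] N.m_inv_closed
        by (simp add: commutator_inv_right)
      then show ?thesis using a by simp
    qed
    show "a \<otimes> b \<in> ?C" if a: "a \<in> ?C" and b: "b \<in> ?C" for a b
    proof -
      have "commutator u (a \<otimes> b) \<in> N" if u: "u \<in> S" for u
        using normal_conjD(1)[OF N, of a "commutator u b"] a b u Sc[OF u] N.m_closed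
        by (simp add: commutator_mult_right)
      then show ?thesis using a b by simp
    qed
  qed
qed

lemma commutator_mod_sym:
  assumes "subgroup N G" "u \<in> carrier G" "v \<in> carrier G"
  shows "commutator u v \<in> N \<longleftrightarrow> commutator v u \<in> N"
  by (metis assms inv_commutator subgroup_closed(2))

lemma lower_central_Suc:
  "lower_central G (Suc i) = generate G (\<Union>h\<in>lower_central G i. \<Union>g\<in>carrier G. {commutator h g})"
  by (simp add: commutator_def)

declare lower_central.simps(2) [simp del]

lemma lower_central_normal: "lower_central G i \<lhd> G"
proof (induction i)
  case 0
  show ?case using normal_inv_iff subgroup_self by auto
next
  case (Suc i)
  let ?S = "\<Union>h\<in>lower_central G i. \<Union>g\<in>carrier G. {commutator h g}"
  interpret L: normal "lower_central G i" G by fact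
  have S: "?S \<subseteq> carrier G" by auto
  have "subgroup (generate G ?S) G" by (rule generate_is_subgroup[OF S])
  moreover have "x \<otimes> h \<otimes> inv x \<in> generate G ?S" if h: "h \<in> generate G ?S" and x: "x \<in> carrier G" for x h
    using h
  proof (induction rule: generate.induct)
    case one
    then show ?case using x by (auto intro: generate.one)
  next
    case (incl h)
    then obtain a b where ab: "h = commutator a b" "a \<in> lower_central G i" "b \<in> carrier G" by blast
    have a: "a \<in> carrier G" using L.mem_carrier[OF ab(2)] .
    have "x \<otimes> h \<otimes> inv x = commutator (x \<otimes> a \<otimes> inv x) (x \<otimes> b \<otimes> inv x)"
      unfolding ab(1) using a ab(3) x by (simp add: conj_commutator)
    moreover have "commutator (x \<otimes> a \<otimes> inv x) (x \<otimes> b \<otimes> inv x) \<in> ?S"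
      using normal_conjD(1)[OF Suc x ab(2)] m_closed[OF m_closed[OF x ab(3)] inv_closed[OF x]] by blast
    ultimately show ?case using generate.incl by metis
  next
    case (inv h)
    then obtain a b where ab: "h = commutator a b" "a \<in> lower_central G i" "b \<in> carrier G" by blast
    have a: "a \<in> carrier G" using L.mem_carrier[OF ab(2)] .
    have "x \<otimes> inv h \<otimes> inv x = inv (x \<otimes> h \<otimes> inv x)"
      unfolding ab(1) using a ab(3) x by (simp add: word_simps)
    also have "\<dots> = inv (commutator (x \<otimes> a \<otimes> inv x) (x \<otimes> b \<otimes> inv x))"
      unfolding ab(1) using a ab(3) x by (simp add: conj_commutator)
    finally have "x \<otimes> inv h \<otimes> inv x = inv (commutator (x \<otimes> a \<otimes> inv x) (x \<otimes> b \<otimes> inv x))" .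
    moreover have "commutator (x \<otimes> a \<otimes> inv x) (x \<otimes> b \<otimes> inv x) \<in> ?S"
      using normal_conjD(1)[OF Suc x ab(2)] m_closed[OF m_closed[OF x ab(3)] inv_closed[OF x]] by blast
    ultimately show ?case using generate.inv by metis
  next
  case (eng h1 h2)
    then have "h1 \<in> carrier G" "h2 \<in> carrier G" using generate_in_carrier[OF S] by auto
    then show ?case using eng x by (simp add: conj_mult generate.eng)
  qed
  ultimately show ?case unfolding lower_central_Suc normal_inv_iff by blast
qed

lemma lower_central_subgroup: "subgroup (lower_central G i) G"
  using lower_central_normal normal_inv_iff by blast

lemma lower_central_commutator:
  assumes "h \<in> lower_central G i" "g \<in> carrier G"
  shows "commutator h g \<in> lower_central G (Suc i)" "commutator g h \<in> lower_central G (Suc i)"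
proof -
  show 1: "commutator h g \<in> lower_central G (Suc i)"
    unfolding lower_central_Suc using assms by (blast intro: generate.incl)
  have "h \<in> carrier G" using assms lower_central_subgroup subgroup_closed(4) by blast
  then show "commutator g h \<in> lower_central G (Suc i)"
    using 1 assms commutator_mod_sym[OF lower_central_subgroup] by blast
qed

lemma lower_central_Suc_subset: "lower_central G (Suc i) \<subseteq> lower_central G i"
  unfolding lower_central_Suc
proof (rule generate_subgroup_incl[OF _ lower_central_subgroup])
  show "(\<Union>h\<in>lower_central G i. \<Union>g\<in>carrier G. {commutator h g}) \<subseteq> lower_central G i"
    using normal_commutator[OF lower_central_normal] by auto
qed

lemma lower_central_antimono: "i \<le> j \<Longrightarrow> lower_central G j \<subseteq> lower_central G i"
  by (rule lift_Suc_antimono_le[of "lower_central G"]) (rule lower_central_Suc_subset)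

lemma lower_central_generate_incl:
  assumes "subgroup H G" "\<And>h g. h \<in> lower_central G i \<Longrightarrow> g \<in> carrier G \<Longrightarrow> commutator h g \<in> H"
  shows "lower_central G (Suc i) \<subseteq> H"
  unfolding lower_central_Suc by (rule generate_subgroup_incl[OF _ assms(1)]) (use assms(2) in auto)

text \<open>Plays the part of the three subgroups lemma. Conjugation by \<open>u\<close> turns
  \<open>commutator h g\<close> into \<open>commutator (A \<otimes> h) (B \<otimes> g)\<close> with
  \<open>A = commutator u h\<close> and \<open>B = commutator u g\<close>. In the expansion every
  factor besides \<open>commutator h g\<close> itself is covered by the induction hypothesis for
  \<open>B\<close> or is a further commutator with \<open>A\<close>.\<close>

lemma lower_central_bicommutator:
  "u \<in> lower_central G a \<Longrightarrow> v \<in> lower_central G b \<Longrightarrow> commutator u v \<in> lower_central G (Suc (a + b))"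
proof (induction b arbitrary: a u v)
  case 0
  then show ?case using lower_central_commutator by simp
next
  case (Suc b)
  let ?L = "lower_central G"
  define N where "N = ?L (Suc (a + Suc b))"
  have carr: "x \<in> carrier G" if "x \<in> ?L j" for x j
    using that lower_central_subgroup subgroup_closed(4) by blast
  have N: "N \<lhd> G" unfolding N_def by (rule lower_central_normal)
  interpret N: normal N G by (rule N)
  have "?L (Suc b) \<subseteq> {v \<in> carrier G. \<forall>u\<in>?L a. commutator u v \<in> N}"
  proof (rule lower_central_generate_incl)
    show "subgroup {v \<in> carrier G. \<forall>u\<in>?L a. commutator u v \<in> N} G"
      by (rule centralizer_mod_subgroup[OF N]) (use carr in blast)
    fix h g assume h: "h \<in> ?L b" and g: "g \<in> carrier G"
    have "commutator u (commutator h g) \<in> N" if u: "u \<in> ?L a" for u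
    proof -
      note c = carr[OF u] carr[OF h] g
      define A B c Y where "A = commutator u h" and "B = commutator u g" and "c = commutator h g"
        and "Y = commutator h (B \<otimes> g)"
      have A: "A \<in> ?L (Suc (a + b))" unfolding A_def by (rule Suc.IH[OF u h])
      have B: "B \<in> ?L (Suc a)" unfolding B_def by (rule lower_central_commutator[OF u g])
      have cc: "A \<in> carrier G" "B \<in> carrier G" "c \<in> carrier G" "Y \<in> carrier G"
        unfolding A_def B_def c_def Y_def using c by simp_all
      have conj: "u \<otimes> v \<otimes> inv u = commutator u v \<otimes> v" if "u \<in> carrier G" "v \<in> carrier G" for u v
        using that by (simp add: commutator_def m_assoc)
      have "u \<otimes> c \<otimes> inv u = commutator (A \<otimes> h) (B \<otimes> g)"
        unfolding c_def conj_commutator[OF c] A_def B_def using c by (simp add: conj)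
      also have "\<dots> = A \<otimes> Y \<otimes> inv A \<otimes> commutator A (B \<otimes> g)"
        unfolding Y_def by (rule commutator_mult_left) (use c cc in auto)
      also have "\<dots> = commutator A Y \<otimes> Y \<otimes> commutator A (B \<otimes> g)"
        using cc by (simp add: conj)
      finally have 1: "u \<otimes> c \<otimes> inv u = commutator A Y \<otimes> Y \<otimes> commutator A (B \<otimes> g)" .
      have "Y = commutator h B \<otimes> (B \<otimes> c \<otimes> inv B)"
        unfolding Y_def c_def by (rule commutator_mult_right) (use c cc in auto)
      also have "\<dots> = commutator h B \<otimes> (commutator B c \<otimes> c)" using cc by (simp add: conj)
      finally have 2: "Y = commutator h B \<otimes> (commutator B c \<otimes> c)" .
      have "commutator u c = commutator A Y \<otimes> Y \<otimes> commutator A (B \<otimes> g) \<otimes> inv c"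
        unfolding commutator_def[of u c] 1 ..
      also have "\<dots> = commutator A Y \<otimes> (commutator h B \<otimes> (commutator B c \<otimes> c)) \<otimes> commutator A (B \<otimes> g) \<otimes> inv c"
        by (simp only: flip: 2)
      also have "\<dots> =
         commutator A Y \<otimes> commutator h B \<otimes> commutator B c \<otimes> (c \<otimes> commutator A (B \<otimes> g) \<otimes> inv c)"
        using c cc by (simp add: m_assoc)
      finally have "commutator u (commutator h g) =
         commutator A Y \<otimes> commutator h B \<otimes> commutator B c \<otimes> (c \<otimes> commutator A (B \<otimes> g) \<otimes> inv c)"
        unfolding c_def .
      moreover have "commutator A y \<in> N" if "y \<in> carrier G" for y
        using lower_central_commutator[OF A that] by (simp add: N_def)
      moreover have Bh: "commutator B y \<in> N" if "y \<in> ?L b" for y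
        using Suc.IH[OF B that] by (simp add: N_def)
      moreover have "commutator h B \<in> N"
        using Bh[OF h] commutator_mod_sym[OF N.subgroup_axioms] c cc by blast
      moreover have "commutator B c \<in> N"
      proof (rule Bh)
        show "c \<in> ?L b" unfolding c_def by (rule normal_commutator[OF lower_central_normal h g])
      qed
      ultimately show ?thesis using cc c by (auto intro!: N.m_closed normal_conjD[OF N])
    qed
    then show "commutator h g \<in> {v \<in> carrier G. \<forall>u\<in>?L a. commutator u v \<in> N}"
      using h g carr by auto
  qed
  then show ?case using Suc.prems unfolding N_def by blast
qed

end

section \<open>Polynomial sequences in filtered groups\<close>

text \<open>\<open>k\<close> is a weight and \<open>j\<close> a degree. The Hall-Petrescu formula
  ignores the degree; the Engel congruence uses it to discard everything of degree at least 2 in one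
  variable. As weight 0 is included, \<open>F_commutator\<close> also says that \<open>F 0 0\<close>
  normalizes every \<open>F l i\<close>.\<close>

locale filtered_group = group +
  fixes F :: "nat \<Rightarrow> nat \<Rightarrow> 'a set"
  assumes F_subgroup: "subgroup (F k j) G"
    and F_Suc_weight: "F (Suc k) j \<subseteq> F k j"
    and F_Suc_degree: "F k (Suc j) \<subseteq> F k j"
    and F_commutator: "u \<in> F k j \<Longrightarrow> v \<in> F l i \<Longrightarrow> commutator u v \<in> F (k + l) (j + i)"
begin

lemma F_carrier: "u \<in> F k j \<Longrightarrow> u \<in> carrier G"
  using F_subgroup subgroup_closed(4) by blast

definition diff :: "(nat \<Rightarrow> 'a) \<Rightarrow> nat \<Rightarrow> 'a" where
  "diff g m = g (Suc m) \<otimes> inv (g m)"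

text \<open>\<open>n\<close> only bounds how many differences are inspected, so that closure
  properties can be proved by induction on it; \<open>Poly\<close> removes the bound.\<close>

primrec poly :: "nat \<Rightarrow> nat \<Rightarrow> nat \<Rightarrow> (nat \<Rightarrow> 'a) set" where
  "poly 0 k j = {g. \<forall>m. g m \<in> F k j}"
| "poly (Suc n) k j = {g. (\<forall>m. g m \<in> F k j) \<and> diff g \<in> poly n (Suc k) j}"

lemma poly_values: "g \<in> poly n k j \<Longrightarrow> g m \<in> F k j"
  by (cases n) auto

lemma poly_carrier: "g \<in> poly n k j \<Longrightarrow> g m \<in> carrier G"
  using poly_values F_carrier by blast

lemma poly_Suc_weight: "poly n (Suc k) j \<subseteq> poly n k j"
proof (induction n arbitrary: k)
  case (Suc n)
  then show ?case using Suc[of "Suc k"] F_Suc_weight[of k j] by auto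
qed (use F_Suc_weight in auto)

lemma poly_Suc_degree: "poly n k (Suc j) \<subseteq> poly n k j"
proof (induction n arbitrary: k)
  case (Suc n)
  then show ?case using Suc[of "Suc k"] F_Suc_degree[of k j] by auto
qed (use F_Suc_degree in auto)

lemma poly_antimono: "k \<le> k' \<Longrightarrow> j \<le> j' \<Longrightarrow> g \<in> poly n k' j' \<Longrightarrow> g \<in> poly n k j"
  using lift_Suc_antimono_le[of "\<lambda>k. poly n k j'", OF poly_Suc_weight]
    lift_Suc_antimono_le[of "\<lambda>j. poly n k j", OF poly_Suc_degree] by blast

lemma poly_Suc_order: "g \<in> poly (Suc n) k j \<Longrightarrow> g \<in> poly n k j"
  by (induction n arbitrary: k g) (use F_Suc_weight in auto)

lemma diff_mult:
  "\<lbrakk>\<And>m. g m \<in> carrier G; \<And>m. h m \<in> carrier G\<rbrakk> \<Longrightarrow>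
    diff (\<lambda>m. g m \<otimes> h m) = (\<lambda>m. diff g m \<otimes> commutator (g m) (diff h m) \<otimes> diff h m)"
  by (simp add: diff_def commutator_def word_simps fun_eq_iff)

lemma diff_inv:
  "(\<And>m. g m \<in> carrier G) \<Longrightarrow>
    diff (\<lambda>m. inv (g m)) = (\<lambda>m. commutator (inv (g m)) (inv (diff g m)) \<otimes> inv (diff g m))"
  by (simp add: diff_def commutator_def word_simps fun_eq_iff)

text \<open>The point of this arrangement is that every factor contains a difference
  \<open>a\<close> or \<open>b\<close> and so has weight one more than \<open>c\<close>, which
  itself occurs only inside further commutators.\<close>

lemma diff_commutator:
  assumes "\<And>m. g m \<in> carrier G" "\<And>m. h m \<in> carrier G"
  shows "diff (\<lambda>m. commutator (g m) (h m)) = (\<lambda>m.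
    let a = diff g m; b = diff h m; c = commutator (g m) (h m); e = commutator a (b \<otimes> h m)
    in commutator a (commutator (g m) b \<otimes> commutator b c \<otimes> c) \<otimes> commutator (g m) b \<otimes> commutator b c
       \<otimes> commutator c e \<otimes> e)"
proof
  fix m
  define x y a b c e d where "x = g m" and "y = h m" and "a = diff g m" and "b = diff h m"
    and "c = commutator x y" and "e = commutator a (b \<otimes> y)"
    and "d = commutator x b \<otimes> commutator b c \<otimes> c"
  have carr: "x \<in> carrier G" "y \<in> carrier G" "a \<in> carrier G" "b \<in> carrier G"
    using assms by (simp_all add: x_def y_def a_def b_def diff_def)
  then have carr': "c \<in> carrier G" "e \<in> carrier G" "d \<in> carrier G"
    by (simp_all add: c_def e_def d_def)
  have "g (Suc m) = a \<otimes> x" "h (Suc m) = b \<otimes> y"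
    using assms by (simp_all add: a_def b_def x_def y_def diff_def m_assoc)
  then have 1: "diff (\<lambda>m. commutator (g m) (h m)) m = commutator (a \<otimes> x) (b \<otimes> y) \<otimes> inv c"
    by (simp add: diff_def c_def x_def y_def)
  have 2: "commutator (a \<otimes> x) (b \<otimes> y) = a \<otimes> commutator x (b \<otimes> y) \<otimes> inv a \<otimes> e"
    unfolding e_def by (rule commutator_mult_left) (use carr in auto)
  have 3: "commutator x (b \<otimes> y) = commutator x b \<otimes> (b \<otimes> c \<otimes> inv b)"
    unfolding c_def by (rule commutator_mult_right) (use carr in auto)
  have conj: "u \<otimes> v \<otimes> inv u = commutator u v \<otimes> v" if "u \<in> carrier G" "v \<in> carrier G" for u v
    using that by (simp add: commutator_def m_assoc)
  have 4: "commutator x (b \<otimes> y) = d"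
    unfolding 3 conj[OF carr(4) carr'(1)] d_def using carr carr' by (simp add: m_assoc)
  have 5: "e \<otimes> inv c = inv c \<otimes> (commutator c e \<otimes> e)"
    unfolding conj[OF carr'(1,2), symmetric] using carr' by (simp add: m_assoc inv_cancel_left)
  have "diff (\<lambda>m. commutator (g m) (h m)) m = commutator a d \<otimes> d \<otimes> (e \<otimes> inv c)"
    unfolding 1 2 4 conj[OF carr(3) carr'(3)] using carr carr' by (simp add: m_assoc)
  also have "\<dots> = commutator a d \<otimes> commutator x b \<otimes> commutator b c \<otimes> commutator c e \<otimes> e"
    unfolding 5 d_def using carr carr' by (simp add: m_assoc inv_cancel_left)
  finally show "diff (\<lambda>m. commutator (g m) (h m)) m = (
    let a = diff g m; b = diff h m; c = commutator (g m) (h m); e = commutator a (b \<otimes> h m)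
    in commutator a (commutator (g m) b \<otimes> commutator b c \<otimes> c) \<otimes> commutator (g m) b \<otimes> commutator b c
       \<otimes> commutator c e \<otimes> e)"
    unfolding Let_def a_def b_def c_def d_def e_def x_def y_def .
qed

text \<open>The Lazard-Leibman theorem that polynomial sequences form a group. The three closure
  properties need a joint induction: differences of products and inverses involve commutators, and
  differences of commutators involve products.\<close>

lemma poly_group_aux:
  "(\<forall>k j g h. g \<in> poly n k j \<longrightarrow> h \<in> poly n k j \<longrightarrow> (\<lambda>m. g m \<otimes> h m) \<in> poly n k j) \<and>
   (\<forall>k j g. g \<in> poly n k j \<longrightarrow> (\<lambda>m. inv (g m)) \<in> poly n k j) \<and>
   (\<forall>k j l i g h. g \<in> poly n k j \<longrightarrow> h \<in> poly n l i \<longrightarrow>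
      (\<lambda>m. commutator (g m) (h m)) \<in> poly n (k + l) (j + i))"
proof (induction n)
  case 0
  then show ?case
    using subgroup_closed[OF F_subgroup] F_commutator by simp
next
  case (Suc n)
  have mult: "(\<lambda>m. g m \<otimes> h m) \<in> poly n k j" if "g \<in> poly n k j" "h \<in> poly n k j" for k j g h
    using Suc that by blast
  have invc: "(\<lambda>m. inv (g m)) \<in> poly n k j" if "g \<in> poly n k j" for k j g
    using Suc that by blast
  have comm: "(\<lambda>m. commutator (g m) (h m)) \<in> poly n k' j'"
    if "g \<in> poly n k j" "h \<in> poly n l i" "k' \<le> k + l" "j' \<le> j + i" for k j l i g h k' j'
    by (rule poly_antimono[OF that(3,4)]) (use Suc that in blast)
  show ?case
  proof (intro conjI allI impI)
    fix k j g h assume gh: "g \<in> poly (Suc n) k j" "h \<in> poly (Suc n) k j"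
    note gh' = gh[THEN poly_Suc_order]
    have c: "g m \<in> carrier G" "h m \<in> carrier G" for m using gh poly_carrier by blast+
    have d: "diff g \<in> poly n (Suc k) j" "diff h \<in> poly n (Suc k) j" using gh by auto
    have "diff (\<lambda>m. g m \<otimes> h m) \<in> poly n (Suc k) j"
      unfolding diff_mult[OF c] by (intro mult d comm[OF gh'(1) d(2)]) auto
    then show "(\<lambda>m. g m \<otimes> h m) \<in> poly (Suc n) k j"
      using gh subgroup_closed(3)[OF F_subgroup] by simp
  next
    fix k j g assume g: "g \<in> poly (Suc n) k j"
    note g' = g[THEN poly_Suc_order]
    have c: "g m \<in> carrier G" for m using g poly_carrier by blast
    have d: "diff g \<in> poly n (Suc k) j" using g by auto
    have "diff (\<lambda>m. inv (g m)) \<in> poly n (Suc k) j"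
      unfolding diff_inv[OF c] by (intro mult invc d comm[OF invc[OF g'] invc[OF d]]) auto
    then show "(\<lambda>m. inv (g m)) \<in> poly (Suc n) k j"
      using g subgroup_closed(2)[OF F_subgroup] by simp
  next
    fix k j l i g h assume gh: "g \<in> poly (Suc n) k j" "h \<in> poly (Suc n) l i"
    note gh' = gh[THEN poly_Suc_order]
    have c: "g m \<in> carrier G" "h m \<in> carrier G" for m using gh poly_carrier by blast+
    have d: "diff g \<in> poly n (Suc k) j" "diff h \<in> poly n (Suc l) i" using gh by auto
    have c': "(\<lambda>m. commutator (g m) (h m)) \<in> poly n (k + l) (j + i)"
      by (rule comm[OF gh']) auto
    have gb: "(\<lambda>m. commutator (g m) (diff h m)) \<in> poly n (Suc (k + l)) (j + i)"
      by (rule comm[OF gh'(1) d(2)]) auto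
    have bc: "(\<lambda>m. commutator (diff h m) (commutator (g m) (h m))) \<in> poly n (Suc (k + l)) (j + i)"
      by (rule comm[OF d(2) c']) auto
    have h': "(\<lambda>m. diff h m \<otimes> h m) \<in> poly n l i"
      by (intro mult gh' poly_antimono[OF _ _ d(2)]) auto
    have e: "(\<lambda>m. commutator (diff g m) (diff h m \<otimes> h m)) \<in> poly n (Suc (k + l)) (j + i)"
      by (rule comm[OF d(1) h']) auto
    have ce: "(\<lambda>m. commutator (commutator (g m) (h m)) (commutator (diff g m) (diff h m \<otimes> h m)))
        \<in> poly n (Suc (k + l)) (j + i)"
      by (rule comm[OF c' e]) auto
    have "(\<lambda>m. commutator (g m) (diff h m) \<otimes> commutator (diff h m) (commutator (g m) (h m))
        \<otimes> commutator (g m) (h m)) \<in> poly n (k + l) (j + i)"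
      by (intro mult c' poly_antimono[OF _ _ gb] poly_antimono[OF _ _ bc]) auto
    from comm[OF d(1) this, of "Suc (k + l)" "j + i"]
    have "(\<lambda>m. commutator (diff g m) (commutator (g m) (diff h m)
        \<otimes> commutator (diff h m) (commutator (g m) (h m)) \<otimes> commutator (g m) (h m)))
        \<in> poly n (Suc (k + l)) (j + i)"
      by simp
    then have "diff (\<lambda>m. commutator (g m) (h m)) \<in> poly n (Suc (k + l)) (j + i)"
      unfolding diff_commutator[OF c] Let_def by (intro mult gb bc ce e)
    then show "(\<lambda>m. commutator (g m) (h m)) \<in> poly (Suc n) (k + l) (j + i)"
      using F_commutator[OF poly_values[OF gh(1)] poly_values[OF gh(2)]] by simp
  qed
qed

lemma poly_mult: "g \<in> poly n k j \<Longrightarrow> h \<in> poly n k j \<Longrightarrow> (\<lambda>m. g m \<otimes> h m) \<in> poly n k j"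
  using poly_group_aux[of n, THEN conjunct1, THEN spec[of _ k], THEN spec[of _ j], THEN spec[of _ g], THEN spec[of _ h]] by blast

lemma poly_inv: "g \<in> poly n k j \<Longrightarrow> (\<lambda>m. inv (g m)) \<in> poly n k j"
  using poly_group_aux[of n, THEN conjunct2, THEN conjunct1, THEN spec[of _ k], THEN spec[of _ j], THEN spec[of _ g]] by blast

lemma poly_commutator:
  "g \<in> poly n k j \<Longrightarrow> h \<in> poly n l i \<Longrightarrow> (\<lambda>m. commutator (g m) (h m)) \<in> poly n (k + l) (j + i)"
  using poly_group_aux[of n, THEN conjunct2, THEN conjunct2, THEN spec[of _ k], THEN spec[of _ j], THEN spec[of _ l], THEN spec[of _ i], THEN spec[of _ g], THEN spec[of _ h]] by blast

definition Poly :: "nat \<Rightarrow> nat \<Rightarrow> (nat \<Rightarrow> 'a) set" where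
  "Poly k j = (\<Inter>n. poly n k j)"

lemma Poly_mult: "g \<in> Poly k j \<Longrightarrow> h \<in> Poly k j \<Longrightarrow> (\<lambda>m. g m \<otimes> h m) \<in> Poly k j"
  by (simp add: Poly_def poly_mult)

lemma Poly_inv: "g \<in> Poly k j \<Longrightarrow> (\<lambda>m. inv (g m)) \<in> Poly k j"
  by (simp add: Poly_def poly_inv)

lemma Poly_antimono: "g \<in> Poly k' j' \<Longrightarrow> k \<le> k' \<Longrightarrow> j \<le> j' \<Longrightarrow> g \<in> Poly k j"
  by (auto simp: Poly_def intro: poly_antimono)

lemma Poly_commutator:
  assumes "g \<in> Poly k j" "h \<in> Poly l i" "k' \<le> k + l" "j' \<le> j + i"
  shows "(\<lambda>m. commutator (g m) (h m)) \<in> Poly k' j'"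
proof -
  have "(\<lambda>m. commutator (g m) (h m)) \<in> Poly (k + l) (j + i)"
    using assms(1,2) by (simp add: Poly_def poly_commutator)
  then show ?thesis by (rule Poly_antimono[OF _ assms(3,4)])
qed

lemma Poly_values: "g \<in> Poly k j \<Longrightarrow> g m \<in> F k j"
  unfolding Poly_def by (drule INT_D[of _ _ _ 0], simp, rule poly_values)

lemma Poly_carrier: "g \<in> Poly k j \<Longrightarrow> g m \<in> carrier G"
  using Poly_values F_carrier by blast

lemma Poly_diff: "g \<in> Poly k j \<Longrightarrow> diff g \<in> Poly (Suc k) j"
proof -
  assume "g \<in> Poly k j"
  then have "g \<in> poly (Suc n) k j" for n unfolding Poly_def by blast
  then show ?thesis unfolding Poly_def by simp
qed

lemma Poly_diff_pow: "g \<in> Poly k j \<Longrightarrow> (diff ^^ q) g \<in> Poly (k + q) j"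
  by (induction q) (auto dest: Poly_diff)

text \<open>By Pascal's rule a difference lowers \<open>i\<close> by one, which is exactly the gain
  in weight it has to produce; at \<open>i = 0\<close> the sequence is constant.\<close>

lemma Poly_binomial: "c \<in> F (k + i) j \<Longrightarrow> (\<lambda>m. c [^] (m choose i)) \<in> Poly k j"
proof -
  have "\<forall>k i. c \<in> F (k + i) j \<longrightarrow> (\<lambda>m. c [^] (m choose i)) \<in> poly n k j" for n
  proof (induction n)
    case 0
    have "c \<in> F (k + i) j \<Longrightarrow> c \<in> F k j" for k i
      using lift_Suc_antimono_le[of "\<lambda>k. F k j", OF F_Suc_weight, of k "k + i"] by auto
    then show ?case using subgroup_closed(5)[OF F_subgroup] by auto
  next
    case (Suc n)
    show ?case
    proof (intro allI impI)
      fix k i assume c: "c \<in> F (k + i) j"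
      then have cc: "c \<in> carrier G" by (rule F_carrier)
      have "(\<lambda>m. c [^] (m choose i)) \<in> poly n k j" using Suc c by blast
      then have 1: "c [^] (m choose i) \<in> F k j" for m by (rule poly_values)
      have 2: "diff (\<lambda>m. c [^] (m choose i)) \<in> poly n (Suc k) j"
      proof (cases i)
        case 0
        have "diff (\<lambda>m. c [^] (m choose i)) = (\<lambda>m. \<one> [^] (m choose 0))"
          using cc 0 by (simp add: diff_def fun_eq_iff)
        moreover have "(\<lambda>m. \<one> [^] (m choose 0)) \<in> poly n' k' j" for n' k'
          by (induction n' arbitrary: k') (simp_all add: subgroup_closed[OF F_subgroup] diff_def[abs_def])
        ultimately show ?thesis by metis
      next
        case i: (Suc i')
        have "c [^] (Suc m choose i) = c [^] (m choose i') \<otimes> c [^] (m choose i)" for m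
          using cc i by (simp add: nat_pow_mult)
        then have "diff (\<lambda>m. c [^] (m choose i)) = (\<lambda>m. c [^] (m choose i'))"
          using cc by (simp add: diff_def fun_eq_iff m_assoc)
        then show ?thesis using Suc c i by simp
      qed
      show "(\<lambda>m. c [^] (m choose i)) \<in> poly (Suc n) k j"
        using 1 2 by simp
    qed
  qed
  then show "c \<in> F (k + i) j \<Longrightarrow> (\<lambda>m. c [^] (m choose i)) \<in> Poly k j"
    unfolding Poly_def by blast
qed

lemma Poly_const: "c \<in> F k j \<Longrightarrow> (\<lambda>m. c) \<in> Poly k j"
  using Poly_binomial[of c k 0 j] F_carrier by fastforce

lemma Poly_pow: "c \<in> F (Suc k) j \<Longrightarrow> (\<lambda>m. c [^] m) \<in> Poly k j"
  using Poly_binomial[of c k 1 j] by simp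

text \<open>Taken separately, the powers of \<open>y \<otimes> x\<close> and of \<open>x\<close>
  only have degree 0. The quotient obeys a difference equation in which both factors on the right
  contain \<open>y\<close> or \<open>g\<close>, so that degree \<open>j\<close> propagates by
  induction.\<close>

lemma Poly_pow_quotient:
  assumes x: "x \<in> F 1 0" and y: "y \<in> F 1 j"
  defines "g \<equiv> \<lambda>m. (y \<otimes> x) [^] m \<otimes> inv (x [^] m)"
  shows "g \<in> Poly 0 j" and "diff g = (\<lambda>m. y \<otimes> commutator x (g m))"
proof -
  have c: "x \<in> carrier G" "y \<in> carrier G" using assms F_carrier by auto
  have gc: "g m \<in> carrier G" for m unfolding g_def using c by simp
  have step: "g (Suc m) = y \<otimes> commutator x (g m) \<otimes> g m" for m
  proof -
    have "g (Suc m) = (y \<otimes> x) \<otimes> g m \<otimes> inv x"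
      unfolding g_def using c by (simp only: nat_pow_Suc2 m_closed nat_pow_closed)
        (simp add: word_simps nat_pow_inv nat_pow_Suc2)
    then show ?thesis using c gc[of m] by (simp add: commutator_def word_simps)
  qed
  then show d: "diff g = (\<lambda>m. y \<otimes> commutator x (g m))"
    using gc c by (simp add: diff_def fun_eq_iff m_assoc)
  have yF: "y \<in> F 0 j" using y F_Suc_weight[of 0 j] by auto
  have v: "g m \<in> F 0 j" for m
  proof (induction m)
    case 0
    then show ?case using subgroup_closed[OF F_subgroup] by (simp add: g_def)
  next
    case (Suc m)
    have "commutator x (g m) \<in> F 1 j" using F_commutator[OF x Suc] by simp
    then have "commutator x (g m) \<in> F 0 j" using F_Suc_weight[of 0 j] by auto
    then show ?case unfolding step using Suc yF subgroup_closed(3)[OF F_subgroup] by blast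
  qed
  have "g \<in> poly n 0 j" for n
  proof (induction n)
    case 0
    then show ?case using v by simp
  next
    case (Suc n)
    have "(\<lambda>m. x) \<in> poly n 1 0" "(\<lambda>m. y) \<in> poly n 1 j"
      using Poly_const x y unfolding Poly_def by blast+
    moreover have "(\<lambda>m. commutator x (g m)) \<in> poly n (1 + 0) (0 + j)"
      by (rule poly_commutator) (use Suc calculation in auto)
    ultimately have "diff g \<in> poly n (Suc 0) j"
      unfolding d using poly_mult by simp
    then show ?case using v by simp
  qed
  then show "g \<in> Poly 0 j" by (simp add: Poly_def)
qed

text \<open>When all earlier values are trivial, the value at \<open>i\<close> is the
  \<open>i\<close>-th Taylor coefficient and inherits the weight of the \<open>i\<close>-th
  difference.\<close>

lemma Poly_leading:
  "g \<in> Poly k j \<Longrightarrow> (\<And>m. m < i \<Longrightarrow> g m = \<one>) \<Longrightarrow> g i \<in> F (k + i) j \<and> (diff ^^ i) g 0 = g i"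
proof (induction i arbitrary: g k)
  case 0
  then show ?case using Poly_values by simp
next
  case (Suc i)
  have c: "g m \<in> carrier G" for m using Poly_carrier Suc.prems(1) by blast
  have "diff g i \<in> F (Suc k + i) j \<and> (diff ^^ i) (diff g) 0 = diff g i"
    by (rule Suc.IH[OF Poly_diff[OF Suc.prems(1)]]) (simp add: diff_def Suc.prems(2))
  moreover have "diff g i = g (Suc i)"
    using Suc.prems(2)[of i] c by (simp add: diff_def)
  ultimately show ?case by (simp add: funpow_Suc_right del: funpow.simps)
qed

lemma Poly_divide_leading:
  assumes "g \<in> Poly 0 j" "\<And>m. m < i \<Longrightarrow> g m = \<one>"
  defines "h \<equiv> \<lambda>m. inv (g i [^] (m choose i)) \<otimes> g m"
  shows "h \<in> Poly 0 j" "\<And>m. m < Suc i \<Longrightarrow> h m = \<one>" "g = (\<lambda>m. g i [^] (m choose i) \<otimes> h m)"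
proof -
  have c: "g m \<in> carrier G" for m using Poly_carrier assms(1) by blast
  have gi: "g i \<in> F (0 + i) j" using Poly_leading[OF assms(1,2)] by blast
  show "h \<in> Poly 0 j" unfolding h_def
    by (intro Poly_mult Poly_inv Poly_binomial gi assms(1))
  show "h m = \<one>" if "m < Suc i" for m
  proof (cases "m = i")
    case False
    then have "m < i" using that by simp
    then show ?thesis using assms(2)[of m] by (simp add: h_def binomial_eq_0)
  qed (use c[of i] in \<open>simp add: h_def\<close>)
  show "g = (\<lambda>m. g i [^] (m choose i) \<otimes> h m)"
    using c by (simp add: h_def inv_cancel_left)
qed

text \<open>Evaluating the Taylor expansion \<open>g m = \<Prod>\<^sub>i c\<^sub>i ^ (m choose i)\<close> with \<open>c\<^sub>i \<in> F i j\<close> at a prime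
  \<open>m = p\<close> leaves only \<open>p\<close>-th powers and the top coefficient.\<close>
lemma Poly_prime_value:
  assumes p: "Factorial_Ring.prime (p::nat)" and W: "subgroup W G" "F p j \<subseteq> W"
    and pw: "\<And>c i. b \<le> i \<Longrightarrow> i < p \<Longrightarrow> c \<in> F i j \<Longrightarrow> c [^] p \<in> W"
  shows "\<lbrakk>g \<in> Poly 0 j; 0 < b; b \<le> p; \<And>m. m < b \<Longrightarrow> g m = \<one>\<rbrakk> \<Longrightarrow> g p \<in> W"
  using pw
proof (induction "p - b" arbitrary: b g)
  case 0
  then have "b = p" by simp
  then show ?case using Poly_leading[of g 0 j p] 0 W by auto
next
  case (Suc d)
  then have b: "b < p" by simp
  define h where "h = (\<lambda>m. inv (g b [^] (m choose b)) \<otimes> g m)"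
  note h = Poly_divide_leading[OF Suc.prems(1), of b, OF Suc.prems(4)]
  have h2: "h m = \<one>" if "m < Suc b" for m
    unfolding h_def using h(2) that by simp
  have hp: "h p \<in> W"
  proof (rule Suc.hyps(1)[of "Suc b" h])
    show "d = p - Suc b" using Suc.hyps(2) by simp
    show "c [^] p \<in> W" if "Suc b \<le> i" "i < p" "c \<in> F i j" for c i
      using Suc.prems(5)[of i c] that by simp
  qed (use h(1) h2 b in \<open>simp_all add: h_def\<close>)
  have "p dvd p choose b" by (rule dvd_choose_prime) (use b p Suc.prems in auto)
  then obtain e where e: "p choose b = p * e" by auto
  have gi: "g b \<in> F b j" using Poly_leading[OF Suc.prems(1), of b] Suc.prems(4) by simp
  then have "(g b [^] p) [^] e \<in> W"
    using Suc.prems(5)[OF _ b gi] subgroup_closed(5)[OF W(1)] by auto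
  then have "g b [^] (p choose b) \<in> W"
    using e F_carrier[OF gi] by (simp add: nat_pow_pow)
  moreover have "g p = g b [^] (p choose b) \<otimes> h p" unfolding h_def by (rule fun_cong[OF h(3)])
  ultimately show ?case using hp subgroup_closed(3)[OF W(1)] by metis
qed

end

section \<open>The Hall-Petrescu formula and p-th powers of commutators\<close>

context group
begin

text \<open>The correction term \<open>h m\<close> is a polynomial sequence that is trivial at 0 and
  1, so its Taylor expansion starts in weight 2. Hence \<open>W\<close> only has to absorb
  \<open>p\<close>-th powers from \<open>E 2\<close> and the last term \<open>E p\<close>.\<close>

lemma hall_petrescu:
  assumes p: "Factorial_Ring.prime (p::nat)"
    and E: "\<And>k. subgroup (E k) G" "\<And>k. E (Suc k) \<subseteq> E k"
      "\<And>k l u v. u \<in> E k \<Longrightarrow> v \<in> E l \<Longrightarrow> commutator u v \<in> E (k + l)"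
    and W: "subgroup W G" "E p \<subseteq> W" "\<And>c. c \<in> E 2 \<Longrightarrow> c [^] p \<in> W"
    and xy: "x \<in> E 1" "y \<in> E 1"
  shows "\<exists>w\<in>W. (y \<otimes> x) [^] p = y [^] p \<otimes> w \<otimes> x [^] p"
proof -
  interpret filtered_group G "\<lambda>k j. E k"
    by (intro filtered_group.intro filtered_group_axioms.intro is_group) (use E in auto)
  have c: "x \<in> carrier G" "y \<in> carrier G" using F_carrier xy by auto
  define h where "h = (\<lambda>m::nat. inv (y [^] m) \<otimes> ((y \<otimes> x) [^] m \<otimes> inv (x [^] m)))"
  have 1: "(\<lambda>m. (y \<otimes> x) [^] m \<otimes> inv (x [^] m)) \<in> Poly 0 0"
    by (rule Poly_pow_quotient(1)) (use xy in auto)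
  have 2: "(\<lambda>m. inv (y [^] m)) \<in> Poly 0 0"
    by (rule Poly_inv[OF Poly_pow]) (use xy in auto)
  have hP: "h \<in> Poly 0 0"
    unfolding h_def by (rule Poly_mult[OF 2 1])
  have h1: "h m = \<one>" if "m < 2" for m
  proof -
    have "m = 0 \<or> m = 1" using that by auto
    then show ?thesis using c by (auto simp: h_def word_simps)
  qed
  have "h p \<in> W"
  proof (rule Poly_prime_value[where g = h and b = 2 and W = W, OF p W(1,2)])
    show "c [^] p \<in> W" if "2 \<le> i" "i < p" "c \<in> E i" for c i
      using W(3) lift_Suc_antimono_le[of E, OF E(2) that(1)] that(3) by blast
    show "h m = \<one>" if "m < 2" for m by (rule h1[OF that])
  qed (use prime_ge_2_nat[OF p] hP in auto)
  moreover have "(y \<otimes> x) [^] p = y [^] p \<otimes> h p \<otimes> x [^] p"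
    using c by (simp add: h_def word_simps)
  ultimately show ?thesis by blast
qed

text \<open>With this indexing weights add under commutators. Truncated subtraction makes
  \<open>gam 0\<close> and \<open>gam 1\<close> both the whole group, which keeps the rule valid at
  index 0.\<close>

definition gam :: "nat \<Rightarrow> 'a set" where
  "gam i = lower_central G (i - 1)"

lemma gam_normal: "gam i \<lhd> G"
  unfolding gam_def by (rule lower_central_normal)

lemma gam_subgroup: "subgroup (gam i) G"
  unfolding gam_def by (rule lower_central_subgroup)

lemma gam_carrier: "u \<in> gam i \<Longrightarrow> u \<in> carrier G"
  using gam_subgroup subgroup_closed(4) by blast

lemma gam_0_1: "gam 0 = carrier G" "gam (Suc 0) = carrier G"
  by (simp_all add: gam_def)

lemma gam_antimono: "i \<le> j \<Longrightarrow> gam j \<subseteq> gam i"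
  unfolding gam_def by (rule lower_central_antimono) auto

lemma gam_antimonoD: "u \<in> gam j \<Longrightarrow> i \<le> j \<Longrightarrow> u \<in> gam i"
  using gam_antimono by blast

lemma gam_commutator:
  assumes "u \<in> gam i" "v \<in> gam j" "k \<le> i + j"
  shows "commutator u v \<in> gam k"
proof -
  have "commutator u v \<in> gam (i + j)"
  proof (cases "i = 0 \<or> j = 0")
    case True
    then show ?thesis using assms normal_commutator[OF gam_normal] gam_carrier by auto
  next
    case False
    then have "Suc (i - 1 + (j - 1)) = i + j - 1" by linarith
    then show ?thesis
      using lower_central_bicommutator[of u "i - 1" v "j - 1"] assms unfolding gam_def by metis
  qed
  then show ?thesis using assms(3) gam_antimonoD by blast
qed

lemma gam_commutator_carrier:
  assumes "u \<in> gam i" "v \<in> carrier G" "k \<le> Suc i"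
  shows "commutator u v \<in> gam k" "commutator v u \<in> gam k"
  using gam_commutator[of u i v 1 k] gam_commutator[of v 1 u i k] assms by (simp_all add: gam_0_1)

lemma gam_generate_incl:
  assumes "subgroup H G" "1 \<le> i" "\<And>h g. h \<in> gam i \<Longrightarrow> g \<in> carrier G \<Longrightarrow> commutator g h \<in> H"
  shows "gam (Suc i) \<subseteq> H"
proof -
  have "commutator h g \<in> H" if "h \<in> gam i" "g \<in> carrier G" for h g
    using assms(3)[OF that] commutator_mod_sym[OF assms(1)] that gam_carrier by blast
  then have "lower_central G (Suc (i - 1)) \<subseteq> H"
    unfolding gam_def by (intro lower_central_generate_incl[OF assms(1)]) auto
  then show ?thesis using assms(2) unfolding gam_def by simp
qed

lemma centralizer_mod_subgroup':
  assumes N: "N \<lhd> G" and S: "S \<subseteq> carrier G"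
  shows "subgroup {v \<in> carrier G. \<forall>u\<in>S. commutator v u \<in> N} G"
proof -
  have "{v \<in> carrier G. \<forall>u\<in>S. commutator v u \<in> N} = {v \<in> carrier G. \<forall>u\<in>S. commutator u v \<in> N}"
    using commutator_mod_sym N S normal_inv_iff by (meson subsetD)
  then show ?thesis using centralizer_mod_subgroup[OF assms] by simp
qed

text \<open>\<open>S\<close> is central modulo \<open>N\<close>, so adjoining the single element
  \<open>x\<close> gives a group that is abelian modulo \<open>N\<close>. For
  \<open>S = gam i\<close> and \<open>N = gam (Suc i)\<close> this places the commutators of
  weight-one elements in \<open>gam (Suc i)\<close> instead of just \<open>gam 2\<close>.\<close>

lemma cyclic_extension_commutator:
  assumes x: "x \<in> carrier G" and N: "N \<lhd> G" and S: "S \<subseteq> carrier G"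
    and SN: "\<And>u v. u \<in> S \<Longrightarrow> v \<in> carrier G \<Longrightarrow> commutator u v \<in> N"
  shows "\<lbrakk>u \<in> generate G (insert x S); v \<in> generate G (insert x S)\<rbrakk> \<Longrightarrow> commutator u v \<in> N"
proof -
  let ?H = "generate G (insert x S)"
  have N1: "\<one> \<in> N" and Nsub: "subgroup N G" using N normal_inv_iff subgroup_closed(1) by blast+
  have H: "?H \<subseteq> carrier G" by (rule generate_incl) (use x S in auto)
  have SN': "commutator v u \<in> N" if "u \<in> S" "v \<in> carrier G" for u v
    using SN[OF that] commutator_mod_sym[OF Nsub] that S by blast
  have 1: "?H \<subseteq> {v \<in> carrier G. \<forall>u\<in>{x}. commutator v u \<in> N}"
    by (rule generate_subgroup_incl[OF _ centralizer_mod_subgroup'[OF N]]) (use x S SN N1 in auto)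
  have "?H \<subseteq> {v \<in> carrier G. \<forall>u\<in>?H. commutator u v \<in> N}"
    by (rule generate_subgroup_incl[OF _ centralizer_mod_subgroup[OF N H]]) (use x S SN' N1 1 H in auto)
  then show "\<lbrakk>u \<in> ?H; v \<in> ?H\<rbrakk> \<Longrightarrow> commutator u v \<in> N" by auto
qed

lemma hall_petrescu_gam:
  assumes p: "Factorial_Ring.prime (p::nat)" and x: "x \<in> carrier G" and y: "y \<in> gam i" and i: "1 \<le> i"
    and W: "subgroup W G" "gam (i + p - 1) \<subseteq> W" "\<And>c. c \<in> gam (Suc i) \<Longrightarrow> c [^] p \<in> W"
  shows "\<exists>w\<in>W. (y \<otimes> x) [^] p = y [^] p \<otimes> w \<otimes> x [^] p"
proof -
  define H where "H = generate G (insert x (gam i))"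
  \<comment> \<open>Weights 0 and 1 share the group \<open>H\<close>. From weight 2 on the lower
    central series can be used with shift \<open>i - 1\<close>, because commutators within
    \<open>H\<close> already lie in \<open>gam (Suc i)\<close>.\<close>
  define E where "E = (\<lambda>k. if k \<le> 1 then H else gam (i + k - 1))"
  have sub: "insert x (gam i) \<subseteq> carrier G" using x gam_carrier by auto
  have H: "x \<in> H" "gam i \<subseteq> H" "H \<subseteq> carrier G" "subgroup H G"
    unfolding H_def using generate.incl[of _ "insert x (gam i)"] generate_incl[OF sub] generate_is_subgroup[OF sub]
    by auto
  have HH: "commutator u v \<in> gam (Suc i)" if "u \<in> H" "v \<in> H" for u v
    by (rule cyclic_extension_commutator[OF x gam_normal[of "Suc i"] _ _ that[unfolded H_def]])
      (use gam_carrier gam_commutator_carrier in auto)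
  have E_comm: "commutator u v \<in> E (k + l)" if "u \<in> E k" "v \<in> E l" for k l u v
  proof -
    consider "k \<le> 1" "l \<le> 1" | "k \<le> 1" "1 < l" | "1 < k" "l \<le> 1" | "1 < k" "1 < l" by linarith
    then show ?thesis
    proof cases
      case 1
      then have c: "commutator u v \<in> gam (Suc i)" using that HH by (simp add: E_def)
      have "k + l \<le> 1 \<or> i + (k + l) - 1 = Suc i" using 1 by linarith
      then show ?thesis using c H(2) gam_antimonoD[OF c, of i] by (auto simp: E_def)
    next
      case 2
      then have "commutator u v \<in> gam (Suc (i + l - 1))"
        using that H by (intro gam_commutator_carrier) (auto simp: E_def)
      then show ?thesis using 2 i by (auto simp: E_def elim: gam_antimonoD)
    next
      case 3
      then have "commutator u v \<in> gam (Suc (i + k - 1))"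
        using that H by (intro gam_commutator_carrier) (auto simp: E_def)
      then show ?thesis using 3 i by (auto simp: E_def elim: gam_antimonoD)
    next
      case 4
      then show ?thesis using that i unfolding E_def by (auto intro: gam_commutator)
    qed
  qed
  show ?thesis
  proof (rule hall_petrescu[of p E W x y])
    show "commutator u v \<in> E (k + l)" if "u \<in> E k" "v \<in> E l" for k l u v by (rule E_comm[OF that])
    show "subgroup (E k) G" for k using H gam_subgroup by (simp add: E_def)
    show "E (Suc k) \<subseteq> E k" for k
      using H gam_antimono[of i "i + Suc k - 1"] gam_antimono[of "i + k - 1" "i + Suc k - 1"] by (auto simp: E_def)
    show "E p \<subseteq> W" using W prime_ge_2_nat[OF p] by (simp add: E_def)
    show "c [^] p \<in> W" if "c \<in> E 2" for c using that W by (simp add: E_def)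
    show "x \<in> E 1" "y \<in> E 1" using H y by (auto simp: E_def)
    show "Factorial_Ring.prime p" "subgroup W G" by fact+
  qed
qed

text \<open>Conjugation by \<open>g\<close> sends \<open>z\<close> to
  \<open>commutator g z \<otimes> z\<close>. This exhibits a commutator with a power as a quotient
  of two powers, the shape that the Hall-Petrescu formula handles.\<close>

lemma commutator_pow_right:
  assumes "g \<in> carrier G" "z \<in> carrier G"
  shows "commutator g (z [^] (m::nat)) = (commutator g z \<otimes> z) [^] m \<otimes> inv (z [^] m)"
proof -
  have "commutator g z \<otimes> z = g \<otimes> z \<otimes> inv g"
    using assms by (simp add: commutator_def word_simps)
  then show ?thesis using assms by (simp add: conj_pow commutator_def)
qed

lemma commutator_pow_self:
  assumes "x \<in> carrier G"
  shows "commutator (x [^] (m::nat)) x = \<one>"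
proof -
  have "x [^] m \<otimes> x = x \<otimes> x [^] m" using nat_pow_Suc2[OF assms] by simp
  then show ?thesis using assms by (simp add: commutator_def m_assoc)
qed

text \<open>The bridge between \<open>x [^] p\<close> and \<open>commutator g x [^] p\<close>, later
  crossed in both directions.\<close>

lemma commutator_pow_prime:
  assumes p: "Factorial_Ring.prime (p::nat)" and x: "x \<in> carrier G" and g: "g \<in> carrier G"
    and y: "commutator g x \<in> gam i" and i: "1 \<le> i"
    and W: "subgroup W G" "gam (i + p - 1) \<subseteq> W" "\<And>c. c \<in> gam (Suc i) \<Longrightarrow> c [^] p \<in> W"
  shows "\<exists>w\<in>W. commutator g (x [^] p) = commutator g x [^] p \<otimes> w"
proof -
  obtain w where w: "w \<in> W" "(commutator g x \<otimes> x) [^] p = commutator g x [^] p \<otimes> w \<otimes> x [^] p"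
    using hall_petrescu_gam[OF p x y i W] by blast
  then have "w \<in> carrier G" using W subgroup_closed(4) by blast
  then show ?thesis using w x g by (auto simp: commutator_pow_right m_assoc)
qed

text \<open>In maximal class, if this subgroup contains \<open>gam (Suc i)\<close> with
  \<open>i >= 2\<close>, then one element of \<open>gam i\<close> outside \<open>gam (Suc i)\<close>
  decides the matter for all of \<open>gam i\<close>.\<close>

lemma pow_subgroup_aux:
  assumes hp: "\<And>x y. x \<in> gam i \<Longrightarrow> y \<in> gam i \<Longrightarrow> \<exists>w\<in>gam r. (y \<otimes> x) [^] p = y [^] (p::nat) \<otimes> w \<otimes> x [^] p"
  shows "subgroup {u \<in> gam i. u [^] p \<in> gam r} G"
proof (rule subgroupI)
  note sub = subgroup_closed[OF gam_subgroup]
  show "{u \<in> gam i. u [^] p \<in> gam r} \<subseteq> carrier G" using gam_carrier by auto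
  show "{u \<in> gam i. u [^] p \<in> gam r} \<noteq> {}" using sub by (auto intro!: exI[of _ \<one>])
  show "inv a \<in> {u \<in> gam i. u [^] p \<in> gam r}" if "a \<in> {u \<in> gam i. u [^] p \<in> gam r}" for a
    using that sub gam_carrier by (auto simp: nat_pow_inv)
  show "a \<otimes> b \<in> {u \<in> gam i. u [^] p \<in> gam r}"
    if ab: "a \<in> {u \<in> gam i. u [^] p \<in> gam r}" "b \<in> {u \<in> gam i. u [^] p \<in> gam r}" for a b
  proof -
    obtain w where w: "w \<in> gam r" "(a \<otimes> b) [^] p = a [^] p \<otimes> w \<otimes> b [^] p"
      using hp[of b a] ab by blast
    then have "(a \<otimes> b) [^] p \<in> gam r" using ab sub(3) by simp
    then show ?thesis using ab sub(3) by simp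
  qed
qed

lemma pow_subgroup:
  assumes p: "Factorial_Ring.prime (p::nat)" and i: "1 \<le> i"
    and W: "gam (i + p - 1) \<subseteq> gam r" "\<And>c. c \<in> gam (Suc i) \<Longrightarrow> c [^] p \<in> gam r"
  shows "subgroup {u \<in> gam i. u [^] p \<in> gam r} G"
  by (rule pow_subgroup_aux, rule hall_petrescu_gam[OF p gam_carrier _ i gam_subgroup W])

end

section \<open>Groups of maximal class\<close>

locale maximal_class_group = group +
  fixes p n :: nat
  assumes maximal: "maximal_class p n G" and n_gt_2: "2 < n"
begin

lemma p_prime: "Factorial_Ring.prime p"
  using maximal by (simp add: maximal_class_def)

lemma p_ge_2: "2 \<le> p" by (rule prime_ge_2_nat[OF p_prime])

lemma order_eq: "order G = p ^ n"
  using maximal by (simp add: maximal_class_def)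

lemma finite_carrier: "finite (carrier G)"
proof -
  have "order G > 0" using order_eq p_ge_2 by simp
  then show ?thesis using order_gt_0_iff_finite by blast
qed

lemma finite_subgroup: "subgroup H G \<Longrightarrow> finite H"
  using finite_carrier finite_subset subgroup.subset by blast

lemma lower_central_class:
  "lower_central G (n - 1) = {\<one>}" "c < n - 1 \<Longrightarrow> lower_central G c \<noteq> {\<one>}"
proof -
  have 1: "\<exists>c. lower_central G c = {\<one>}" "(LEAST c. lower_central G c = {\<one>}) = n - 1"
    using maximal unfolding maximal_class_def nilpotent_def nilpotency_class_def by blast+
  show "lower_central G (n - 1) = {\<one>}" using LeastI_ex[OF 1(1)] unfolding 1(2) .
  show "c < n - 1 \<Longrightarrow> lower_central G c \<noteq> {\<one>}"
    using not_less_Least[of c "\<lambda>c. lower_central G c = {\<one>}"] 1(2) by simp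
qed

lemma gam_trivial: "n \<le> i \<Longrightarrow> gam i = {\<one>}"
  using gam_antimono[of n i] lower_central_class(1) subgroup_closed(1)[OF gam_subgroup]
  unfolding gam_def by auto

lemma gam_strict:
  assumes "1 \<le> i" "i < n"
  shows "gam (Suc i) \<subset> gam i"
proof -
  have "gam (Suc i) \<noteq> gam i"
  proof
    assume eq: "gam (Suc i) = gam i"
    have "lower_central G (i - 1 + d) = lower_central G (i - 1)" for d
    proof (induction d)
      case (Suc d)
      then have "lower_central G (i - 1 + Suc d) = lower_central G (Suc (i - 1))"
        by (simp del: lower_central.simps add: lower_central.simps(2))
      then show ?case using eq assms by (simp add: gam_def)
    qed simp
    from this[of "n - i"] have "lower_central G (i - 1) = lower_central G (n - 1)"
      using assms by simp
    then show False using lower_central_class[of] lower_central_class(2)[of "i - 1"] assms by auto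
  qed
  then show ?thesis using gam_antimono[of i "Suc i"] by auto
qed

section \<open>Orders of subgroups and the position of elements in the lower central series\<close>

lemma card_subgroup: "subgroup H G \<Longrightarrow> \<exists>e\<le>n. card H = p ^ e"
proof -
  assume "subgroup H G"
  then have "card H dvd p ^ n" using lagrange order_eq by (metis dvd_triv_right)
  then show ?thesis using divides_primepow_nat[OF p_prime] by blast
qed

lemma card_subgroup_step:
  assumes "subgroup H G" "subgroup K G" "H \<subset> K"
  shows "p * card H \<le> card K"
proof -
  obtain a b where ab: "card H = p ^ a" "card K = p ^ b" using card_subgroup assms by meson
  have "card H < card K" using assms finite_subgroup by (simp add: psubset_card_mono)
  then have "a < b" using ab p_ge_2 by (simp add: power_strict_increasing_iff)
  then have "p ^ Suc a \<le> p ^ b" using p_ge_2 by (intro power_increasing) auto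
  then show ?thesis using ab by simp
qed

lemma subgroup_between:
  assumes "subgroup H G" "subgroup K G" "subgroup L G" "H \<subset> K" "K \<subseteq> L" "card L \<le> p * card H"
  shows "K = L"
  using card_subgroup_step[OF assms(1,2,4)] assms finite_subgroup[OF assms(3)]
  by (intro card_subset_eq) (auto simp: card_mono order_antisym)

text \<open>A group with a central subgroup of prime index is abelian; here modulo \<open>N\<close>.\<close>
lemma central_maximal_subgroup:
  assumes H: "subgroup H G" "p ^ n \<le> p * card H" and N: "N \<lhd> G"
    and c: "\<And>h g. h \<in> H \<Longrightarrow> g \<in> carrier G \<Longrightarrow> commutator g h \<in> N"
    and gh: "g \<in> carrier G" "h \<in> carrier G"
  shows "commutator g h \<in> N"
proof (rule ccontr)
  assume nc: "commutator g h \<notin> N"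
  note Nsub = N[unfolded normal_inv_iff, THEN conjunct1]
  note card_le = H(2)[folded order_eq, unfolded order_def]
  define Z where "Z = {w \<in> carrier G. \<forall>u\<in>carrier G. commutator u w \<in> N}"
  have Z: "subgroup Z G" unfolding Z_def by (rule centralizer_mod_subgroup[OF N]) simp
  have HZ: "H \<subseteq> Z" using c H(1) subgroup_closed(4) by (auto simp: Z_def)
  define C where "C = {w \<in> carrier G. \<forall>u\<in>{h}. commutator w u \<in> N}"
  have C: "subgroup C G" unfolding C_def by (rule centralizer_mod_subgroup'[OF N]) (use gh in simp)
  have hH: "h \<notin> H" using nc c gh by auto
  have "H \<subseteq> C"
    using c[OF _ gh(2)] commutator_mod_sym[OF Nsub gh(2)] subgroup_closed(4)[OF H(1)] by (auto simp: C_def)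
  moreover have "h \<in> C" using gh subgroup_closed(1)[OF Nsub] by (simp add: C_def)
  ultimately have "C = carrier G"
    using hH subgroup_between[OF H(1) C subgroup_self _ _ card_le] subgroup_closed(4)[OF C] by blast
  then show False using nc gh by (auto simp: C_def)
qed

lemma card_gam: "2 \<le> i \<Longrightarrow> i \<le> n \<Longrightarrow> card (gam i) = p ^ (n - i)"
proof -
  have lower: "i \<le> n \<Longrightarrow> 1 \<le> i \<Longrightarrow> p ^ (n - i) \<le> card (gam i)" for i
  proof (induction "n - i" arbitrary: i)
    case 0
    then show ?case using gam_trivial by simp
  next
    case (Suc d)
    then have "p ^ (n - Suc i) \<le> card (gam (Suc i))" by simp
    moreover have "p * card (gam (Suc i)) \<le> card (gam i)"
      using Suc by (intro card_subgroup_step gam_subgroup gam_strict) auto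
    moreover have "p ^ (n - i) = p * p ^ (n - Suc i)" using Suc by (simp flip: power_Suc add: Suc_diff_Suc)
    ultimately show ?case using mult_le_mono2 order_trans by metis
  qed
  \<comment> \<open>The abelianization has order more than \<open>p\<close>: otherwise
    \<open>gam 2\<close>, central modulo \<open>gam 3\<close>, would have index at most
    \<open>p\<close>, making the group abelian modulo \<open>gam 3\<close> and forcing
    \<open>gam 2 = gam 3\<close>.\<close>
  have upper2: "card (gam 2) \<le> p ^ (n - 2)"
  proof -
    obtain e where e: "card (gam 2) = p ^ e" using card_subgroup gam_subgroup by blast
    have "\<not> p ^ n \<le> p * card (gam 2)"
    proof
      assume le: "p ^ n \<le> p * card (gam 2)"
      have "commutator g h \<in> gam 3" if "g \<in> carrier G" "h \<in> carrier G" for g h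
        by (rule central_maximal_subgroup[OF gam_subgroup le gam_normal _ that])
          (use gam_commutator_carrier in auto)
      then have "gam (Suc 1) \<subseteq> gam 3"
        by (intro gam_generate_incl gam_subgroup) (auto simp: gam_0_1)
      then show False using gam_strict[of 2] n_gt_2 by (simp add: numeral_eq_Suc)
    qed
    then have "p ^ Suc e < p ^ n" using e by simp
    then have "Suc e < n" using p_ge_2 by (metis linorder_not_less power_increasing one_le_numeral order_trans)
    then show ?thesis unfolding e using p_ge_2 by (intro power_increasing) auto
  qed
  have upper: "2 \<le> i \<Longrightarrow> i \<le> n \<Longrightarrow> card (gam i) \<le> p ^ (n - i)" for i
  proof (induction i rule: nat_induct_at_least)
    case base
    then show ?case using upper2 by simp
  next
    case (Suc i)
    have "p * card (gam (Suc i)) \<le> card (gam i)"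
      using Suc by (intro card_subgroup_step gam_subgroup gam_strict) auto
    moreover have "p ^ (n - i) = p * p ^ (n - Suc i)" using Suc by (simp flip: power_Suc add: Suc_diff_Suc)
    ultimately have "p * card (gam (Suc i)) \<le> p * p ^ (n - Suc i)"
      using Suc.IH Suc.prems by (metis Suc_leD le_trans)
    moreover have "0 < p" using p_ge_2 by simp
    ultimately show ?case by (simp only: nat_mult_le_cancel1)
  qed
  show "2 \<le> i \<Longrightarrow> i \<le> n \<Longrightarrow> card (gam i) = p ^ (n - i)"
    using lower[of i] upper[of i] by simp
qed

lemma gam_index:
  assumes "2 \<le> i"
  shows "card (gam i) \<le> p * card (gam (Suc i))"
proof (cases "i < n")
  case True
  then have "p ^ (n - i) = p * p ^ (n - Suc i)" by (simp flip: power_Suc add: Suc_diff_Suc)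
  then show ?thesis using card_gam assms True by simp
next
  case False
  then show ?thesis using gam_trivial p_ge_2 by simp
qed

text \<open>The factor of \<open>gam i\<close> by \<open>gam (Suc i)\<close> has prime order, so any
  element outside \<open>gam (Suc i)\<close> generates it.\<close>

lemma gam_span:
  assumes "2 \<le> i" "u \<in> gam i" "u \<notin> gam (Suc i)" "subgroup S G" "gam (Suc i) \<subseteq> S" "u \<in> S"
  shows "gam i \<subseteq> S"
proof -
  have "S \<inter> gam i = gam i"
    by (rule subgroup_between[OF gam_subgroup[of "Suc i"] _ gam_subgroup[of i] _ _ gam_index[OF assms(1)]])
      (use assms gam_subgroup gam_antimono[of i "Suc i"] subgroups_Inter_pair in auto)
  then show ?thesis by auto
qed

text \<open>In maximal class the upper and lower central series coincide. If \<open>u\<close> left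
  the lower series at some \<open>j < i\<close>, then \<open>u\<close> and
  \<open>gam (Suc j)\<close> would force all of \<open>gam j\<close> to be central modulo
  \<open>gam (Suc (Suc j))\<close>, and the series would stop too early.\<close>

lemma upper_central:
  assumes i: "1 \<le> i" "i < n" and u: "u \<in> carrier G" and c: "\<And>g. g \<in> carrier G \<Longrightarrow> commutator g u \<in> gam (Suc i)"
  shows "u \<in> gam i"
proof (rule ccontr)
  assume ui: "u \<notin> gam i"
  have "\<exists>j. 1 \<le> j \<and> j < i \<and> u \<in> gam j \<and> u \<notin> gam (Suc j)"
    using i ui
  proof (induction i rule: nat_induct_at_least)
    case base
    then show ?case using u gam_0_1 by simp
  next
    case (Suc i)
    then show ?case by (metis Suc_lessD less_Suc_eq)
  qed
  then obtain j where j: "1 \<le> j" "j < i" "u \<in> gam j" "u \<notin> gam (Suc j)" by blast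
  define C where "C = {w \<in> carrier G. \<forall>g\<in>carrier G. commutator g w \<in> gam (Suc (Suc j))}"
  have C: "subgroup C G" unfolding C_def by (rule centralizer_mod_subgroup[OF gam_normal]) simp
  have uC: "u \<in> C" using u c j gam_antimonoD[OF c] by (auto simp: C_def)
  have gC: "gam (Suc j) \<subseteq> C" using gam_commutator_carrier gam_carrier by (auto simp: C_def)
  have "gam j \<subseteq> C"
  \<comment> \<open>\<open>gam_span\<close> relies on prime index, but \<open>gam 2\<close> has
    index \<open>p ^ 2\<close> in the whole group; for \<open>j = 1\<close> the subgroup
    \<open>C\<close> is a central subgroup of index at most \<open>p\<close> instead.\<close>
  proof (cases "j = 1")
    case True
    have "p * card (gam 2) = p ^ (n - 1)" using card_gam[of 2] n_gt_2 by (simp flip: power_Suc add: Suc_diff_Suc numeral_2_eq_2)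
    moreover have "p * card (gam 2) \<le> card C"
      by (rule card_subgroup_step[OF gam_subgroup C]) (use uC gC j True in \<open>auto simp: numeral_2_eq_2\<close>)
    ultimately have "p * p ^ (n - 1) \<le> p * card C" using mult_le_mono2 by metis
    then have "p ^ n \<le> p * card C" using n_gt_2 by (simp flip: power_Suc)
    from central_maximal_subgroup[OF C this gam_normal]
    have "commutator g h \<in> gam (Suc (Suc j))" if "g \<in> carrier G" "h \<in> carrier G" for g h
      using that by (simp add: C_def)
    then show ?thesis using True by (auto simp: C_def gam_0_1)
  next
    case False
    then show ?thesis using gam_span[OF _ j(3,4) C gC uC] j by simp
  qed
  then have "gam (Suc j) \<subseteq> gam (Suc (Suc j))"
    using j by (intro gam_generate_incl gam_subgroup) (auto simp: C_def)
  then show False using gam_strict[of "Suc j"] j i by auto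
qed

text \<open>Properness holds because otherwise the lower central series would become stationary at
  \<open>gam (Suc i)\<close>.\<close>

lemma two_step_centralizer:
  assumes "2 \<le> i" "Suc i < n"
  defines "C \<equiv> {s \<in> carrier G. \<forall>u\<in>gam i. commutator u s \<in> gam (Suc (Suc i))}"
  shows "subgroup C G" "C \<noteq> carrier G" "gam 2 \<subseteq> C"
proof -
  show "subgroup C G" unfolding C_def using gam_carrier by (intro centralizer_mod_subgroup gam_normal) auto
  show "gam 2 \<subseteq> C" unfolding C_def using gam_carrier by (auto intro: gam_commutator)
  show "C \<noteq> carrier G"
  proof
    assume *: "C = carrier G"
    have "commutator g h \<in> gam (Suc (Suc i))" if "h \<in> gam i" "g \<in> carrier G" for g h
    proof -
      have "g \<in> C" using that * by simp
      then have "commutator h g \<in> gam (Suc (Suc i))" using that unfolding C_def by blast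
      then show ?thesis using commutator_mod_sym[OF gam_subgroup gam_carrier[OF that(1)] that(2)] by blast
    qed
    then have "gam (Suc i) \<subseteq> gam (Suc (Suc i))"
      using assms by (intro gam_generate_incl gam_subgroup) auto
    then show False using gam_strict[of "Suc i"] assms by auto
  qed
qed

section \<open>Upper bounds for p-th powers\<close>

lemma pow_coprime_mem:
  assumes S: "subgroup S G" and z: "z \<in> carrier G" and d: "z [^] (d::nat) \<in> S" "coprime d p"
  shows "z \<in> S"
proof -
  obtain x where x: "[d * x = 1] (mod p ^ n)"
    using cong_solve_coprime_nat[of d "p ^ n"] d by (auto simp: coprime_power_right_iff)
  have zn: "z [^] (p ^ n) = \<one>" using pow_order_eq_1[OF z] order_eq by simp
  have "p ^ n \<noteq> 1" using p_ge_2 n_gt_2 by simp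
  then obtain q where q: "d * x = 1 + q * p ^ n" using x unfolding cong_to_1'_nat by blast
  have "z [^] (d * x) = z \<otimes> (z [^] (p ^ n)) [^] q"
    unfolding q by (simp only: plus_1_eq_Suc nat_pow_Suc2[OF z] nat_pow_pow[OF z] mult.commute)
  then have "z [^] (d * x) = z" using z zn by simp
  then have "z = (z [^] d) [^] x" using z by (simp add: nat_pow_pow)
  then show ?thesis using subgroup_closed(5)[OF S d(1)] by metis
qed

text \<open>Pigeonhole: the \<open>(p + 1) * card H\<close> pairs cannot give distinct products in
  \<open>K\<close>, so some \<open>z [^] e\<close> with \<open>0 < e\<close> and
  \<open>e <= p\<close> lies in \<open>H\<close>. If \<open>e < p\<close>, then \<open>e\<close> is
  prime to \<open>p\<close> and \<open>z\<close> itself lies in \<open>H\<close>.\<close>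

lemma prime_index_pow:
  assumes H: "subgroup H G" and K: "subgroup K G" "card K \<le> p * card H" "H \<subseteq> K" and z: "z \<in> K"
  shows "z [^] p \<in> H"
proof -
  have zc: "z \<in> carrier G" using z K subgroup_closed(4) by blast
  have "\<not> inj_on (\<lambda>(a, h). h \<otimes> z [^] a) ({..p} \<times> H)"
  proof
    assume inj: "inj_on (\<lambda>(a, h). h \<otimes> z [^] a) ({..p} \<times> H)"
    have "(\<lambda>(a, h). h \<otimes> z [^] a) ` ({..p} \<times> H) \<subseteq> K"
      using z K subgroup_closed[OF K(1)] by auto
    then have "card ({..p} \<times> H) \<le> card K"
      using card_inj_on_le[OF inj] finite_subgroup[OF K(1)] by blast
    then have "Suc p * card H \<le> p * card H" using K(2) by (simp add: card_cartesian_product)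
    moreover have "card H > 0" using finite_subgroup[OF H] subgroup_closed(1)[OF H] card_gt_0_iff by blast
    ultimately show False by simp
  qed
  then obtain a b h k where ab: "a \<le> p" "b \<le> p" "h \<in> H" "k \<in> H" "(a, h) \<noteq> (b, k)" "h \<otimes> z [^] a = k \<otimes> z [^] b"
    by (auto simp: inj_on_def)
  have main: "z [^] p \<in> H" if "a < b" "b \<le> p" "h \<in> H" "k \<in> H" "h \<otimes> z [^] a = k \<otimes> z [^] b" for a b h k
  proof -
    have hk: "h \<in> carrier G" "k \<in> carrier G" using that H subgroup_closed(4) by blast+
    have "z [^] b = z [^] (b - a) \<otimes> z [^] a" using that zc by (simp add: nat_pow_mult)
    then have "h \<otimes> z [^] a = (k \<otimes> z [^] (b - a)) \<otimes> z [^] a" using that hk zc by (simp add: m_assoc)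
    then have "h = k \<otimes> z [^] (b - a)" using hk zc by simp
    then have "z [^] (b - a) = inv k \<otimes> h" using hk zc by (simp add: inv_cancel_left)
    then have zd: "z [^] (b - a) \<in> H" using that subgroup_closed[OF H] by auto
    show ?thesis
    proof (cases "b - a = p")
      case False
      then have "\<not> p dvd b - a" using that by (auto dest: dvd_imp_le)
      then have "coprime (b - a) p" using prime_imp_coprime[OF p_prime, of "b - a"] coprime_commute by blast
      then show ?thesis using pow_coprime_mem[OF H zc zd] subgroup_closed(5)[OF H] by blast
    qed (use zd in simp)
  qed
  show ?thesis
  proof (cases "a = b")
    case True
    then show ?thesis using ab zc subgroup_closed(4)[OF H] by auto
  next
    case False
    then show ?thesis using main[of a b h k] main[of b a k h] ab by (metis nat_neq_iff)
  qed
qed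

text \<open>If some \<open>y = [g, s]\<close> with \<open>s \<notin> gam 2\<close> had \<open>y ^ p \<notin> gam (Suc r)\<close>, then \<open>s ^ p\<close> would
  generate \<open>gam (r - 1)\<close> modulo \<open>gam r\<close>, so \<open>s\<close> would centralize \<open>gam (r - 1)\<close> modulo
  \<open>gam (Suc r)\<close>; it can be chosen not to.\<close>
lemma gam_2_pow_step:
  assumes r: "3 \<le> r" "r < n" "r \<le> p"
    and IH: "\<And>c. c \<in> gam 2 \<Longrightarrow> c [^] p \<in> gam r"
    and IH3: "\<And>c. c \<in> gam 3 \<Longrightarrow> c [^] p \<in> gam (Suc r)"
    and z: "z \<in> gam 2"
  shows "z [^] p \<in> gam (Suc r)"
proof (rule ccontr)
  assume nz: "z [^] p \<notin> gam (Suc r)"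
  note W = gam_subgroup[of "Suc r"]
  have W2: "gam (2 + p - 1) \<subseteq> gam (Suc r)" using r by (intro gam_antimono) auto
  have IH3': "\<And>c. c \<in> gam (Suc 2) \<Longrightarrow> c [^] p \<in> gam (Suc r)" using IH3 by (simp add: numeral_3_eq_3 numeral_2_eq_2)
  define U where "U = {u \<in> gam 2. u [^] p \<in> gam (Suc r)}"
  have U: "subgroup U G" unfolding U_def by (rule pow_subgroup[OF p_prime _ W2 IH3']) auto
  define C where "C = {s \<in> carrier G. \<forall>u\<in>gam (r - 1). commutator u s \<in> gam (Suc (Suc (r - 1)))}"
  have r1: "2 \<le> r - 1" "Suc (r - 1) < n" using r by auto
  note C = two_step_centralizer[OF r1, folded C_def]
  obtain s where s: "s \<in> carrier G" "s \<notin> C"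
    using C(2) subgroup_closed(4)[OF C(1)] by blast
  have s2: "s \<notin> gam 2" using C(3) s r by auto
  have key: "\<exists>w\<in>gam (Suc r). commutator g (s [^] p) = commutator g s [^] p \<otimes> w" if g: "g \<in> carrier G" for g
    by (rule commutator_pow_prime[OF p_prime s(1) g _ _ W W2 IH3'])
      (use gam_commutator_carrier[of g 1 s 2] s g in \<open>auto simp: gam_0_1\<close>)
  have gs2: "commutator g s \<in> gam 2" if g: "g \<in> carrier G" for g
    using gam_commutator_carrier[of g 1 s 2] s g by (auto simp: gam_0_1)
  have cr: "commutator g (s [^] p) \<in> gam r" if g: "g \<in> carrier G" for g
  proof -
    obtain w where w: "w \<in> gam (Suc r)" "commutator g (s [^] p) = commutator g s [^] p \<otimes> w"
      using key[OF g] by blast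
    have "w \<in> gam r" using w gam_antimono[of r "Suc r"] by auto
    then show ?thesis using w(2) IH[OF gs2[OF g]] subgroup_closed(3)[OF gam_subgroup] by metis
  qed
  have sp: "s [^] p \<in> gam (r - 1)"
    by (rule upper_central) (use r s cr in auto)
  obtain g where g: "g \<in> carrier G" "commutator g s \<notin> gam (Suc 2)"
    using upper_central[of 2 s] s s2 n_gt_2 by auto
  have "commutator g s \<notin> U"
  proof
    assume "commutator g s \<in> U"
    moreover have "gam (Suc 2) \<subseteq> U" unfolding U_def using IH3' gam_antimono[of 2 "Suc 2"] by auto
    ultimately have "gam 2 \<subseteq> U" using gam_span[OF _ gs2[OF g(1)] g(2) U] by simp
    then show False using z nz by (auto simp: U_def)
  qed
  then have ny: "commutator g s [^] p \<notin> gam (Suc r)" using gs2[OF g(1)] by (auto simp: U_def)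
  have "s [^] p \<notin> gam r"
  proof
    assume "s [^] p \<in> gam r"
    then have 1: "commutator g (s [^] p) \<in> gam (Suc r)" using gam_commutator_carrier g by blast
    obtain w where w: "w \<in> gam (Suc r)" "commutator g (s [^] p) = commutator g s [^] p \<otimes> w"
      using key[OF g(1)] by blast
    then show False using 1 ny normal_mult_cancel(2)[OF W w(1), of "commutator g s [^] p"] g s by simp
  qed
  then have sp': "s [^] p \<notin> gam (Suc (r - 1))" using r by simp
  define D where "D = {v \<in> carrier G. \<forall>u\<in>{s}. commutator v u \<in> gam (Suc r)}"
  have D: "subgroup D G" unfolding D_def by (rule centralizer_mod_subgroup'[OF gam_normal]) (use s in simp)
  have "s [^] p \<in> D" using s subgroup_closed(1)[OF W] commutator_pow_self by (simp add: D_def)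
  moreover have "gam (Suc (r - 1)) \<subseteq> D"
    using r s gam_commutator_carrier gam_carrier by (auto simp: D_def)
  ultimately have "gam (r - 1) \<subseteq> D" using gam_span[OF _ sp sp' D] r by simp
  then have "s \<in> C" using s r by (auto simp: C_def D_def)
  then show False using s by simp
qed

text \<open>Outer induction on \<open>r\<close>, inner downward induction on \<open>i\<close>
  starting where \<open>gam i\<close> is already inside \<open>gam (Suc r)\<close>. For
  \<open>i >= 3\<close>, \<open>gam i\<close> is generated by commutators with elements
  \<open>h\<close> of \<open>gam (i - 1)\<close>, and \<open>h [^] p\<close> is in
  \<open>gam r\<close> by the outer hypothesis. For \<open>i = 2\<close> this would involve
  \<open>p\<close>-th powers of arbitrary elements: prime index settles \<open>r = 2\<close>, and a
  well-chosen \<open>s\<close> settles larger \<open>r\<close>.\<close>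

lemma gam_pow: "2 \<le> i \<Longrightarrow> r \<le> i + p - 1 \<Longrightarrow> z \<in> gam i \<Longrightarrow> z [^] p \<in> gam r"
proof (induction r arbitrary: i z)
  case 0
  then show ?case using gam_carrier by (simp add: gam_0_1)
next
  case (Suc r)
  note IH = Suc.IH
  have "\<forall>i z. 2 \<le> i \<longrightarrow> Suc r \<le> i + p - 1 \<longrightarrow> Suc r - i = d \<longrightarrow> z \<in> gam i \<longrightarrow> z [^] p \<in> gam (Suc r)" for d
  proof (induction d)
    case 0
    then show ?case using subgroup_closed(5)[OF gam_subgroup] gam_antimonoD by (metis diff_is_0_eq)
  next
    case (Suc d)
    show ?case
    proof (intro allI impI)
      fix i z assume i: "2 \<le> i" "Suc r \<le> i + p - 1" "Suc r - i = Suc d" and z: "z \<in> gam i"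
      have next_i: "\<And>c. c \<in> gam (Suc i) \<Longrightarrow> c [^] p \<in> gam (Suc r)"
      proof -
        fix c assume c: "c \<in> gam (Suc i)"
        have "2 \<le> Suc i" "Suc r \<le> Suc i + p - 1" "Suc r - Suc i = d" using i by linarith+
        then show "c [^] p \<in> gam (Suc r)" using Suc.IH c by blast
      qed
      have W2: "gam (i + p - 1) \<subseteq> gam (Suc r)" using i by (intro gam_antimono)
      define U where "U = {u \<in> gam i. u [^] p \<in> gam (Suc r)}"
      have U: "subgroup U G" unfolding U_def by (rule pow_subgroup[OF p_prime _ W2 next_i]) (use i in auto)
      consider "n \<le> r" | "r < n" "3 \<le> i" | "r < n" "i = 2" "r = 2" | "r < n" "i = 2" "3 \<le> r"
        using i by linarith
      then show "z [^] p \<in> gam (Suc r)"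
      proof cases
        case 1
        have "z [^] p \<in> gam r" by (rule IH[OF _ _ z]) (use i in auto)
        then show ?thesis using gam_trivial 1 by simp
      next
        case 2
        have "gam (Suc (i - 1)) \<subseteq> U"
        proof (rule gam_generate_incl[OF U])
          fix h g assume h: "h \<in> gam (i - 1)" and g: "g \<in> carrier G"
          have hc: "h \<in> carrier G" using h gam_carrier by blast
          have y: "commutator g h \<in> gam i" using gam_commutator_carrier(2)[OF h g, of i] 2 by simp
          obtain w where w: "w \<in> gam (Suc r)" "commutator g (h [^] p) = commutator g h [^] p \<otimes> w"
            using commutator_pow_prime[OF p_prime hc g y _ gam_subgroup W2 next_i] i by auto
          have "h [^] p \<in> gam r" by (rule IH[OF _ _ h]) (use i 2 in auto)
          then have "commutator g (h [^] p) \<in> gam (Suc r)" using gam_commutator_carrier(2) g by blast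
          then have "commutator g h [^] p \<in> gam (Suc r)"
            using w normal_mult_cancel(2)[OF gam_subgroup w(1), of "commutator g h [^] p"] g hc by simp
          then show "commutator g h \<in> U" using y by (simp add: U_def)
        qed (use 2 in auto)
        then show ?thesis using z 2 by (auto simp: U_def)
      next
        case 3
        then show ?thesis
          using prime_index_pow[OF gam_subgroup gam_subgroup gam_index[of 2] _ z[unfolded 3]] gam_antimono[of 2 "Suc 2"]
          by simp
      next
        case 4
        show ?thesis
        proof (rule gam_2_pow_step)
          show "c [^] p \<in> gam r" if "c \<in> gam 2" for c by (rule IH[OF _ _ that]) (use i 4 in auto)
          show "c [^] p \<in> gam (Suc r)" if "c \<in> gam 3" for c
            using next_i[of c] that 4 by (simp add: numeral_3_eq_3 numeral_2_eq_2)
        qed (use 4 i z in auto)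
      qed
    qed
  qed
  then show ?case using Suc.prems by blast
qed

lemma pow_prime_mem:
  assumes x: "x \<in> carrier G"
  shows "x [^] p \<in> gam (min p (n - 1))"
proof (rule upper_central)
  \<comment> \<open>The cap at \<open>n - 1\<close> comes from \<open>upper_central\<close>, which
    is limited to indices below \<open>n\<close>; for \<open>n <= p\<close> the result places
    \<open>p\<close>-th powers in the last nontrivial term.\<close>
  let ?m = "min p (n - 1)"
  show "1 \<le> ?m" "?m < n" using p_ge_2 n_gt_2 by auto
  show "x [^] p \<in> carrier G" using x by simp
  fix g assume g: "g \<in> carrier G"
  have y: "commutator g x \<in> gam 2" using gam_commutator_carrier[of g 1 x 2] x g by (simp add: gam_0_1)
  have "\<exists>w\<in>gam (Suc ?m). commutator g (x [^] p) = commutator g x [^] p \<otimes> w"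
  proof (rule commutator_pow_prime[OF p_prime x g y _ gam_subgroup])
    show "gam (2 + p - 1) \<subseteq> gam (Suc ?m)" by (rule gam_antimono) auto
    show "c [^] p \<in> gam (Suc ?m)" if "c \<in> gam (Suc 2)" for c
      by (rule gam_pow[OF _ _ that]) auto
  qed simp
  moreover have "commutator g x [^] p \<in> gam (Suc ?m)" by (rule gam_pow[OF _ _ y]) auto
  ultimately show "commutator g (x [^] p) \<in> gam (Suc ?m)"
    using subgroup_closed(3)[OF gam_subgroup] by metis
qed

lemma pow_power_mem:
  assumes "x \<in> carrier G" "p < n"
  shows "x [^] (p ^ Suc j) \<in> gam (1 + Suc j * (p - 1))"
proof (induction j)
  case 0
  then show ?case using pow_prime_mem[OF assms(1)] assms p_ge_2 by (simp add: min_def split: if_splits)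
next
  case (Suc j)
  have "(x [^] (p ^ Suc j)) [^] p \<in> gam (1 + Suc (Suc j) * (p - 1))"
    by (rule gam_pow[OF _ _ Suc]) (use p_ge_2 in \<open>cases p; auto\<close>)+
  then show ?case using assms by (simp add: nat_pow_pow mult.commute)
qed

lemma pow_exponent_bound:
  assumes "x \<in> carrier G" "p < n" "n - 1 \<le> k * (p - 1)"
  shows "x [^] (p ^ k) = \<one>"
proof -
  obtain j where "k = Suc j" using assms n_gt_2 by (cases k) auto
  then show ?thesis using pow_power_mem[OF assms(1,2), of j] gam_trivial[of "1 + Suc j * (p - 1)"] assms by auto
qed

lemma pow_small_class:
  assumes "x \<in> carrier G" "n \<le> p"
  shows "x [^] (p ^ 2) = \<one>"
proof -
  have "min p (n - 1) = n - 1" using assms by simp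
  then have "x [^] p \<in> gam (n - 1)" using pow_prime_mem[OF assms(1)] by simp
  then have "(x [^] p) [^] p \<in> gam n" by (intro gam_pow[of "n - 1" n "x [^] p"]) (use assms n_gt_2 in auto)
  then show ?thesis using assms gam_trivial[of n] by (simp add: nat_pow_pow power2_eq_square)
qed

text \<open>Both error terms of the Hall-Petrescu formula die: \<open>gam p\<close> is trivial, and
  so are the \<open>p\<close>-th powers from \<open>gam 2\<close>. This serves the examples, where
  exponent \<open>p\<close> can then be checked on factors.\<close>

lemma pow_prime_hom:
  assumes "x \<in> carrier G" "y \<in> carrier G" "n \<le> p"
  shows "(y \<otimes> x) [^] p = y [^] p \<otimes> x [^] p"
proof -
  have "\<exists>w\<in>{\<one>}. (y \<otimes> x) [^] p = y [^] p \<otimes> w \<otimes> x [^] p"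
  proof (rule hall_petrescu_gam[OF p_prime assms(1)])
    show "gam (1 + p - 1) \<subseteq> {\<one>}" using assms gam_trivial by simp
    show "c [^] p \<in> {\<one>}" if "c \<in> gam (Suc 1)" for c
      using gam_pow[of 2 n c] that gam_trivial[of n] assms by (simp add: numeral_2_eq_2)
  qed (use assms triv_subgroup gam_0_1 in auto)
  then show ?thesis using assms by auto
qed

text \<open>Below, \<open>x\<close> is an element with \<open>x ^ p \<notin> gam (p + 1)\<close>. It commutes with \<open>x ^ p\<close>, so it centralizes
  \<open>gam p\<close> modulo \<open>gam (p + 2)\<close>, which improves the last term of the filtration.\<close>
lemma gam_2_pow_nontrivial:
  assumes x: "x \<in> carrier G" "x [^] p \<notin> gam (Suc p)" and n: "p + 2 \<le> n" and p: "2 < p"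
  shows "\<exists>z\<in>gam 2. z [^] p \<notin> gam (p + 2)"
proof -
  let ?W = "gam (p + 2)"
  have xp: "x [^] p \<in> gam p" using pow_prime_mem[OF x(1)] n by (simp add: min_def split: if_splits)
  define C where "C = {h \<in> carrier G. \<forall>u\<in>gam p. commutator u h \<in> ?W}"
  have C: "subgroup C G" unfolding C_def using gam_carrier by (intro centralizer_mod_subgroup gam_normal) auto
  have gC: "gam 2 \<subseteq> C" unfolding C_def using gam_carrier by (auto intro: gam_commutator)
  define D where "D = {v \<in> carrier G. \<forall>u\<in>{x}. commutator v u \<in> ?W}"
  have D: "subgroup D G" unfolding D_def by (rule centralizer_mod_subgroup'[OF gam_normal]) (use x in simp)
  have "x [^] p \<in> D" using x subgroup_closed(1)[OF gam_subgroup] commutator_pow_self by (simp add: D_def)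
  moreover have "gam (Suc p) \<subseteq> D" using x gam_commutator_carrier gam_carrier by (auto simp: D_def)
  ultimately have "gam p \<subseteq> D" using gam_span[OF p_ge_2 xp x(2) D] by simp
  then have xC: "x \<in> C" using x by (auto simp: C_def D_def)
  \<comment> \<open>The contrapositive of \<open>upper_central\<close>, applied to
    \<open>x [^] p\<close>. The required \<open>z\<close> will be
    \<open>commutator g x\<close>.\<close>
  obtain g where g: "g \<in> carrier G" "commutator g (x [^] p) \<notin> ?W"
    using upper_central[of "Suc p" "x [^] p"] x n by auto
  define H where "H = generate G (insert x (gam 2))"
  have sub: "insert x (gam 2) \<subseteq> carrier G" using x gam_carrier by auto
  have H: "x \<in> H" "gam 2 \<subseteq> H" "H \<subseteq> carrier G" "subgroup H G"
    unfolding H_def using generate.incl[of _ "insert x (gam 2)"] generate_incl[OF sub] generate_is_subgroup[OF sub]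
    by auto
  have HC: "H \<subseteq> C" unfolding H_def by (rule generate_subgroup_incl[OF _ C]) (use xC gC in auto)
  have HH: "commutator u v \<in> gam 3" if "u \<in> H" "v \<in> H" for u v
    by (rule cyclic_extension_commutator[OF x(1) gam_normal[of 3] _ _ that[unfolded H_def]])
      (use gam_carrier gam_commutator_carrier in auto)
  \<comment> \<open>The plain choice \<open>gam (Suc k)\<close> would end with
    \<open>gam (Suc p)\<close> in weight \<open>p\<close>, one step above \<open>?W\<close>. Since
    \<open>H\<close> centralizes \<open>gam p\<close> modulo \<open>?W\<close>, the commutators of
    \<open>H\<close> with \<open>E (p - 1) = gam p\<close> lie in \<open>gam (p + 2)\<close>, and
    the extra step is kept from there on.\<close>
  define E where "E = (\<lambda>k. if k \<le> 1 then H else if k < p then gam (Suc k) else gam (k + 2))"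
  have HE: "commutator u v \<in> E (Suc l)" "commutator v u \<in> E (Suc l)" if u: "u \<in> H" and v: "v \<in> E l" and l: "1 < l" for u v l
  proof -
    have vc: "v \<in> carrier G" "u \<in> carrier G" using u v l H gam_carrier by (auto simp: E_def split: if_splits)
    have E: "subgroup (E (Suc l)) G" using H gam_subgroup by (simp add: E_def)
    show "commutator v u \<in> E (Suc l)"
    proof (cases "Suc l = p")
      case True
      then have "v \<in> gam p" using v l by (auto simp: E_def split: if_splits)
      then show ?thesis using HC u True l by (auto simp: C_def E_def)
    next
      case False
      then show ?thesis
        using v l gam_commutator_carrier(1)[of v _ u] vc by (auto simp: E_def split: if_splits)
    qed
    then show "commutator u v \<in> E (Suc l)" using commutator_mod_sym[OF E] vc by blast
  qed
  have E_anti: "E (Suc k) \<subseteq> E k" for k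
    using H gam_antimono p unfolding E_def by (auto elim!: gam_antimonoD)
  define y where "y = commutator g x"
  have y: "y \<in> gam 2" using gam_commutator_carrier[of g 1 x 2] x g by (simp add: gam_0_1 y_def)
  have "\<exists>w\<in>?W. (y \<otimes> x) [^] p = y [^] p \<otimes> w \<otimes> x [^] p"
  proof (rule hall_petrescu[where E = E])
    show "commutator u v \<in> E (k + l)" if "u \<in> E k" "v \<in> E l" for k l u v
    proof -
      consider "k \<le> 1" "l \<le> 1" | "k \<le> 1" "1 < l" | "1 < k" "l \<le> 1" | "1 < k" "1 < l" by linarith
      then show ?thesis
      proof cases
        case 1
        then have "commutator u v \<in> E 2" using that HH p by (simp add: E_def numeral_3_eq_3 numeral_2_eq_2)
        moreover have "E 2 \<subseteq> E (k + l)" using lift_Suc_antimono_le[of E, OF E_anti] 1 by simp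
        ultimately show ?thesis by auto
      next
        case 2
        then have "commutator u v \<in> E (Suc l)" using HE(1)[of u v l] that by (simp add: E_def)
        moreover have "E (Suc l) \<subseteq> E (k + l)" using lift_Suc_antimono_le[of E, OF E_anti] 2 by simp
        ultimately show ?thesis by auto
      next
        case 3
        then have "commutator u v \<in> E (Suc k)" using HE(2)[of v u k] that by (simp add: E_def)
        moreover have "E (Suc k) \<subseteq> E (k + l)" using lift_Suc_antimono_le[of E, OF E_anti] 3 by simp
        ultimately show ?thesis by auto
      next
        case 4
        then show ?thesis using that unfolding E_def by (auto intro: gam_commutator split: if_splits)
      qed
    qed
    show "subgroup (E k) G" for k using H gam_subgroup by (simp add: E_def)
    show "E (Suc k) \<subseteq> E k" for k by (rule E_anti)
    show "E p \<subseteq> ?W" using p by (simp add: E_def)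
    show "c [^] p \<in> ?W" if "c \<in> E 2" for c
      using that p by (intro gam_pow[of 3]) (auto simp: E_def numeral_3_eq_3 numeral_2_eq_2)
    show "x \<in> E 1" "y \<in> E 1" using H y by (auto simp: E_def)
  qed (use p_prime gam_subgroup in auto)
  then obtain w where w: "w \<in> ?W" "(y \<otimes> x) [^] p = y [^] p \<otimes> w \<otimes> x [^] p" by blast
  have c: "w \<in> carrier G" "y \<in> carrier G" using w y gam_carrier by auto
  have "commutator g (x [^] p) = y [^] p \<otimes> w"
    using commutator_pow_right[OF g(1) x(1), of p] w(2) c x by (simp add: y_def m_assoc)
  then have "y [^] p \<notin> ?W" using g(2) w(1) subgroup_closed(3)[OF gam_subgroup] by metis
  then show ?thesis using y by blast
qed

lemma gam_pow_nontrivial_step: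
  assumes i: "3 \<le> i" "i + p \<le> n" and p: "2 < p"
    and z: "z \<in> gam (i - 1)" "z [^] p \<notin> gam (i + p - 1)"
  shows "\<exists>y\<in>gam i. y [^] p \<notin> gam (i + p)"
proof -
  let ?W = "gam (i + p)"
  have zc: "z \<in> carrier G" using z gam_carrier by blast
  have "z [^] p \<in> gam (i + p - 1)" if "\<And>g. g \<in> carrier G \<Longrightarrow> commutator g (z [^] p) \<in> ?W"
    by (rule upper_central) (use that i p zc in auto)
  then obtain g where g: "g \<in> carrier G" "commutator g (z [^] p) \<notin> ?W"
    using z(2) by blast
  define y where "y = commutator g z"
  have y: "y \<in> gam i" using gam_commutator_carrier(2)[OF z(1) g(1), of i] i by (simp add: y_def)
  \<comment> \<open>As \<open>i - 1 >= 2\<close>, a commutator with \<open>gam (i - 1)\<close> gains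
    at least two steps per weight. So \<open>E 2\<close> is \<open>gam (Suc i)\<close>, whose
    \<open>p\<close>-th powers lie in \<open>?W\<close>, and
    \<open>E p = gam (i + 2 * p - 3)\<close> lies in \<open>?W\<close> because
    \<open>p >= 3\<close>.\<close>
  define E where "E = (\<lambda>k. if k \<le> 1 then gam (i - 1) else gam (i + 2 * k - 3))"
  have "\<exists>w\<in>?W. (y \<otimes> z) [^] p = y [^] p \<otimes> w \<otimes> z [^] p"
  proof (rule hall_petrescu[where E = E])
    show "commutator u v \<in> E (k + l)" if "u \<in> E k" "v \<in> E l" for k l u v
      using that i unfolding E_def by (auto intro: gam_commutator split: if_splits)
    show "subgroup (E k) G" for k using gam_subgroup by (simp add: E_def)
    show "E (Suc k) \<subseteq> E k" for k using i unfolding E_def by (auto elim!: gam_antimonoD)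
    show "E p \<subseteq> ?W" using p i by (auto simp: E_def elim!: gam_antimonoD)
    show "c [^] p \<in> ?W" if "c \<in> E 2" for c
      using that p i by (intro gam_pow[of "Suc i"]) (auto simp: E_def)
    show "z \<in> E 1" "y \<in> E 1" using z y i by (auto simp: E_def elim: gam_antimonoD)
  qed (use p_prime gam_subgroup in auto)
  then obtain w where w: "w \<in> ?W" "(y \<otimes> z) [^] p = y [^] p \<otimes> w \<otimes> z [^] p" by blast
  have c: "w \<in> carrier G" "y \<in> carrier G" using w y gam_carrier by auto
  have "commutator g (z [^] p) = y [^] p \<otimes> w"
    using commutator_pow_right[OF g(1) zc, of p] w(2) c zc by (simp add: y_def m_assoc)
  then have "y [^] p \<notin> ?W" using g(2) w(1) subgroup_closed(3)[OF gam_subgroup] by metis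
  then show ?thesis using y by blast
qed

text \<open>The preceding lemmas supply one element of \<open>gam i\<close> whose
  \<open>p\<close>-th power is outside \<open>gam (i + p)\<close>. If \<open>z\<close>, which
  generates \<open>gam i\<close> modulo \<open>gam (Suc i)\<close>, behaved differently, the
  subgroup \<open>U\<close> would be all of \<open>gam i\<close>.\<close>

lemma gam_pow_nontrivial:
  assumes x: "x \<in> carrier G" "x [^] p \<notin> gam (Suc p)" and p: "2 < p"
    and i: "2 \<le> i" "i + p \<le> n" and z: "z \<in> gam i" "z \<notin> gam (Suc i)"
  shows "z [^] p \<notin> gam (i + p)"
proof
  assume zp: "z [^] p \<in> gam (i + p)"
  have "2 \<le> i \<Longrightarrow> i + p \<le> n \<Longrightarrow> \<exists>y\<in>gam i. y [^] p \<notin> gam (i + p)" for i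
  proof (induction i rule: nat_induct_at_least)
    case base
    then show ?case using gam_2_pow_nontrivial[OF x _ p] by (simp add: add.commute)
  next
    case (Suc i)
    then obtain y where "y \<in> gam i" "y [^] p \<notin> gam (i + p)" by auto
    then show ?case using Suc gam_pow_nontrivial_step[of "Suc i" y] p by simp
  qed
  then obtain y where y: "y \<in> gam i" "y [^] p \<notin> gam (i + p)" using i by blast
  define U where "U = {u \<in> gam i. u [^] p \<in> gam (i + p)}"
  have next_i: "c [^] p \<in> gam (i + p)" if "c \<in> gam (Suc i)" for c
    by (rule gam_pow[OF _ _ that]) (use i in auto)
  have U: "subgroup U G" unfolding U_def
  \<comment> \<open>\<open>pow_subgroup\<close> only admits targets that contain
    \<open>gam (i + p - 1)\<close>. Inside \<open>gam i\<close> commutators gain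
    \<open>i >= 2\<close> steps, so a filtration descending by two at a time reaches
    \<open>gam (i + p)\<close>.\<close>
  proof (rule pow_subgroup_aux)
    fix x y assume xy: "x \<in> gam i" "y \<in> gam i"
    show "\<exists>w\<in>gam (i + p). (y \<otimes> x) [^] p = y [^] p \<otimes> w \<otimes> x [^] p"
    proof (rule hall_petrescu[where E = "\<lambda>k. gam (i + 2 * (k - 1))"])
      show "commutator u v \<in> gam (i + 2 * (k + l - 1))"
        if "u \<in> gam (i + 2 * (k - 1))" "v \<in> gam (i + 2 * (l - 1))" for k l u v
        by (rule gam_commutator[OF that]) (use i in \<open>cases k; cases l; auto\<close>)
      show "gam (i + 2 * (p - 1)) \<subseteq> gam (i + p)" by (rule gam_antimono) (use p in auto)
      show "c [^] p \<in> gam (i + p)" if "c \<in> gam (i + 2 * (2 - 1))" for c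
        by (rule gam_pow[OF _ _ that]) (use i in auto)
      show "gam (i + 2 * (Suc k - 1)) \<subseteq> gam (i + 2 * (k - 1))" for k
        by (rule gam_antimono) simp
    qed (use p_prime gam_subgroup xy in auto)
  qed
  have "gam i \<subseteq> U"
    by (rule gam_span[OF i(1) z U]) (use next_i gam_antimono[of i "Suc i"] z zp in \<open>auto simp: U_def\<close>)
  then show False using y by (auto simp: U_def)
qed

lemma pow_power_nontrivial:
  assumes x: "x \<in> carrier G" "x [^] p \<notin> gam (Suc p)" and p: "2 < p" "p < n"
  shows "1 + Suc j * (p - 1) < n \<Longrightarrow> x [^] (p ^ Suc j) \<notin> gam (2 + Suc j * (p - 1))"
proof (induction j)
  case 0
  then show ?case using x p by simp
next
  case (Suc j)
  let ?i = "1 + Suc j * (p - 1)"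
  have 1: "(x [^] (p ^ Suc j)) [^] p \<notin> gam (?i + p)"
  proof (rule gam_pow_nontrivial[OF x p(1)])
    show "2 \<le> ?i" using p by simp
    show "?i + p \<le> n" using Suc.prems p by (cases p) auto
    show "x [^] (p ^ Suc j) \<in> gam ?i" by (rule pow_power_mem[OF x(1) p(2)])
    show "x [^] (p ^ Suc j) \<notin> gam (Suc ?i)" using Suc by simp
  qed
  have 2: "?i + p = 2 + Suc (Suc j) * (p - 1)" using p by (cases p) auto
  have 3: "(x [^] (p ^ Suc j)) [^] p = x [^] (p ^ Suc (Suc j))"
    using x by (simp add: nat_pow_pow mult.commute)
  show ?case using 1 unfolding 2 3 .
qed

end

section \<open>The Engel congruence\<close>

context filtered_group
begin

text \<open>Congruence modulo degree 2: calculations up to \<open>eqv\<close> retain only the part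
  that is linear in the variable of degree 1.\<close>

definition eqv :: "nat \<Rightarrow> (nat \<Rightarrow> 'a) \<Rightarrow> (nat \<Rightarrow> 'a) \<Rightarrow> bool" where
  "eqv k f g \<longleftrightarrow> (\<exists>r\<in>Poly k 2. f = (\<lambda>m. r m \<otimes> g m))"

lemma eqvI: "r \<in> Poly k 2 \<Longrightarrow> (\<And>m. f m = r m \<otimes> g m) \<Longrightarrow> eqv k f g"
  unfolding eqv_def by (rule bexI[of _ r]) auto

lemma eqv_refl:
  assumes "\<And>m. f m \<in> carrier G"
  shows "eqv k f f"
proof (rule eqvI)
  show "(\<lambda>m. \<one>) \<in> Poly k 2" by (rule Poly_const) (rule subgroup_closed(1)[OF F_subgroup])
qed (use assms in simp)

lemma eqv_trans:
  assumes "eqv k f g" "eqv k g h" "\<And>m. h m \<in> carrier G"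
  shows "eqv k f h"
proof -
  obtain r where r: "r \<in> Poly k 2" "f = (\<lambda>m. r m \<otimes> g m)" using assms(1) unfolding eqv_def by (rule bexE)
  obtain r' where r': "r' \<in> Poly k 2" "g = (\<lambda>m. r' m \<otimes> h m)" using assms(2) unfolding eqv_def by (rule bexE)
  show ?thesis
  proof (rule eqvI[OF Poly_mult[OF r(1) r'(1)]])
    show "f m = r m \<otimes> r' m \<otimes> h m" for m
      using r(2) r'(2) Poly_carrier[OF r(1)] Poly_carrier[OF r'(1)] assms(3) by (simp add: m_assoc)
  qed
qed

lemma eqv_diff:
  assumes "eqv k f g" "g \<in> Poly k 1"
  shows "eqv (Suc k) (diff f) (diff g)"
proof -
  obtain r where r: "r \<in> Poly k 2" "f = (\<lambda>m. r m \<otimes> g m)" using assms(1) unfolding eqv_def by (rule bexE)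
  note c = Poly_carrier[OF r(1)] Poly_carrier[OF assms(2)]
  have 1: "(\<lambda>m. commutator (r m) (diff g m)) \<in> Poly (Suc k) 2"
    by (rule Poly_commutator[OF r(1) Poly_diff[OF assms(2)]]) auto
  show ?thesis
  proof (rule eqvI[OF Poly_mult[OF Poly_diff[OF r(1)] 1]])
    show "diff f m = diff r m \<otimes> commutator (r m) (diff g m) \<otimes> diff g m" for m
      unfolding r(2) diff_mult[OF c] ..
  qed
qed

text \<open>Both corrections are commutators with at least two entries of degree 1, so differences
  multiply up to degree 2.\<close>

lemma eqv_diff_mult:
  assumes "u \<in> Poly k 1" "v \<in> Poly k 1"
  shows "eqv (Suc k) (diff (\<lambda>m. u m \<otimes> v m)) (\<lambda>m. diff u m \<otimes> diff v m)"
proof -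
  note c = Poly_carrier[OF assms(1)] Poly_carrier[OF assms(2)]
  have 1: "(\<lambda>m. commutator (u m) (diff v m)) \<in> Poly (Suc k) 2"
    by (rule Poly_commutator[OF assms(1) Poly_diff[OF assms(2)]]) auto
  have 2: "(\<lambda>m. commutator (diff u m) (commutator (u m) (diff v m))) \<in> Poly (Suc k) 2"
    by (rule Poly_commutator[OF Poly_diff[OF assms(1)] 1]) auto
  show ?thesis
  proof (rule eqvI[OF Poly_mult[OF 2 1]])
    fix m
    define a d b where "a = diff u m" and "d = diff v m" and "b = commutator (u m) d"
    have "a \<in> carrier G" "b \<in> carrier G" "d \<in> carrier G"
      using c by (simp_all add: a_def b_def d_def diff_def)
    then show "diff (\<lambda>m. u m \<otimes> v m) m =
      commutator (diff u m) (commutator (u m) (diff v m)) \<otimes> commutator (u m) (diff v m) \<otimes> (diff u m \<otimes> diff v m)"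
      unfolding diff_mult[OF c] a_def[symmetric] d_def[symmetric] unfolding b_def[symmetric]
      by (simp add: commutator_def word_simps)
  qed
qed

lemma eqv_diff_pow_mult:
  assumes "u \<in> Poly k 1" "v \<in> Poly k 1"
  shows "eqv (k + q) ((diff ^^ q) (\<lambda>m. u m \<otimes> v m)) (\<lambda>m. (diff ^^ q) u m \<otimes> (diff ^^ q) v m)"
proof (induction q)
  case 0
  then show ?case using eqv_refl Poly_carrier[OF assms(1)] Poly_carrier[OF assms(2)] by simp
next
  case (Suc q)
  note d = Poly_diff_pow[OF assms(1), of q] Poly_diff_pow[OF assms(2), of q]
  note d' = Poly_diff_pow[OF assms(1), of "Suc q"] Poly_diff_pow[OF assms(2), of "Suc q"]
  have 1: "eqv (Suc (k + q)) (diff ((diff ^^ q) (\<lambda>m. u m \<otimes> v m))) (diff (\<lambda>m. (diff ^^ q) u m \<otimes> (diff ^^ q) v m))"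
    by (rule eqv_diff[OF Suc Poly_mult[OF d]])
  have "eqv (Suc (k + q)) (diff ((diff ^^ q) (\<lambda>m. u m \<otimes> v m))) (\<lambda>m. diff ((diff ^^ q) u) m \<otimes> diff ((diff ^^ q) v) m)"
    by (rule eqv_trans[OF 1 eqv_diff_mult[OF d]])
      (use Poly_carrier[OF d'(1)] Poly_carrier[OF d'(2)] in simp)
  then show ?case by simp
qed

lemma eqv_diff_commutator:
  assumes x: "x \<in> F 1 0" and f: "f \<in> Poly k 1"
  shows "eqv (Suc (Suc k)) (diff (\<lambda>m. commutator x (f m))) (\<lambda>m. commutator x (diff f m))"
proof -
  note d = Poly_diff[OF f]
  have xc: "x \<in> carrier G" using x F_carrier by blast
  have Xi: "(\<lambda>m. x) \<in> Poly 1 0" using x by (rule Poly_const)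
  have c: "(\<lambda>m. commutator x (f m)) \<in> Poly (Suc k) 1" by (rule Poly_commutator[OF Xi f]) auto
  have a: "(\<lambda>m. commutator x (diff f m)) \<in> Poly (Suc (Suc k)) 1" by (rule Poly_commutator[OF Xi d]) auto
  have b: "(\<lambda>m. commutator (diff f m) (commutator x (f m))) \<in> Poly (Suc (Suc k)) 2"
    by (rule Poly_commutator[OF d c]) auto
  have e: "(\<lambda>m. commutator (commutator x (diff f m)) (commutator (diff f m) (commutator x (f m))))
      \<in> Poly (Suc (Suc k)) 2"
    by (rule Poly_commutator[OF a b]) auto
  show ?thesis
  proof (rule eqvI[OF Poly_mult[OF e b]])
    fix m
    define A B C where "A = commutator x (diff f m)" and "B = commutator (diff f m) (commutator x (f m))"
      and "C = commutator x (f m)"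
    have cc: "f m \<in> carrier G" "diff f m \<in> carrier G" using Poly_carrier[OF f] Poly_carrier[OF d] by auto
    have AB: "A \<in> carrier G" "B \<in> carrier G" "C \<in> carrier G" using cc xc by (auto simp: A_def B_def C_def)
    have "f (Suc m) = diff f m \<otimes> f m"
      using cc(1) Poly_carrier[OF f, of "Suc m"] by (simp add: diff_def m_assoc)
    then have "diff (\<lambda>m. commutator x (f m)) m = A \<otimes> (diff f m \<otimes> C \<otimes> inv (diff f m)) \<otimes> inv C"
      unfolding diff_def[of "\<lambda>m. commutator x (f m)"]
      using commutator_mult_right[OF xc cc(2,1)] by (simp add: A_def C_def)
    also have "\<dots> = A \<otimes> B" using AB cc unfolding B_def C_def[symmetric] commutator_def[of _ C] by (simp add: m_assoc)
    also have "\<dots> = commutator A B \<otimes> B \<otimes> A" using AB by (simp add: commutator_def word_simps)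
    finally show "diff (\<lambda>m. commutator x (f m)) m =
       commutator (commutator x (diff f m)) (commutator (diff f m) (commutator x (f m)))
       \<otimes> commutator (diff f m) (commutator x (f m)) \<otimes> commutator x (diff f m)"
      by (simp add: A_def B_def)
  qed
qed

text \<open>One further difference removes the constant \<open>y\<close> from the equation for
  \<open>diff g\<close>, and modulo degree 2 differencing commutes with \<open>commutator x\<close>.
  Each difference thus amounts to one application of \<open>commutator x\<close>.\<close>

lemma diff_pow_quotient_eqv:
  assumes x: "x \<in> F 1 0" and y: "y \<in> F 1 1" and g: "g \<in> Poly 0 1"
    and dg: "diff g = (\<lambda>m. y \<otimes> commutator x (g m))"
  shows "eqv (q + 2) ((diff ^^ (q + 2)) g) (\<lambda>m. commutator x ((diff ^^ Suc q) g m))"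
proof (induction q)
  case 0
  have xc: "x \<in> carrier G" "y \<in> carrier G" using x y F_carrier by blast+
  have Xi: "(\<lambda>m. x) \<in> Poly 1 0" "(\<lambda>m. y) \<in> Poly 1 1" using x y Poly_const by blast+
  have c: "(\<lambda>m. commutator x (g m)) \<in> Poly 1 1" by (rule Poly_commutator[OF Xi(1) g]) auto
  have "diff (diff g) = (\<lambda>m. diff (\<lambda>m. y) m \<otimes> commutator y (diff (\<lambda>m. commutator x (g m)) m)
      \<otimes> diff (\<lambda>m. commutator x (g m)) m)"
    unfolding dg by (rule diff_mult) (use Poly_carrier[OF c] xc in auto)
  also have "\<dots> = (\<lambda>m. commutator y (diff (\<lambda>m. commutator x (g m)) m) \<otimes> diff (\<lambda>m. commutator x (g m)) m)"
    using xc Poly_carrier[OF Poly_diff[OF c]] by (simp add: diff_def[of "\<lambda>m. y"])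
  finally have 1: "eqv 2 (diff (diff g)) (diff (\<lambda>m. commutator x (g m)))"
    unfolding eqv_def
    by (intro bexI[of _ "\<lambda>m. commutator y (diff (\<lambda>m. commutator x (g m)) m)"]
        Poly_commutator[OF Xi(2) Poly_diff[OF c]]) auto
  have "eqv 2 (diff (diff g)) (\<lambda>m. commutator x (diff g m))"
    by (rule eqv_trans[OF 1 eqv_diff_commutator[OF x g, folded numeral_2_eq_2]])
      (use Poly_carrier[OF Poly_diff[OF g]] xc in auto)
  then show ?case by (simp add: numeral_2_eq_2)
next
  case (Suc q)
  have xc: "x \<in> carrier G" using x F_carrier by blast
  have Xi: "(\<lambda>m. x) \<in> Poly 1 0" using x Poly_const by blast
  have d: "(diff ^^ Suc q) g \<in> Poly (Suc q) 1" using Poly_diff_pow[OF g, of "Suc q"] by simp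
  have d': "diff ((diff ^^ Suc q) g) \<in> Poly (Suc (Suc q)) 1" by (rule Poly_diff[OF d])
  have 1: "eqv (Suc (q + 2)) (diff ((diff ^^ (q + 2)) g)) (diff (\<lambda>m. commutator x ((diff ^^ Suc q) g m)))"
    by (rule eqv_diff[OF Suc Poly_commutator[OF Xi d]]) auto
  have "eqv (Suc (q + 2)) (diff ((diff ^^ (q + 2)) g)) (\<lambda>m. commutator x (diff ((diff ^^ Suc q) g) m))"
    by (rule eqv_trans[OF 1]) (use eqv_diff_commutator[OF x d] Poly_carrier[OF d'] xc in auto)
  then show ?case by simp
qed

text \<open>Evaluates that recursion at 0, where it starts with \<open>diff g 0 = y\<close>; the
  Taylor coefficients of \<open>g\<close> are therefore Engel commutators modulo degree 2.\<close>

lemma diff_pow_quotient_zero: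
  assumes x: "x \<in> F 1 0" and y: "y \<in> F 1 1" and g: "g \<in> Poly 0 1" "g 0 = \<one>"
    and dg: "diff g = (\<lambda>m. y \<otimes> commutator x (g m))"
  shows "(commutator x ^^ q) y \<in> F (Suc q) 1 \<and>
    (\<exists>r\<in>F (Suc q) 2. (diff ^^ Suc q) g 0 = r \<otimes> (commutator x ^^ q) y)"
proof (induction q)
  case 0
  have c: "x \<in> carrier G" "y \<in> carrier G" using x y F_carrier by blast+
  have "diff g 0 = \<one> \<otimes> y" using dg c g(2) by simp
  then show ?case using y subgroup_closed(1)[OF F_subgroup] by auto
next
  case (Suc q)
  let ?a = "(commutator x ^^ q) y"
  obtain r where r: "r \<in> F (Suc q) 2" "(diff ^^ Suc q) g 0 = r \<otimes> ?a" using Suc by blast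
  have a: "?a \<in> F (Suc q) 1" using Suc by blast
  have xa: "commutator x ?a \<in> F (Suc (Suc q)) 1" using F_commutator[OF x a] by simp
  have c: "x \<in> carrier G" "r \<in> carrier G" "?a \<in> carrier G" "commutator x ?a \<in> carrier G"
    using F_carrier x r(1) a xa by blast+
  obtain s where s: "s \<in> Poly (q + 2) 2" "(diff ^^ (q + 2)) g = (\<lambda>m. s m \<otimes> commutator x ((diff ^^ Suc q) g m))"
    using diff_pow_quotient_eqv[OF x y g(1) dg, of q] unfolding eqv_def by (rule bexE)
  have s0: "s 0 \<in> F (Suc (Suc q)) 2" using Poly_values[OF s(1), of 0] by simp
  have "(diff ^^ Suc (Suc q)) g 0 = s 0 \<otimes> commutator x (r \<otimes> ?a)"
    using fun_cong[OF s(2), of 0] r(2) by simp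
  also have "commutator x (r \<otimes> ?a) = commutator x r \<otimes> (r \<otimes> commutator x ?a \<otimes> inv r)"
    by (rule commutator_mult_right[OF c(1-3)])
  also have "r \<otimes> commutator x ?a \<otimes> inv r = commutator r (commutator x ?a) \<otimes> commutator x ?a"
    using c by (simp add: commutator_def[of r] m_assoc)
  finally have eq: "(diff ^^ Suc (Suc q)) g 0
      = (s 0 \<otimes> (commutator x r \<otimes> commutator r (commutator x ?a))) \<otimes> commutator x ?a"
    using c F_carrier[OF s0] by (simp add: m_assoc)
  have "commutator x r \<in> F (Suc (Suc q)) 2" using F_commutator[OF x r(1)] by (simp add: numeral_2_eq_2)
  moreover have "commutator r (commutator x ?a) \<in> F (Suc (Suc q)) 2"
  proof -
    have "commutator r (commutator x ?a) \<in> F (Suc q + Suc (Suc q)) (2 + 1)"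
      by (rule F_commutator[OF r(1) xa])
    moreover have "F (Suc q + Suc (Suc q)) (2 + 1) \<subseteq> F (Suc q + Suc (Suc q)) 2"
      using F_Suc_degree[of "Suc q + Suc (Suc q)" 2] by simp
    moreover have "F (Suc q + Suc (Suc q)) 2 \<subseteq> F (Suc (Suc q)) 2"
      by (rule lift_Suc_antimono_le[of "\<lambda>k. F k 2"]) (use F_Suc_weight in auto)
    ultimately show ?thesis by blast
  qed
  ultimately have "s 0 \<otimes> (commutator x r \<otimes> commutator r (commutator x ?a)) \<in> F (Suc (Suc q)) 2"
    using s0 subgroup_closed(3)[OF F_subgroup] by blast
  then show ?case using eq xa by auto
qed

lemma diff_pow_binomial:
  assumes "c \<in> carrier G"
  shows "(diff ^^ q) (\<lambda>m. c [^] (m choose (i + q))) = (\<lambda>m. c [^] (m choose i))"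
    "(diff ^^ (i + Suc q)) (\<lambda>m. c [^] (m choose i)) = (\<lambda>m. \<one>)"
proof -
  have step: "diff (\<lambda>m. c [^] (m choose Suc i)) = (\<lambda>m. c [^] (m choose i))" for i
  proof
    fix m
    have "c [^] (Suc m choose Suc i) = c [^] (m choose i) \<otimes> c [^] (m choose Suc i)"
      using assms by (simp add: nat_pow_mult)
    then show "diff (\<lambda>m. c [^] (m choose Suc i)) m = c [^] (m choose i)"
      using assms by (simp add: diff_def m_assoc)
  qed
  show 1: "(diff ^^ q) (\<lambda>m. c [^] (m choose (i + q))) = (\<lambda>m. c [^] (m choose i))" for q i
  proof (induction q)
    case (Suc q)
    then show ?case using step[of "i + q"] by (simp add: funpow_Suc_right del: funpow.simps)
  qed simp
  have "(diff ^^ Suc q) (\<lambda>m. c) = (\<lambda>m. \<one>)" for q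
    by (induction q) (use assms in \<open>auto simp: diff_def fun_eq_iff\<close>)
  then show "(diff ^^ (i + Suc q)) (\<lambda>m. c [^] (m choose i)) = (\<lambda>m. \<one>)"
    using 1[of i 0] assms by (simp only: add.commute[of i] funpow_add) simp
qed

text \<open>Degree 2 absorbs the \<open>p\<close>-th powers, so only the top Taylor coefficient
  survives at \<open>p\<close>. A stripped factor \<open>g b [^] (m choose b)\<close> with
  \<open>b < p\<close> has trivial \<open>p\<close>-th difference, and \<open>p\<close>-th
  differences multiply modulo degree 2.\<close>

lemma Poly_prime_value_diff:
  assumes p: "Factorial_Ring.prime (p::nat)"
    and pw: "\<And>c i. 1 \<le> i \<Longrightarrow> i < p \<Longrightarrow> c \<in> F i 1 \<Longrightarrow> c [^] p \<in> F p 2"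
  shows "\<lbrakk>g \<in> Poly 0 1; 0 < b; b \<le> p; \<And>m. m < b \<Longrightarrow> g m = \<one>\<rbrakk> \<Longrightarrow>
    \<exists>r\<in>F p 2. g p = r \<otimes> (diff ^^ p) g 0"
proof (induction "p - b" arbitrary: b g)
  case 0
  then have "b = p" by simp
  then have "(diff ^^ p) g 0 = g p" using Poly_leading[of g 0 1 p] 0 by simp
  then have "g p = \<one> \<otimes> (diff ^^ p) g 0" using Poly_carrier[OF 0(2)] by simp
  then show ?case using subgroup_closed(1)[OF F_subgroup] by blast
next
  case (Suc d)
  note W = subgroup_closed[OF F_subgroup[of p 2]]
  have b: "b < p" using Suc by simp
  define u h where "u = (\<lambda>m. g b [^] (m choose b))" and "h = (\<lambda>m. inv (g b [^] (m choose b)) \<otimes> g m)"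
  note h = Poly_divide_leading[OF Suc.prems(1), of b, OF Suc.prems(4)]
  have hP: "h \<in> Poly 0 1" unfolding h_def by (rule h(1))
  have h2: "h m = \<one>" if "m < Suc b" for m
    unfolding h_def using h(2) that by simp
  have "\<exists>r\<in>F p 2. h p = r \<otimes> (diff ^^ p) h 0"
    by (rule Suc.hyps(1)[of "Suc b" h]) (use Suc.hyps(2) hP h2 b in \<open>simp_all\<close>)
  then obtain r where r: "r \<in> F p 2" "h p = r \<otimes> (diff ^^ p) h 0" by blast
  have gb: "g b \<in> F b 1" using Poly_leading[OF Suc.prems(1), of b] Suc.prems(4) by simp
  then have uP: "u \<in> Poly 0 1" unfolding u_def by (intro Poly_binomial) simp
  have geq: "g = (\<lambda>m. u m \<otimes> h m)" unfolding u_def h_def by (rule h(3))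
  have "p dvd p choose b" by (rule dvd_choose_prime) (use b p Suc.prems in auto)
  then obtain e where e: "p choose b = p * e" by auto
  have up: "u p \<in> F p 2"
    using pw[OF _ b gb] Suc.prems(2) W(5)[of "g b [^] p" e] F_carrier[OF gb] e by (simp add: u_def nat_pow_pow)
  have du: "(diff ^^ p) u 0 = \<one>"
    using diff_pow_binomial(2)[OF F_carrier[OF gb], of b "p - Suc b"] b by (simp add: u_def)
  have dh: "(diff ^^ p) h 0 \<in> carrier G" using Poly_carrier[OF Poly_diff_pow[OF hP]] .
  obtain s where s: "s \<in> Poly (0 + p) 2" "(diff ^^ p) (\<lambda>m. u m \<otimes> h m) = (\<lambda>m. s m \<otimes> ((diff ^^ p) u m \<otimes> (diff ^^ p) h m))"
    using eqv_diff_pow_mult[OF uP hP, of p] unfolding eqv_def by (rule bexE)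
  have s0: "s 0 \<in> F p 2" using Poly_values[OF s(1), of 0] by simp
  have c: "s 0 \<in> carrier G" "r \<in> carrier G" "u p \<in> carrier G" using s0 r(1) up F_carrier by blast+
  have "(diff ^^ p) g 0 = s 0 \<otimes> (diff ^^ p) h 0"
    using fun_cong[OF s(2), of 0] du dh unfolding geq[symmetric] by simp
  then have "(diff ^^ p) h 0 = inv (s 0) \<otimes> (diff ^^ p) g 0" using c dh by (simp add: inv_cancel_left)
  moreover have "(diff ^^ p) g 0 \<in> carrier G" using Poly_carrier[OF Poly_diff_pow[OF Suc.prems(1)]] .
  moreover have "g p = u p \<otimes> h p" using fun_cong[OF geq] .
  ultimately have "g p = (u p \<otimes> (r \<otimes> inv (s 0))) \<otimes> (diff ^^ p) g 0"
    using r(2) c by (simp add: m_assoc)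
  moreover have "u p \<otimes> (r \<otimes> inv (s 0)) \<in> F p 2" using W up r(1) s0 by simp
  ultimately show ?case by blast
qed

text \<open>Computes the top Taylor coefficient of \<open>g\<close> modulo \<open>F p 2\<close> in
  two ways: as the value \<open>g p\<close>, which is in \<open>F p 2\<close> by assumption, and as
  the Engel commutator.\<close>

theorem engel_congruence:
  assumes p: "Factorial_Ring.prime (p::nat)" and x: "x \<in> F 1 0" and y: "y \<in> F 1 1"
    and pw: "\<And>c i. 1 \<le> i \<Longrightarrow> i < p \<Longrightarrow> c \<in> F i 1 \<Longrightarrow> c [^] p \<in> F p 2"
    and xy: "(y \<otimes> x) [^] p \<otimes> inv (x [^] p) \<in> F p 2"
  shows "(commutator x ^^ (p - 1)) y \<in> F p 2"
proof -
  define g where "g = (\<lambda>m::nat. (y \<otimes> x) [^] m \<otimes> inv (x [^] m))"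
  have g: "g \<in> Poly 0 1" "diff g = (\<lambda>m. y \<otimes> commutator x (g m))"
    unfolding g_def by (rule Poly_pow_quotient[OF x y])+
  have g0: "g 0 = \<one>" by (simp add: g_def)
  have p1: "Suc (p - 1) = p" using prime_gt_0_nat[OF p] by simp
  let ?a = "(commutator x ^^ (p - 1)) y"
  have "\<exists>r\<in>F p 2. g p = r \<otimes> (diff ^^ p) g 0"
    by (rule Poly_prime_value_diff[where b = 1]) (use p pw g(1) g0 prime_gt_0_nat[OF p] in auto)
  then obtain r where r: "r \<in> F p 2" "g p = r \<otimes> (diff ^^ p) g 0" by blast
  obtain s where s: "s \<in> F p 2" "(diff ^^ p) g 0 = s \<otimes> ?a" and a: "?a \<in> F p 1"
    using diff_pow_quotient_zero[OF x y g(1) g0 g(2), of "p - 1"] unfolding p1 by blast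
  have c: "r \<in> carrier G" "s \<in> carrier G" "?a \<in> carrier G" using r(1) s(1) a F_carrier by blast+
  have "g p = (r \<otimes> s) \<otimes> ?a" using r(2) s(2) c by (simp add: m_assoc)
  moreover have "g p \<in> F p 2" using xy by (simp add: g_def)
  moreover have "r \<otimes> s \<in> F p 2" using r s subgroup_closed(3)[OF F_subgroup] by blast
  ultimately show ?thesis using normal_mult_cancel(1)[OF F_subgroup _ c(3)] by metis
qed

end

section \<open>Maps depending on a parameter, and their grading by degree\<close>

definition fun_group :: "('a, 'b) monoid_scheme \<Rightarrow> (nat \<Rightarrow> 'a) monoid" where
  "fun_group G = \<lparr>carrier = {f. \<forall>t. f t \<in> carrier G}, monoid.mult = (\<lambda>f g t. f t \<otimes>\<^bsub>G\<^esub> g t), one = (\<lambda>t. \<one>\<^bsub>G\<^esub>)\<rparr>"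

lemma fun_group_simps:
  "f \<in> carrier (fun_group G) \<longleftrightarrow> (\<forall>t. f t \<in> carrier G)"
  "f \<otimes>\<^bsub>fun_group G\<^esub> g = (\<lambda>t. f t \<otimes>\<^bsub>G\<^esub> g t)"
  "\<one>\<^bsub>fun_group G\<^esub> = (\<lambda>t. \<one>\<^bsub>G\<^esub>)"
  by (simp_all add: fun_group_def)

context group
begin

lemma fun_group: "group (fun_group G)"
proof (rule groupI)
  fix f assume "f \<in> carrier (fun_group G)"
  then show "\<exists>g\<in>carrier (fun_group G). g \<otimes>\<^bsub>fun_group G\<^esub> f = \<one>\<^bsub>fun_group G\<^esub>"
    by (intro bexI[of _ "\<lambda>t. inv (f t)"]) (auto simp: fun_group_simps)
qed (auto simp: fun_group_simps m_assoc)

lemma fun_group_inv: "f \<in> carrier (fun_group G) \<Longrightarrow> inv\<^bsub>fun_group G\<^esub> f = (\<lambda>t. inv (f t))"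
  by (rule group.inv_equality[OF fun_group]) (auto simp: fun_group_simps)

lemma fun_group_pow: "f [^]\<^bsub>fun_group G\<^esub> (m::nat) = (\<lambda>t. f t [^] m)"
proof -
  interpret F: group "fun_group G" by (rule fun_group)
  show ?thesis by (induction m) (auto simp: fun_group_simps)
qed

lemma fun_group_commutator:
  "f \<in> carrier (fun_group G) \<Longrightarrow> g \<in> carrier (fun_group G) \<Longrightarrow>
    group.commutator (fun_group G) f g = (\<lambda>t. commutator (f t) (g t))"
  by (simp add: group.commutator_def[OF fun_group] commutator_def fun_group_inv) (simp add: fun_group_simps)

lemma coset_eq_iff:
  assumes "N \<lhd> G" "a \<in> carrier G" "b \<in> carrier G"
  shows "N #> a = N #> b \<longleftrightarrow> (\<exists>r\<in>N. a = r \<otimes> b)"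
proof -
  interpret N: normal N G by fact
  have "N #> a = N #> b \<longleftrightarrow> a \<in> N #> b"
    using repr_independence[OF _ assms(3) N.subgroup_axioms] rcos_self[OF assms(2) N.subgroup_axioms] by blast
  then show ?thesis by (auto simp: r_coset_def)
qed

lemma commutator_pow_central:
  assumes "u \<in> carrier G" "v \<in> carrier G" "commutator u v \<otimes> v = v \<otimes> commutator u v"
  shows "commutator u (v [^] (b::nat)) = commutator u v [^] b"
proof -
  have "(commutator u v \<otimes> v) [^] b = commutator u v [^] b \<otimes> v [^] b"
    by (rule pow_mult_distrib[OF assms(3)]) (use assms in auto)
  then show ?thesis using assms(1,2) commutator_pow_right[OF assms(1,2), of b] by (simp add: m_assoc)
qed

lemma commutator_pow_pow_central:
  assumes uv: "u \<in> carrier G" "v \<in> carrier G"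
    and "commutator u v \<otimes> v = v \<otimes> commutator u v" "commutator u v \<otimes> u = u \<otimes> commutator u v"
  shows "commutator (u [^] (a::nat)) (v [^] (b::nat)) = commutator u v [^] (a * b)"
proof -
  let ?c = "commutator u v" and ?w = "v [^] b"
  have w: "?w \<in> carrier G" using uv by simp
  have 1: "commutator u ?w = ?c [^] b" using commutator_pow_central assms by blast
  have 2: "commutator ?w u = inv (?c [^] b)" using inv_commutator[OF uv(1) w] 1 by simp
  have "?c [^] b \<otimes> u = u \<otimes> ?c [^] b"
    using group_commutes_pow[OF assms(4)] uv by simp
  then have "inv (?c [^] b) \<otimes> u = u \<otimes> inv (?c [^] b)"
    using uv by (metis commutator_closed inv_closed nat_pow_closed inv_solve_left inv_solve_right m_assoc m_closed)
  then have "commutator ?w (u [^] a) = inv (?c [^] b) [^] a"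
    using commutator_pow_central[OF w uv(1)] 2 by simp
  then have "commutator (u [^] a) ?w = inv (inv (?c [^] b) [^] a)"
    using inv_commutator[OF w, of "u [^] a"] uv by simp
  then show ?thesis using uv by (simp add: nat_pow_inv nat_pow_pow mult.commute)
qed

text \<open>In the quotient by \<open>N\<close> the commutator of \<open>u\<close> and
  \<open>v\<close> is central, so commutators of their powers are bilinear in the exponents.\<close>

lemma commutator_pow_pow_mod:
  assumes N: "N \<lhd> G" and uv: "u \<in> carrier G" "v \<in> carrier G"
    and c: "\<And>w. w \<in> carrier G \<Longrightarrow> commutator (commutator u v) w \<in> N"
  shows "\<exists>r\<in>N. commutator (u [^] (a::nat)) (v [^] (b::nat)) = r \<otimes> commutator u v [^] (a * b)"
proof -
  interpret N: normal N G by fact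
  interpret Q: group "G Mod N" by (rule N.factorgroup_is_group)
  define h where "h = (\<lambda>a. N #> a)"
  interpret h: group_hom G "G Mod N" h
    unfolding group_hom_def group_hom_axioms_def h_def using N.r_coset_hom_Mod is_group Q.is_group by blast
  have hc: "h (commutator x y) = Q.commutator (h x) (h y)" if "x \<in> carrier G" "y \<in> carrier G" for x y
    using that by (simp add: commutator_def Q.commutator_def)
  have central: "Q.commutator (h u) (h v) \<otimes>\<^bsub>G Mod N\<^esub> h w = h w \<otimes>\<^bsub>G Mod N\<^esub> Q.commutator (h u) (h v)"
    if w: "w \<in> carrier G" for w
  proof -
    have cc: "commutator u v \<in> carrier G" using uv by simp
    have "commutator u v \<otimes> w = commutator (commutator u v) w \<otimes> (w \<otimes> commutator u v)"
      using w cc unfolding commutator_def[of "commutator u v"] by (simp add: word_simps)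
    then have "h (commutator u v \<otimes> w) = h (w \<otimes> commutator u v)"
      unfolding h_def using coset_eq_iff[OF N] c[OF w] cc w by blast
    then show ?thesis using cc w uv by (simp flip: hc)
  qed
  have "h (commutator (u [^] a) (v [^] b)) = h (commutator u v [^] (a * b))"
    using Q.commutator_pow_pow_central[OF h.hom_closed[OF uv(1)] h.hom_closed[OF uv(2)] central[OF uv(2)] central[OF uv(1)], of a b] uv
    by (simp add: hc h.hom_nat_pow)
  then show ?thesis unfolding h_def using coset_eq_iff[OF N] uv by simp
qed

text \<open>Weight 1 offers just the two inputs, the constant \<open>s\<close> in degree 0 and
  \<open>x [^] t\<close> in degree 1, and is the only weight where \<open>i = k\<close>
  occurs.\<close>

definition admissible :: "'a \<Rightarrow> 'a \<Rightarrow> nat \<Rightarrow> nat \<Rightarrow> 'a \<Rightarrow> nat \<Rightarrow> bool" where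
  "admissible s x k j d i \<longleftrightarrow>
     k = 1 \<and> (d = s \<and> i = 0 \<and> j = 0 \<or> d = x \<and> i = 1 \<and> j \<le> 1) \<or> 2 \<le> k \<and> d \<in> gam k \<and> j \<le> i \<and> i < k"

text \<open>The leading terms of the maps in \<open>graded s x k j\<close> are products of monomials \<open>t \<mapsto> d ^ (t ^ i)\<close> with
  \<open>d \<in> gam k\<close> and \<open>j \<le> i < k\<close>: the degree in \<open>t\<close> counts how often \<open>x ^ t\<close> is used. The bound \<open>i < k\<close> (valid
  since \<open>[x ^ t, x ^ t] = 1\<close>) keeps \<open>i\<close> below \<open>p\<close> for \<open>k = p\<close>, so that the linear term can be isolated
  modulo \<open>p\<close>.\<close>
inductive_set graded :: "'a \<Rightarrow> 'a \<Rightarrow> nat \<Rightarrow> nat \<Rightarrow> (nat \<Rightarrow> 'a) set" for s x k j where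
  low: "(\<And>t. h t \<in> gam (Suc k)) \<Longrightarrow> h \<in> graded s x k j"
| monomial: "admissible s x k j d i \<Longrightarrow> (\<lambda>t. d [^] (t ^ i)) \<in> graded s x k j"
| mult: "h \<in> graded s x k j \<Longrightarrow> h' \<in> graded s x k j \<Longrightarrow> (\<lambda>t. h t \<otimes> h' t) \<in> graded s x k j"
| inv: "h \<in> graded s x k j \<Longrightarrow> (\<lambda>t. inv (h t)) \<in> graded s x k j"

context
  fixes s x
  assumes sx: "s \<in> carrier G" "x \<in> carrier G"
begin

lemma admissible_mem: "admissible s x k j d i \<Longrightarrow> d \<in> gam k"
  using sx by (auto simp: admissible_def gam_0_1)

lemma graded_values: "h \<in> graded s x k j \<Longrightarrow> h t \<in> gam k"
proof (induction rule: graded.induct)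
  case (low h)
  then show ?case using gam_antimono[of k "Suc k"] by auto
next
  case (monomial d i)
  then show ?case using subgroup_closed(5)[OF gam_subgroup] admissible_mem by blast
qed (use subgroup_closed[OF gam_subgroup] in auto)

lemma graded_carrier: "h \<in> graded s x k j \<Longrightarrow> h t \<in> carrier G"
  using graded_values gam_carrier by blast

lemma graded_Suc_degree: "h \<in> graded s x k (Suc j) \<Longrightarrow> h \<in> graded s x k j"
proof (induction rule: graded.induct)
  case (monomial d i)
  then show ?case by (intro graded.monomial) (auto simp: admissible_def)
qed (auto intro: graded.intros)

lemma admissible_commutator:
  assumes "admissible s x k j d i" "admissible s x l j' d' i'"
  shows "commutator d d' = \<one> \<or> admissible s x (k + l) (j + j') (commutator d d') (i + i')"
proof -
  have "commutator d d' \<in> gam (k + l)" using gam_commutator admissible_mem assms by blast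
  then show ?thesis using assms sx unfolding admissible_def by auto
qed

lemma graded_monomial_commutator:
  assumes "admissible s x k j d i" "admissible s x l j' d' i'"
  shows "(\<lambda>t. commutator (d [^] (t ^ i)) (d' [^] (t ^ i'))) \<in> graded s x (k + l) (j + j')"
proof -
  have d: "d \<in> gam k" "d' \<in> gam l" using admissible_mem assms by blast+
  then have c: "d \<in> carrier G" "d' \<in> carrier G" using gam_carrier by blast+
  have cc: "commutator d d' \<in> gam (k + l)" using gam_commutator[OF d] by simp
  have "\<exists>r\<in>gam (Suc (k + l)). commutator (d [^] (t ^ i)) (d' [^] (t ^ i')) = r \<otimes> commutator d d' [^] (t ^ i * t ^ i')" for t :: nat
    by (rule commutator_pow_pow_mod[OF gam_normal c]) (use gam_commutator_carrier(1)[OF cc] in auto)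
  then obtain r where r: "\<And>t. r t \<in> gam (Suc (k + l))"
    "\<And>t :: nat. commutator (d [^] (t ^ i)) (d' [^] (t ^ i')) = r t \<otimes> commutator d d' [^] (t ^ (i + i'))"
    unfolding power_add by metis
  have rg: "r \<in> graded s x (k + l) (j + j')" using r(1) by (rule graded.low)
  have "(\<lambda>t. commutator d d' [^] (t ^ (i + i'))) \<in> graded s x (k + l) (j + j')"
    using admissible_commutator[OF assms]
  proof
    assume 1: "commutator d d' = \<one>"
    show ?thesis unfolding 1 by (rule graded.low) (use subgroup_closed(1)[OF gam_subgroup] in simp)
  qed (rule graded.monomial)
  then show ?thesis unfolding r(2) by (rule graded.mult[OF rg])
qed

text \<open>Induction over both arguments reduces to monomials. The corrections in the product and
  inverse rules are commutators with values in \<open>gam (k + l)\<close>, hence deep enough for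
  \<open>low\<close>.\<close>

lemma graded_commutator:
  assumes u: "u \<in> graded s x k j" and v: "v \<in> graded s x l i"
  shows "(\<lambda>t. commutator (u t) (v t)) \<in> graded s x (k + l) (j + i)"
proof (cases "k = 0 \<or> l = 0")
  \<comment> \<open>Weight 0 has no monomials. As \<open>gam 0 = gam 1\<close>, commutators with its
    elements descend one step more than the weights promise, so \<open>low\<close> applies.\<close>
  case True
  have "commutator (u t) (v t) \<in> gam (Suc (k + l))" for t
    using True graded_values[OF u, of t] graded_values[OF v, of t] gam_carrier gam_commutator_carrier by auto
  then show ?thesis by (rule graded.low)
next
  case False
  let ?R = "graded s x (k + l) (j + i)"
  have deep: "(\<lambda>t. commutator (f t) (h t)) \<in> ?R" if "\<And>t. f t \<in> gam m" "\<And>t. h t \<in> gam (k + l)" "1 \<le> m" for f h m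
  proof (rule graded.low)
    show "commutator (f t) (h t) \<in> gam (Suc (k + l))" for t
      by (rule gam_commutator[OF that(1,2)]) (use that(3) in simp)
  qed
  have invg: "inv (f t) \<in> gam m" if "\<And>t. f t \<in> gam m" for f m t
    using that subgroup_closed(2)[OF gam_subgroup] by blast
  have val: "commutator (f t) (h t) \<in> gam (k + l)" if "\<And>t. f t \<in> gam k" "\<And>t. h t \<in> gam l" for f h t
    by (rule gam_commutator[OF that]) simp
  show ?thesis
    using u
  proof (induction rule: graded.induct)
    case (low h)
    show ?case
    proof (rule graded.low)
      show "commutator (h t) (v t) \<in> gam (Suc (k + l))" for t
        by (rule gam_commutator[OF low graded_values[OF v]]) simp
    qed
  next
    case (monomial d e)
    have d: "d [^] (t ^ e) \<in> gam k" for t :: nat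
      using graded_values[OF graded.monomial[OF monomial]] .
    show ?case
      using v
    proof (induction rule: graded.induct)
      case (low h)
      show ?case
      proof (rule graded.low)
        show "commutator (d [^] (t ^ e)) (h t) \<in> gam (Suc (k + l))" for t
          by (rule gam_commutator[OF d low]) simp
      qed
    next
      case (monomial d' e')
      then show ?case using graded_monomial_commutator \<open>admissible s x k j d e\<close> by blast
    next
      case (mult h h')
      note hv = graded_values[OF mult(1)] graded_values[OF mult(2)]
      have "(\<lambda>t. commutator (d [^] (t ^ e)) (h t \<otimes> h' t)) = (\<lambda>t. commutator (d [^] (t ^ e)) (h t) \<otimes>
         (commutator (h t) (commutator (d [^] (t ^ e)) (h' t)) \<otimes> commutator (d [^] (t ^ e)) (h' t)))"
      proof
        fix t
        have "d [^] (t ^ e) \<in> carrier G" "h t \<in> carrier G" "h' t \<in> carrier G"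
          using d hv gam_carrier by blast+
        then show "commutator (d [^] (t ^ e)) (h t \<otimes> h' t) = commutator (d [^] (t ^ e)) (h t) \<otimes>
           (commutator (h t) (commutator (d [^] (t ^ e)) (h' t)) \<otimes> commutator (d [^] (t ^ e)) (h' t))"
          by (simp add: commutator_mult_right commutator_def[of "h t"] m_assoc)
      qed
      moreover have "(\<lambda>t. commutator (h t) (commutator (d [^] (t ^ e)) (h' t))) \<in> ?R"
        by (rule deep[OF hv(1) val[OF d hv(2)]]) (use False in simp)
      ultimately show ?case using graded.mult[OF mult(3) graded.mult[OF _ mult(4)]] by simp
    next
      case (inv h)
      note hv = graded_values[OF inv(1)]
      have "(\<lambda>t. commutator (d [^] (t ^ e)) (inv (h t))) = (\<lambda>t.
         commutator (inv (h t)) (inv (commutator (d [^] (t ^ e)) (h t))) \<otimes> inv (commutator (d [^] (t ^ e)) (h t)))"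
      proof
        fix t
        have "d [^] (t ^ e) \<in> carrier G" "h t \<in> carrier G"
          using d hv gam_carrier by blast+
        then show "commutator (d [^] (t ^ e)) (inv (h t)) =
         commutator (inv (h t)) (inv (commutator (d [^] (t ^ e)) (h t))) \<otimes> inv (commutator (d [^] (t ^ e)) (h t))"
          by (simp add: commutator_inv_right commutator_def[of "inv (h t)"] m_assoc)
      qed
      moreover have "(\<lambda>t. commutator (inv (h t)) (inv (commutator (d [^] (t ^ e)) (h t)))) \<in> ?R"
        by (rule deep[OF invg[OF hv] invg[OF val[OF d hv]]]) (use False in simp)
      ultimately show ?case using graded.mult[OF _ graded.inv[OF inv(2)]] by simp
    qed
  next
    case (mult h h')
    note hv = graded_values[OF mult(1)] graded_values[OF mult(2)] graded_values[OF v]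
    have "(\<lambda>t. commutator (h t \<otimes> h' t) (v t)) = (\<lambda>t.
       (commutator (h t) (commutator (h' t) (v t)) \<otimes> commutator (h' t) (v t)) \<otimes> commutator (h t) (v t))"
    proof
      fix t
      have "h t \<in> carrier G" "h' t \<in> carrier G" "v t \<in> carrier G"
        using hv gam_carrier by blast+
      then show "commutator (h t \<otimes> h' t) (v t) =
         (commutator (h t) (commutator (h' t) (v t)) \<otimes> commutator (h' t) (v t)) \<otimes> commutator (h t) (v t)"
        by (simp add: commutator_mult_left commutator_def[of "h t" "commutator (h' t) (v t)"] m_assoc)
    qed
    moreover have "(\<lambda>t. commutator (h t) (commutator (h' t) (v t))) \<in> ?R"
      by (rule deep[OF hv(1) val[OF hv(2,3)]]) (use False in simp)
    ultimately show ?case using graded.mult[OF graded.mult[OF _ mult(4)] mult(3)] by simp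
  next
    case (inv h)
    note hv = graded_values[OF inv(1)] graded_values[OF v]
    have "(\<lambda>t. commutator (inv (h t)) (v t)) = (\<lambda>t.
       commutator (inv (h t)) (inv (commutator (h t) (v t))) \<otimes> inv (commutator (h t) (v t)))"
    proof
      fix t
      have "h t \<in> carrier G" "v t \<in> carrier G"
        using hv gam_carrier by blast+
      then show "commutator (inv (h t)) (v t) =
       commutator (inv (h t)) (inv (commutator (h t) (v t))) \<otimes> inv (commutator (h t) (v t))"
        by (simp add: commutator_inv_left commutator_def[of "inv (h t)" "inv (commutator (h t) (v t))"] m_assoc)
    qed
    moreover have "(\<lambda>t. commutator (inv (h t)) (inv (commutator (h t) (v t)))) \<in> ?R"
      by (rule deep[OF invg[OF hv(1)] invg[OF val[OF hv]]]) (use False in simp)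
    ultimately show ?case using graded.mult[OF _ graded.inv[OF inv(2)]] by simp
  qed
qed

lemma graded_filtered: "filtered_group (fun_group G) (graded s x)"
proof (intro filtered_group.intro filtered_group_axioms.intro fun_group)
  interpret Q: group "fun_group G" by (rule fun_group)
  show "subgroup (graded s x k j) (fun_group G)" for k j
  proof (rule Q.subgroupI)
    show "graded s x k j \<subseteq> carrier (fun_group G)" using graded_carrier by (auto simp: fun_group_simps)
    have "(\<lambda>t. \<one>) \<in> graded s x k j" by (rule graded.low) (rule subgroup_closed(1)[OF gam_subgroup])
    then show "graded s x k j \<noteq> {}" by blast
    show "inv\<^bsub>fun_group G\<^esub> a \<in> graded s x k j" if "a \<in> graded s x k j" for a
      using that graded_carrier graded.inv by (simp add: fun_group_inv fun_group_simps)
    show "a \<otimes>\<^bsub>fun_group G\<^esub> b \<in> graded s x k j" if "a \<in> graded s x k j" "b \<in> graded s x k j" for a b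
      using graded.mult[OF that] by (simp add: fun_group_simps)
  qed
  show "graded s x (Suc k) j \<subseteq> graded s x k j" for k j
    using graded_values by (auto intro: graded.low)
  show "graded s x k (Suc j) \<subseteq> graded s x k j" for k j
    using graded_Suc_degree by blast
  show "Q.commutator u v \<in> graded s x (k + l) (j + i)"
    if "u \<in> graded s x k j" "v \<in> graded s x l i" for u v k j l i
    using graded_commutator[OF that] graded_carrier that by (simp add: fun_group_commutator fun_group_simps)
qed

end

end

section \<open>Power sums modulo a prime\<close>

lemma sum_pow_eq:
  "(\<Sum>t<N. \<Sum>j\<le>m. (Suc m choose j) * t ^ j) = (N::nat) ^ Suc m"
proof (induction N)
  case (Suc N)
  have "Suc N ^ Suc m = (\<Sum>j\<le>Suc m. (Suc m choose j) * N ^ j)"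
    using binomial[of N 1 "Suc m"] by simp
  also have "\<dots> = (\<Sum>j\<le>m. (Suc m choose j) * N ^ j) + N ^ Suc m" by simp
  finally show ?case using Suc by simp
qed simp

text \<open>\<open>sum_pow_eq\<close> telescopes the differences of \<open>t ^ Suc m\<close>.
  Solving it for the sum of \<open>t ^ m\<close> only requires cancelling \<open>Suc m\<close>,
  which is prime to \<open>p\<close> in this range. For \<open>m = 0\<close> the convention
  \<open>0 ^ 0 = 1\<close> makes the sum equal to \<open>p\<close>.\<close>

lemma prime_dvd_power_sum:
  assumes p: "Factorial_Ring.prime (p::nat)"
  shows "m < p - 1 \<Longrightarrow> p dvd (\<Sum>t<p. t ^ m)"
proof (induction m rule: less_induct)
  case (less m)
  define S where "S = (\<lambda>j. \<Sum>t<p. t ^ j)"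
  have "p ^ Suc m = (\<Sum>j\<le>m. (Suc m choose j) * S j)"
    unfolding sum_pow_eq[of m p, symmetric] S_def by (subst sum.swap) (simp add: sum_distrib_left)
  also have "\<dots> = (\<Sum>j<m. (Suc m choose j) * S j) + Suc m * S m"
    by (simp add: lessThan_Suc_atMost[symmetric])
  finally have eq: "p ^ Suc m = (\<Sum>j<m. (Suc m choose j) * S j) + Suc m * S m" .
  have "p dvd (\<Sum>j<m. (Suc m choose j) * S j)"
    using less by (intro dvd_sum dvd_mult) (auto simp: S_def)
  moreover have "p dvd p ^ Suc m" by simp
  ultimately have "p dvd Suc m * S m" unfolding eq using dvd_add_right_iff by blast
  moreover have "\<not> p dvd Suc m" using less.prems by (auto dest: dvd_imp_le)
  ultimately show ?case using p prime_dvd_mult_iff unfolding S_def by blast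
qed

text \<open>By Fermat's theorem \<open>t ^ (p - 2)\<close> inverts \<open>t\<close>, leaving the sum
  of \<open>t ^ (i - 1)\<close>; this vanishes modulo \<open>p\<close> unless \<open>i = 1\<close>,
  where it counts \<open>p - 1\<close> terms.\<close>

lemma power_sum_cong:
  assumes p: "Factorial_Ring.prime (p::nat)" and i: "1 \<le> i" "i < p"
  shows "[(\<Sum>t=1..<p. t ^ (i + (p - 2))) = (if i = 1 then p - 1 else 0)] (mod p)"
proof -
  have "[(\<Sum>t=1..<p. t ^ (i + (p - 2))) = (\<Sum>t=1..<p. t ^ (i - 1))] (mod p)"
  proof (rule cong_sum)
    fix t assume t: "t \<in> {1..<p}"
    then have "\<not> p dvd t" by (auto dest: dvd_imp_le)
    then have "[t ^ (i - 1) * t ^ (p - 1) = t ^ (i - 1) * 1] (mod p)"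
      using fermat_theorem[OF p] cong_scalar_left by blast
    moreover have "i + (p - 2) = (i - 1) + (p - 1)" using i prime_ge_2_nat[OF p] by simp
    ultimately show "[t ^ (i + (p - 2)) = t ^ (i - 1)] (mod p)" by (simp add: power_add)
  qed
  moreover have "[(\<Sum>t=1..<p. t ^ (i - 1)) = (if i = 1 then p - 1 else 0)] (mod p)"
  proof (cases "i = 1")
    case False
    then have "p dvd (\<Sum>t<p. t ^ (i - 1))" using i by (intro prime_dvd_power_sum[OF p]) auto
    also have "(\<Sum>t<p. t ^ (i - 1)) = (\<Sum>t=1..<p. t ^ (i - 1))"
      using False i by (intro sum.mono_neutral_right) auto
    finally show ?thesis using False by (simp add: cong_0_iff)
  qed simp
  ultimately show ?thesis by (rule cong_trans)
qed

section \<open>The linear coefficient as an obstruction\<close>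

context maximal_class_group
begin

text \<open>If \<open>q\<close> is a polynomial in \<open>t\<close> with exponents from 1 to
  \<open>p - 1\<close>, this is minus its linear coefficient modulo \<open>p\<close>. It will be
  applied to logarithms to base \<open>z\<close> in \<open>gam p\<close> modulo
  \<open>gam (Suc p)\<close>.\<close>

definition log_sum :: "(nat \<Rightarrow> nat) \<Rightarrow> nat" where
  "log_sum q = (\<Sum>t=1..<p. q t * t ^ (p - 2))"

context
  fixes z N
  assumes N: "N = gam (Suc p)" and z: "z \<in> gam p" "z \<notin> gam (Suc p)" and zp: "z [^] p \<in> N"
begin

lemma gam_p_log:
  assumes "u \<in> gam p"
  shows "\<exists>e::nat. \<exists>r\<in>N. u = r \<otimes> z [^] e"
proof -
  have zc: "z \<in> carrier G" using z gam_carrier by blast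
  have Nn: "N \<lhd> G" unfolding N by (rule gam_normal)
  interpret N: normal N G by (rule Nn)
  define S where "S = {u. \<exists>e::nat. \<exists>r\<in>N. u = r \<otimes> z [^] e}"
  have mem: "r \<otimes> z [^] (e::nat) \<in> S" if "r \<in> N" for r e using that by (auto simp: S_def)
  have "subgroup S G"
  proof (rule subgroupI)
    show "S \<subseteq> carrier G" using zc by (auto simp: S_def)
    show "S \<noteq> {}" using mem[OF N.one_closed] by blast
    show m: "a \<otimes> b \<in> S" if ab: "a \<in> S" "b \<in> S" for a b
    proof -
      obtain e f r q where eq: "a = r \<otimes> z [^] (e::nat)" "b = q \<otimes> z [^] (f::nat)" "r \<in> N" "q \<in> N"
        using ab unfolding S_def by blast
      have c: "r \<in> carrier G" "q \<in> carrier G" using eq by auto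
      have "a \<otimes> b = (r \<otimes> (z [^] e \<otimes> q \<otimes> inv (z [^] e))) \<otimes> z [^] (e + f)"
        unfolding eq using zc c by (simp add: word_simps flip: nat_pow_mult)
      moreover have "r \<otimes> (z [^] e \<otimes> q \<otimes> inv (z [^] e)) \<in> N"
        using normal_conjD(1)[OF Nn, of "z [^] e" q] zc eq by simp
      ultimately show ?thesis using mem by simp
    qed
    show "inv a \<in> S" if "a \<in> S" for a
    proof -
      have ac: "a \<in> carrier G" using that zc by (auto simp: S_def)
      have powS: "a [^] (k::nat) \<in> S" for k
      proof (induction k)
        case 0
        then show ?case using mem[OF N.one_closed, of 0] by simp
      qed (use m that in simp)
      \<comment> \<open>Finite order writes the inverse as a power, so that logarithms remain
        natural numbers.\<close>
      have "0 < p ^ n" using p_ge_2 by simp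
      then obtain k where k: "p ^ n = Suc k" by (metis gr0_implies_Suc)
      have "a [^] k \<otimes> a = \<one>" using pow_order_eq_1[OF ac] unfolding order_eq k by simp
      then have "inv a = a [^] k" using ac by (intro inv_equality) auto
      then show ?thesis using powS by simp
    qed
  qed
  moreover have "gam (Suc p) \<subseteq> S"
  proof
    fix u assume "u \<in> gam (Suc p)"
    then show "u \<in> S" using mem[of u 0] N N.mem_carrier by simp
  qed
  moreover have "z \<in> S" using mem[of \<one> 1] zc by simp
  ultimately have "gam p \<subseteq> S" using gam_span[OF p_ge_2 z] by blast
  then show ?thesis using assms by (auto simp: S_def)
qed

text \<open>In weight \<open>p\<close> and degree 2 every monomial has \<open>2 <= i\<close> and
  \<open>i < p\<close>, so its weighted power sum vanishes modulo \<open>p\<close>; products and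
  inverses only add and scale logarithms.\<close>

lemma graded_log_sum:
  assumes sx: "s \<in> carrier G" "x \<in> carrier G" and h: "h \<in> graded s x p 2"
  shows "\<exists>q. (\<forall>t. \<exists>r\<in>N. h t = r \<otimes> z [^] (q t)) \<and> p dvd log_sum q"
proof -
  have zc: "z \<in> carrier G" using z gam_carrier by blast
  have Nn: "N \<lhd> G" unfolding N by (rule gam_normal)
  interpret N: normal N G by (rule Nn)
  have central: "commutator u v \<in> N" if "u \<in> gam p" "v \<in> carrier G" for u v
    unfolding N by (rule gam_commutator_carrier(1)[OF that]) simp
  have zz: "z [^] (k::nat) \<in> gam p" for k using z subgroup_closed(5)[OF gam_subgroup] by blast
  have powN: "\<exists>r'\<in>N. (r \<otimes> d) [^] (k::nat) = r' \<otimes> d [^] k" if "r \<in> N" "d \<in> carrier G" for r d k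
  proof (induction k)
    case 0
    then show ?case using N.one_closed by auto
  next
    case (Suc k)
    then obtain r' where r': "r' \<in> N" "(r \<otimes> d) [^] k = r' \<otimes> d [^] k" by blast
    have "(r \<otimes> d) [^] Suc k = (r' \<otimes> (d [^] k \<otimes> r \<otimes> inv (d [^] k))) \<otimes> d [^] Suc k"
      using r' that by (simp add: word_simps)
    moreover have "r' \<otimes> (d [^] k \<otimes> r \<otimes> inv (d [^] k)) \<in> N"
      using normal_conjD(1)[OF Nn, of "d [^] k" r] that r' by simp
    ultimately show ?case by blast
  qed
  have coset_mult: "\<exists>r\<in>N. a \<otimes> b = r \<otimes> z [^] (e + f)"
    if ex: "\<exists>r\<in>N. a = r \<otimes> z [^] (e::nat)" "\<exists>r\<in>N. b = r \<otimes> z [^] (f::nat)" for a b e f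
  proof -
    obtain r q where ab: "a = r \<otimes> z [^] e" "b = q \<otimes> z [^] f" "r \<in> N" "q \<in> N"
      using ex by blast
    have c: "r \<in> carrier G" "q \<in> carrier G" using ab by auto
    have "a \<otimes> b = (r \<otimes> (z [^] e \<otimes> q \<otimes> inv (z [^] e))) \<otimes> z [^] (e + f)"
      unfolding ab using zc c by (simp add: word_simps flip: nat_pow_mult)
    moreover have "r \<otimes> (z [^] e \<otimes> q \<otimes> inv (z [^] e)) \<in> N"
      using normal_conjD(1)[OF Nn, of "z [^] e" q] zc ab by simp
    ultimately show ?thesis by blast
  qed
  have pow: "\<exists>r\<in>N. a [^] (k::nat) = r \<otimes> z [^] (e * k)" if "\<exists>r\<in>N. a = r \<otimes> z [^] (e::nat)" for a e k
    using that powN[OF _ nat_pow_closed[OF zc]] nat_pow_pow[OF zc] by metis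
  show ?thesis
    using h
  proof (induction rule: graded.induct)
    case (low h)
    have "\<exists>r\<in>N. h t = r \<otimes> z [^] (0::nat)" for t
      using low[of t] N N.mem_carrier by (intro bexI[of _ "h t"]) auto
    then show ?case by (intro exI[of _ "\<lambda>t. 0"]) (auto simp: log_sum_def)
  next
    case (monomial d i)
    have d: "d \<in> gam p" "2 \<le> i" "i < p" using monomial p_ge_2 by (auto simp: admissible_def)
    obtain e :: nat where e: "\<exists>r\<in>N. d = r \<otimes> z [^] e" using gam_p_log[OF d(1)] by blast
    have "log_sum (\<lambda>t. e * t ^ i) = e * (\<Sum>t=1..<p. t ^ (i + (p - 2)))"
      unfolding log_sum_def power_add by (simp only: sum_distrib_left mult.assoc)
    moreover have "p dvd (\<Sum>t=1..<p. t ^ (i + (p - 2)))"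
      using power_sum_cong[OF p_prime, of i] d by (simp add: cong_0_iff)
    ultimately have "p dvd log_sum (\<lambda>t. e * t ^ i)" by simp
    then show ?case using pow[OF e] by (intro exI[of _ "\<lambda>t. e * t ^ i"]) simp
  next
    case (mult h h')
    obtain q q' where q: "\<forall>t. \<exists>r\<in>N. h t = r \<otimes> z [^] (q t)" "p dvd log_sum q"
      "\<forall>t. \<exists>r\<in>N. h' t = r \<otimes> z [^] (q' t)" "p dvd log_sum q'"
      using mult.IH by blast
    have "log_sum (\<lambda>t. q t + q' t) = log_sum q + log_sum q'"
      by (simp add: log_sum_def sum.distrib algebra_simps)
    then have "p dvd log_sum (\<lambda>t. q t + q' t)" using q by simp
    moreover have "\<forall>t. \<exists>r\<in>N. h t \<otimes> h' t = r \<otimes> z [^] (q t + q' t)"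
      by (intro allI coset_mult q(1)[rule_format] q(3)[rule_format])
    ultimately show ?case by (intro exI[of _ "\<lambda>t. q t + q' t"] conjI)
  next
    case (inv h)
    obtain q where q: "\<forall>t. \<exists>r\<in>N. h t = r \<otimes> z [^] (q t)" "p dvd log_sum q"
      using inv.IH by blast
    have hc: "h t \<in> carrier G" for t using q(1) zc by (metis N.mem_carrier m_closed nat_pow_closed)
    have "0 < p ^ n" using p_ge_2 by simp
    then obtain k where k: "p ^ n = Suc k" by (metis gr0_implies_Suc)
    have "h t [^] k \<otimes> h t = \<one>" for t using pow_order_eq_1[OF hc] unfolding order_eq k by simp
    then have "inv (h t) = h t [^] k" for t using hc by (intro inv_equality) auto
    then have "\<forall>t. \<exists>r\<in>N. inv (h t) = r \<otimes> z [^] (q t * k)" using pow q(1) by simp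
    moreover have "log_sum (\<lambda>t. q t * k) = log_sum q * k"
      by (simp add: log_sum_def sum_distrib_left mult.assoc mult.commute[of _ k])
    ultimately show ?case using q(2) by (intro exI[of _ "\<lambda>t. q t * k"] conjI) simp_all
  qed
qed

end

text \<open>Counting: \<open>p - 2\<close> proper subgroups of order at most
  \<open>p ^ (n - 1)\<close> cannot cover the group, so some \<open>s\<close> avoids all two-step
  centralizers concerned. Each further commutator with \<open>s\<close> then descends by exactly one
  step, because the current element generates its term modulo the next.\<close>

lemma engel_chain:
  assumes p: "2 < p" "p < n"
  shows "\<exists>s\<in>carrier G. \<exists>x\<in>carrier G. \<forall>q. 1 \<le> q \<longrightarrow> q < p \<longrightarrow>
    (commutator s ^^ q) x \<in> gam (Suc q) \<and> (commutator s ^^ q) x \<notin> gam (Suc (Suc q))"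
proof -
  define C where "C = (\<lambda>i. {s \<in> carrier G. \<forall>u\<in>gam i. commutator u s \<in> gam (Suc (Suc i))})"
  have C: "subgroup (C i) G" "C i \<noteq> carrier G" "gam 2 \<subseteq> C i" if "i \<in> {2..<p}" for i
    using two_step_centralizer[of i, folded C_def] that p unfolding C_def by auto
  have "card (\<Union>i\<in>{2..<p}. C i) \<le> (\<Sum>i\<in>{2..<p}. card (C i))" by (rule card_UN_le) simp
  also have "\<dots> \<le> (\<Sum>i\<in>{2..<p}. p ^ (n - 1))"
  proof (rule sum_mono)
    fix i assume i: "i \<in> {2..<p}"
    have "C i \<subset> carrier G" using C(2)[OF i] by (auto simp: C_def)
    then have "p * card (C i) \<le> p ^ n"
      using card_subgroup_step[OF C(1)[OF i] subgroup_self] order_eq by (simp add: order_def)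
    also have "p ^ n = p * p ^ (n - 1)" using n_gt_2 by (simp flip: power_Suc)
    finally show "card (C i) \<le> p ^ (n - 1)" using p by simp
  qed
  also have "\<dots> = (p - 2) * p ^ (n - 1)" by simp
  also have "\<dots> < p * p ^ (n - 1)" using p by simp
  also have "\<dots> = card (carrier G)" using n_gt_2 order_eq by (simp flip: power_Suc add: order_def)
  finally have "\<not> carrier G \<subseteq> (\<Union>i\<in>{2..<p}. C i)"
    using card_mono[of "\<Union>i\<in>{2..<p}. C i" "carrier G"] finite_subgroup C(1) by fastforce
  then obtain s where "s \<in> carrier G" "s \<notin> (\<Union>i\<in>{2..<p}. C i)" by blast
  then have s: "s \<in> carrier G" "\<And>i. 2 \<le> i \<Longrightarrow> i < p \<Longrightarrow> s \<notin> C i" by auto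
  have "s \<notin> gam 2" using C(3)[of 2] s(2)[of 2] p by auto
  then obtain x where x: "x \<in> carrier G" "commutator x s \<notin> gam (Suc 2)"
    using upper_central[of 2 s] s n_gt_2 by auto
  have "(commutator s ^^ q) x \<in> gam (Suc q) \<and> (commutator s ^^ q) x \<notin> gam (Suc (Suc q))" if "1 \<le> q" "q < p" for q
    using that
  proof (induction q rule: nat_induct_at_least)
    case base
    have "commutator s x \<in> gam 2" using gam_commutator_carrier(1)[of s 1 x 2] s x by (simp add: gam_0_1)
    moreover have "commutator s x \<notin> gam (Suc 2)" using x s commutator_mod_sym[OF gam_subgroup] by blast
    ultimately show ?case by (simp add: numeral_2_eq_2)
  next
    case (Suc q)
    let ?u = "(commutator s ^^ q) x" and ?i = "Suc q"
    have u: "?u \<in> gam ?i" "?u \<notin> gam (Suc ?i)" using Suc by auto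
    have "commutator s ?u \<notin> gam (Suc (Suc ?i))"
    proof
      assume "commutator s ?u \<in> gam (Suc (Suc ?i))"
      define D where "D = {v \<in> carrier G. \<forall>u\<in>{s}. commutator u v \<in> gam (Suc (Suc ?i))}"
      have D: "subgroup D G" unfolding D_def by (rule centralizer_mod_subgroup[OF gam_normal]) (use s in simp)
      have "gam ?i \<subseteq> D"
      proof (rule gam_span[OF _ u D])
        show "gam (Suc ?i) \<subseteq> D" using gam_commutator_carrier(2) gam_carrier s(1) by (auto simp: D_def)
        show "?u \<in> D" using u gam_carrier \<open>commutator s ?u \<in> gam (Suc (Suc ?i))\<close> by (simp add: D_def)
      qed (use Suc in simp)
      then have "s \<in> C ?i"
        using s(1) commutator_mod_sym[OF gam_subgroup s(1)] gam_carrier by (auto simp: C_def D_def)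
      then show False using s(2)[of ?i] Suc by simp
    qed
    moreover have "commutator s ?u \<in> gam (Suc ?i)"
      using gam_commutator_carrier(2)[OF u(1) s(1)] by simp
    ultimately show ?case by simp
  qed
  then show ?thesis using s(1) x(1) by blast
qed

theorem exists_pow_nontrivial:
  assumes p: "2 < p" "p < n"
  shows "\<exists>x\<in>carrier G. x [^] p \<notin> gam (Suc p)"
proof (rule ccontr)
  assume "\<not> ?thesis"
  then have all: "w [^] p \<in> gam (Suc p)" if "w \<in> carrier G" for w using that by blast
  obtain s x where sx: "s \<in> carrier G" "x \<in> carrier G"
    and chain: "\<And>q. 1 \<le> q \<Longrightarrow> q < p \<Longrightarrow>
      (commutator s ^^ q) x \<in> gam (Suc q) \<and> (commutator s ^^ q) x \<notin> gam (Suc (Suc q))"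
    using engel_chain[OF p] by blast
  define a where "a = (\<lambda>q. (commutator s ^^ q) x)"
  define z where "z = a (p - 1)"
  have z: "z \<in> gam p" "z \<notin> gam (Suc p)" using chain[of "p - 1"] p by (simp_all add: z_def a_def)
  have zc: "z \<in> carrier G" using z gam_carrier by blast
  note zp = all[OF zc]
  interpret Q: filtered_group "fun_group G" "graded s x" by (rule graded_filtered[OF sx])
  define Xi where "Xi = (\<lambda>t::nat. x [^] t)"
  have S: "(\<lambda>t. s) \<in> graded s x 1 0"
    using graded.monomial[of s x 1 0 s 0] sx by (simp add: admissible_def)
  have Xg: "Xi \<in> graded s x 1 1"
    using graded.monomial[of s x 1 1 x 1] by (simp add: admissible_def Xi_def)
  have cS: "(\<lambda>t. s) \<in> carrier (fun_group G)" "Xi \<in> carrier (fun_group G)"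
    using sx by (auto simp: fun_group_simps Xi_def)
  have "(Q.commutator (\<lambda>t. s) ^^ (p - 1)) Xi \<in> graded s x p 2"
  \<comment> \<open>The constant \<open>s\<close> takes the role of \<open>x\<close> and the map
    \<open>Xi\<close> that of \<open>y\<close>. Under the assumption to be refuted all
    \<open>p\<close>-th powers lie in \<open>gam (Suc p)\<close>, so in weight \<open>p\<close> they
    are \<open>low\<close> and belong to every degree.\<close>
  proof (rule Q.engel_congruence[OF p_prime S Xg])
    show "c [^]\<^bsub>fun_group G\<^esub> p \<in> graded s x p 2" if "c \<in> graded s x i 1" for c i
      unfolding fun_group_pow by (rule graded.low) (use all graded_carrier[OF sx that] in blast)
    have "(Xi \<otimes>\<^bsub>fun_group G\<^esub> (\<lambda>t. s)) [^]\<^bsub>fun_group G\<^esub> p \<otimes>\<^bsub>fun_group G\<^esub>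
       inv\<^bsub>fun_group G\<^esub> ((\<lambda>t. s) [^]\<^bsub>fun_group G\<^esub> p) = (\<lambda>t. (Xi t \<otimes> s) [^] p \<otimes> inv (s [^] p))"
      using sx by (simp add: fun_group_pow fun_group_inv fun_group_simps)
    then show "(Xi \<otimes>\<^bsub>fun_group G\<^esub> (\<lambda>t. s)) [^]\<^bsub>fun_group G\<^esub> p \<otimes>\<^bsub>fun_group G\<^esub>
       inv\<^bsub>fun_group G\<^esub> ((\<lambda>t. s) [^]\<^bsub>fun_group G\<^esub> p) \<in> graded s x p 2"
      using all sx subgroup_closed[OF gam_subgroup] by (simp add: Xi_def graded.low)
  qed
  moreover have "(Q.commutator (\<lambda>t. s) ^^ q) Xi = (\<lambda>t. (commutator s ^^ q) (Xi t))" for q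
  proof (induction q)
    case (Suc q)
    have "(commutator s ^^ q) (Xi t) \<in> carrier G" for t
      by (induction q) (use sx in \<open>auto simp: Xi_def\<close>)
    then show ?case using Suc cS by (simp add: fun_group_commutator fun_group_simps)
  qed simp
  ultimately have A: "(\<lambda>t. (commutator s ^^ (p - 1)) (Xi t)) \<in> graded s x p 2" by simp
  \<comment> \<open>Taking commutators with \<open>s\<close> is multiplicative on leading terms. At
    \<open>q = p - 1\<close> the Engel commutator of \<open>x [^] t\<close> therefore has logarithm
    \<open>t\<close>, purely linear in \<open>t\<close>.\<close>
  have lead: "\<exists>r\<in>gam (Suc (Suc q)). (commutator s ^^ q) (Xi t) = r \<otimes> a q [^] t" if "q < p" for q t
    using that
  proof (induction q)
    case 0
    show ?case
      by (rule bexI[of _ \<one>]) (use subgroup_closed(1)[OF gam_subgroup] sx in \<open>auto simp: Xi_def a_def\<close>)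
  next
    case (Suc q)
    then obtain r where r: "r \<in> gam (Suc (Suc q))" "(commutator s ^^ q) (Xi t) = r \<otimes> a q [^] t" by auto
    let ?M = "gam (Suc (Suc (Suc q)))"
    have rc: "r \<in> carrier G" using r gam_carrier by blast
    have ac: "a q \<in> carrier G" unfolding a_def by (induction q) (use sx in auto)
    have "commutator s (a q) \<in> gam (Suc (Suc q))" using chain[of "Suc q"] Suc.prems by (simp add: a_def)
    then obtain r' where r': "r' \<in> ?M" "commutator (s [^] (1::nat)) (a q [^] t) = r' \<otimes> commutator s (a q) [^] (1 * t)"
      using commutator_pow_pow_mod[OF gam_normal[of "Suc (Suc (Suc q))"] sx(1) ac, of 1 t] gam_commutator_carrier(1) by blast
    have r'c: "r' \<in> carrier G" using r' gam_carrier by blast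
    define c where "c = commutator s (a q) [^] t"
    have cc: "c \<in> carrier G" using sx ac by (simp add: c_def)
    have "commutator s (r \<otimes> a q [^] t) = commutator s r \<otimes> (r \<otimes> (r' \<otimes> c) \<otimes> inv r)"
      using commutator_mult_right[OF sx(1) rc, of "a q [^] t"] r' ac sx by (simp add: c_def)
    also have "\<dots> = (commutator s r \<otimes> ((r \<otimes> r' \<otimes> inv r) \<otimes> commutator r c)) \<otimes> c"
      using rc cc r'c sx unfolding commutator_def[of r] by (simp add: word_simps)
    finally have eq: "commutator s (r \<otimes> a q [^] t) = (commutator s r \<otimes> ((r \<otimes> r' \<otimes> inv r) \<otimes> commutator r c)) \<otimes> c" .
    have "commutator s r \<in> ?M" "commutator r c \<in> ?M" using gam_commutator_carrier[OF r(1)] sx cc by auto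
    moreover have "r \<otimes> r' \<otimes> inv r \<in> ?M" using normal_conjD(1)[OF gam_normal rc r'(1)] .
    ultimately have "commutator s r \<otimes> ((r \<otimes> r' \<otimes> inv r) \<otimes> commutator r c) \<in> ?M"
      using subgroup_closed(3)[OF gam_subgroup] by blast
    then show ?case using eq r(2) by (auto simp: c_def a_def)
  qed
  obtain q where q: "\<And>t. \<exists>r\<in>gam (Suc p). (commutator s ^^ (p - 1)) (Xi t) = r \<otimes> z [^] (q t)" "p dvd log_sum q"
    using graded_log_sum[OF refl z zp sx A] by blast
  \<comment> \<open>Logarithms to base \<open>z\<close> are unique modulo \<open>p\<close>, since
    \<open>z\<close> is outside \<open>gam (Suc p)\<close>.\<close>
  have cong: "[q t = t] (mod p)" for t
  proof -
    obtain r r' where r: "r \<in> gam (Suc p)" "r' \<in> gam (Suc p)" "r \<otimes> z [^] q t = r' \<otimes> z [^] t"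
      using q(1)[of t] lead[of "p - 1" t] p by (auto simp: z_def)
    have rc: "r \<in> carrier G" "r' \<in> carrier G" using r gam_carrier by blast+
    have main: "[e = f] (mod p)" if "e \<le> f" "r \<in> gam (Suc p)" "r' \<in> gam (Suc p)" "r \<otimes> z [^] e = r' \<otimes> z [^] f"
      for e f :: nat and r r'
    proof (rule ccontr)
      assume nc: "\<not> [e = f] (mod p)"
      have rc: "r \<in> carrier G" "r' \<in> carrier G" using that gam_carrier by blast+
      have "z [^] f = z [^] (f - e) \<otimes> z [^] e" using that zc by (simp add: nat_pow_mult)
      then have "r \<otimes> z [^] e = (r' \<otimes> z [^] (f - e)) \<otimes> z [^] e" using that rc zc by (simp add: m_assoc)
      then have "r = r' \<otimes> z [^] (f - e)" using rc zc by simp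
      then have "z [^] (f - e) \<in> gam (Suc p)"
        using that normal_mult_cancel(1)[OF gam_subgroup that(3), of "z [^] (f - e)"] zc by simp
      moreover have "\<not> p dvd f - e" using nc mod_eq_dvd_iff_nat[OF that(1), of p] by (auto simp: cong_def)
      then have "coprime (f - e) p" using prime_imp_coprime[OF p_prime, of "f - e"] coprime_commute by blast
      ultimately show False using pow_coprime_mem[OF gam_subgroup zc] z by blast
    qed
    show ?thesis using main[of "q t" t r r'] main[of t "q t" r' r] r cong_sym by (metis nat_le_linear)
  qed
  \<comment> \<open>Degree 2 forces divisibility by \<open>p\<close>, while the linear logarithm
    \<open>t\<close> gives \<open>p - 1\<close>.\<close>
  have "[log_sum q = (\<Sum>t=1..<p. t * t ^ (p - 2))] (mod p)"
    unfolding log_sum_def by (intro cong_sum cong_mult cong cong_refl)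
  also have "(\<Sum>t=1..<p. t * t ^ (p - 2)) = (\<Sum>t=1..<p. t ^ (1 + (p - 2)))" by simp
  also have "[\<dots> = p - 1] (mod p)" using power_sum_cong[OF p_prime, of 1] p by simp
  finally have "p dvd p - 1" using q(2) cong_dvd_iff by blast
  then show False using p by (auto dest: dvd_imp_le)
qed

end

section \<open>Exponents\<close>

context maximal_class_group
begin

lemma group_exponent_eqI:
  assumes all: "\<And>x. x \<in> carrier G \<Longrightarrow> x [^] (p ^ Suc k) = \<one>"
    and x: "x \<in> carrier G" "x [^] (p ^ k) \<noteq> \<one>"
  shows "group_exponent G = p ^ Suc k"
  unfolding group_exponent_def
proof (rule Least_equality)
  show "0 < p ^ Suc k \<and> (\<forall>g\<in>carrier G. g [^] (p ^ Suc k) = \<one>)" using all p_ge_2 by simp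
  fix e :: nat assume e: "0 < e \<and> (\<forall>g\<in>carrier G. g [^] e = \<one>)"
  have "ord x dvd p ^ Suc k" using all[OF x(1)] pow_eq_id[OF x(1)] by blast
  then obtain i where i: "i \<le> Suc k" "ord x = p ^ i" using divides_primepow_nat[OF p_prime] by blast
  have "\<not> i \<le> k"
  proof
    assume "i \<le> k"
    then have "ord x dvd p ^ k" using i by (simp add: le_imp_power_dvd)
    then show False using x pow_eq_id by blast
  qed
  then have "i = Suc k" using i by simp
  moreover have "ord x dvd e" using e x pow_eq_id by blast
  ultimately show "p ^ Suc k \<le> e" using i e dvd_imp_le by simp
qed

text \<open>The inequalities in \<open>k\<close> characterize the ceiling of
  \<open>(n - 1) / (p - 1)\<close> without real numbers. As \<open>p < n\<close>, they exclude
  \<open>k <= 1\<close>, so the nontrivial power \<open>p ^ (k - 1)\<close> is at least a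
  \<open>p\<close>-th power.\<close>

lemma group_exponent_large:
  assumes p: "2 < p" "p < n" and k: "n - 1 \<le> k * (p - 1)" "(k - 1) * (p - 1) < n - 1"
  shows "group_exponent G = p ^ k"
proof -
  have "\<not> k \<le> 1"
  proof
    assume "k \<le> 1"
    then have "k * (p - 1) \<le> 1 * (p - 1)" by (rule mult_le_mono1)
    then have "n - 1 \<le> p - 1" using k(1) by linarith
    then show False using p by linarith
  qed
  then obtain j where j: "k = Suc (Suc j)" by (cases k; cases "k - 1") auto
  obtain x where x: "x \<in> carrier G" "x [^] p \<notin> gam (Suc p)" using exists_pow_nontrivial[OF p] by blast
  have "x [^] (p ^ Suc j) \<notin> gam (2 + Suc j * (p - 1))"
    by (rule pow_power_nontrivial[OF x p]) (use k(2) j in simp)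
  then have "x [^] (p ^ Suc j) \<noteq> \<one>" using subgroup_closed(1)[OF gam_subgroup] by metis
  then show ?thesis unfolding j
    using x pow_exponent_bound[OF _ p(2) k(1)] unfolding j by (intro group_exponent_eqI) auto
qed

lemma group_exponent_prime:
  assumes "\<And>x. x \<in> carrier G \<Longrightarrow> x [^] p = \<one>"
  shows "group_exponent G = p"
proof -
  have "carrier G \<noteq> {\<one>}"
  proof
    assume "carrier G = {\<one>}"
    then have "p ^ n = 1" using order_eq by (simp add: order_def)
    then show False using n_gt_2 p_ge_2 by simp
  qed
  then obtain x where "x \<in> carrier G" "x \<noteq> \<one>" using one_closed by blast
  then have "group_exponent G = p ^ Suc 0" using assms by (intro group_exponent_eqI) auto
  then show ?thesis by simp
qed

lemma group_exponent_square:
  assumes "n \<le> p" "x \<in> carrier G" "x [^] p \<noteq> \<one>"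
  shows "group_exponent G = p ^ 2"
proof -
  have "group_exponent G = p ^ Suc 1"
    using assms pow_small_class[OF _ assms(1)] by (intro group_exponent_eqI[of 1 x]) (auto simp: numeral_2_eq_2)
  then show ?thesis by (simp add: numeral_2_eq_2)
qed

end

section \<open>Examples of order at most \<open>p ^ p\<close>\<close>

text \<open>The identity plus a shift. Entries are plain natural numbers; reduction modulo
  \<open>p\<close> is postponed to \<open>reduce\<close>.\<close>

definition jordan :: "(nat \<Rightarrow> nat) \<Rightarrow> nat \<Rightarrow> nat" where
  "jordan v = (\<lambda>i. v i + v (Suc i))"

lemma jordan_apply: "jordan v i = v i + v (Suc i)"
  by (simp add: jordan_def)

lemma jordan_pow_add: "(jordan ^^ e) (\<lambda>i. v i + w i) = (\<lambda>i. (jordan ^^ e) v i + (jordan ^^ e) w i)"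
proof (induction e)
  case (Suc e)
  then show ?case by (simp add: jordan_apply fun_eq_iff)
qed simp

lemma jordan_pow_cong:
  "(\<And>i. [v i = w i] (mod p)) \<Longrightarrow> [(jordan ^^ e) v i = (jordan ^^ e) w i] (mod p)"
  by (induction e arbitrary: i) (auto simp: jordan_apply cong_add)

lemma jordan_pow_eq:
  "(\<And>i. Suc k \<le> i \<Longrightarrow> v i = 0) \<Longrightarrow> k \<le> i \<Longrightarrow> (jordan ^^ e) v i = v i"
  by (induction e arbitrary: i) (auto simp: jordan_apply)

lemma jordan_pow_support:
  "(\<And>i. d \<le> i \<Longrightarrow> v i = 0) \<Longrightarrow> d \<le> i \<Longrightarrow> (jordan ^^ e) v i = 0"
  by (induction e arbitrary: i) (auto simp: jordan_apply)

lemma jordan_pow_zero [simp]: "(jordan ^^ e) (\<lambda>i. 0) = (\<lambda>i. 0)"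
  by (induction e) (auto simp: jordan_apply)

lemma jordan_pow_binomial: "(jordan ^^ e) v i = (\<Sum>j\<le>e. (e choose j) * v (i + j))"
proof (induction e arbitrary: i)
  case (Suc e)
  have "(jordan ^^ Suc e) v i = (\<Sum>j\<le>e. (e choose j) * v (i + j)) + (\<Sum>j\<le>e. (e choose j) * v (i + Suc j))"
    unfolding funpow.simps comp_apply jordan_apply[of "(jordan ^^ e) v"] Suc by simp
  also have "(\<Sum>j\<le>e. (e choose j) * v (i + j)) = v i + (\<Sum>j\<le>e. (e choose Suc j) * v (i + Suc j))"
    using sum.atMost_Suc_shift[of "\<lambda>j. (e choose j) * v (i + j)" e]
    by (simp add: binomial_eq_0)
  also have "\<dots> + (\<Sum>j\<le>e. (e choose j) * v (i + Suc j)) = v i + (\<Sum>j\<le>e. (Suc e choose Suc j) * v (i + Suc j))"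
    by (simp add: sum.distrib algebra_simps)
  also have "\<dots> = (\<Sum>j\<le>Suc e. (Suc e choose j) * v (i + j))"
    by (subst sum.atMost_Suc_shift) simp
  finally show ?case .
qed simp

text \<open>Modulo \<open>p\<close>, the \<open>p\<close>-th power of identity plus shift is
  identity plus \<open>p\<close>-fold shift, and the latter kills vectors supported below
  \<open>p\<close>.\<close>

lemma jordan_pow_prime:
  assumes p: "Factorial_Ring.prime (p::nat)" and v: "\<And>i. p \<le> i \<Longrightarrow> v i = 0"
  shows "[(jordan ^^ p) v i = v i] (mod p)"
proof -
  obtain q where q: "p = Suc q" using prime_gt_0_nat[OF p] by (cases p) auto
  have "(jordan ^^ p) v i = v i + (\<Sum>j\<le>q. (p choose Suc j) * v (i + Suc j))"
    unfolding jordan_pow_binomial q by (subst sum.atMost_Suc_shift) simp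
  moreover have "p dvd (\<Sum>j\<le>q. (p choose Suc j) * v (i + Suc j))"
  proof (rule dvd_sum)
    fix j assume j: "j \<in> {..q}"
    show "p dvd (p choose Suc j) * v (i + Suc j)"
    proof (cases "Suc j = p")
      case False
      then have "p dvd p choose Suc j" using j q p by (intro dvd_choose_prime) auto
      then show ?thesis by simp
    qed (use v in simp)
  qed
  ultimately show ?thesis by (simp add: cong_add_lcancel_0_nat cong_0_iff)
qed

lemma jordan_pow_mod:
  assumes p: "Factorial_Ring.prime (p::nat)" and v: "\<And>i. p \<le> i \<Longrightarrow> v i = 0"
  shows "[(jordan ^^ (e mod p)) v i = (jordan ^^ e) v i] (mod p)"
proof -
  have "[(jordan ^^ (p * q)) v i = v i] (mod p)" for q i
  proof (induction q arbitrary: i)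
    case (Suc q)
    have "[(jordan ^^ p) ((jordan ^^ (p * q)) v) i = (jordan ^^ (p * q)) v i] (mod p)"
      by (rule jordan_pow_prime[OF p jordan_pow_support]) (use v in auto)
    then show ?case using Suc[of i] by (simp add: funpow_add cong_trans)
  qed simp
  then have "[(jordan ^^ (e mod p)) ((jordan ^^ (p * (e div p))) v) i = (jordan ^^ (e mod p)) v i] (mod p)"
    by (rule jordan_pow_cong)
  then have "[(jordan ^^ (e mod p + p * (e div p))) v i = (jordan ^^ (e mod p)) v i] (mod p)"
    by (simp only: funpow_add comp_apply)
  then show ?thesis by (simp add: cong_sym_eq)
qed

text \<open>Pairs \<open>(e, v)\<close> stand for \<open>v s ^ e\<close>, where \<open>s\<close> acts on vectors over the integers modulo \<open>p\<close> by a unipotent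
  Jordan block; reducing the exponent uses the relation \<open>s ^ p = c \<cdot> (1, 0, 0, \<dots>)\<close>.\<close>
definition semi_mult :: "nat \<times> (nat \<Rightarrow> nat) \<Rightarrow> nat \<times> (nat \<Rightarrow> nat) \<Rightarrow> nat \<times> (nat \<Rightarrow> nat)" where
  "semi_mult a b = (fst a + fst b, \<lambda>i. snd a i + (jordan ^^ fst a) (snd b) i)"

definition reduce :: "nat \<Rightarrow> nat \<Rightarrow> nat \<times> (nat \<Rightarrow> nat) \<Rightarrow> nat \<times> (nat \<Rightarrow> nat)" where
  "reduce p c a = (fst a mod p, \<lambda>i. (snd a i + (if i = 0 then c * (fst a div p) else 0)) mod p)"

definition jordan_group :: "nat \<Rightarrow> nat \<Rightarrow> nat \<Rightarrow> (nat \<times> (nat \<Rightarrow> nat)) monoid" where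
  "jordan_group p d c = \<lparr>carrier = {..<p} \<times> {v. (\<forall>i. v i < p) \<and> (\<forall>i\<ge>d. v i = 0)},
     monoid.mult = (\<lambda>a b. reduce p c (semi_mult a b)), one = (0, \<lambda>i. 0)\<rparr>"

lemma semi_mult_assoc: "semi_mult (semi_mult a b) e = semi_mult a (semi_mult b e)"
  by (simp add: semi_mult_def jordan_pow_add funpow_add add.assoc)

context
  fixes p d c :: nat
  assumes p: "Factorial_Ring.prime p" and d: "2 \<le> d" "d < p"
begin

text \<open>With \<open>reduce_right\<close>, this transfers associativity from unreduced pairs.
  Carries are additive up to the carry of the remainders, and the action only depends on the
  exponent modulo \<open>p\<close>.\<close>

lemma reduce_left:
  assumes "\<And>i. d \<le> i \<Longrightarrow> snd b i = 0"
  shows "reduce p c (semi_mult (reduce p c a) b) = reduce p c (semi_mult a b)"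
proof -
  obtain e v f w where ab: "a = (e, v)" "b = (f, w)" by (cases a; cases b)
  let ?r = "\<lambda>k i::nat. if i = 0 then c * (k div p) else 0"
  have div: "(e + f) div p = e div p + (e mod p + f) div p"
    using div_add1_eq[of e f p] div_add1_eq[of "e mod p" f p] by simp
  have r: "?r (e + f) i = ?r e i + ?r (e mod p + f) i" for i
    unfolding div by (simp add: algebra_simps)
  have "[(v i + ?r e i) mod p + (jordan ^^ (e mod p)) w i + ?r (e mod p + f) i
      = v i + ?r e i + (jordan ^^ e) w i + ?r (e mod p + f) i] (mod p)" for i
    by (intro cong_add jordan_pow_mod[OF p] cong_refl) (use assms d ab in \<open>auto simp: cong_def\<close>)
  then have "[(v i + ?r e i) mod p + (jordan ^^ (e mod p)) w i + ?r (e mod p + f) i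
      = v i + (jordan ^^ e) w i + ?r (e + f) i] (mod p)" for i
    unfolding r by (simp only: ac_simps)
  then show ?thesis
    unfolding ab reduce_def semi_mult_def fst_conv snd_conv cong_def prod.inject by (simp add: mod_simps)
qed

text \<open>The carry is a multiple of the first unit vector, which \<open>jordan\<close> fixes;
  this is what makes the relation for \<open>s ^ p\<close> consistent.\<close>

lemma reduce_right:
  "reduce p c (semi_mult a (reduce p c b)) = reduce p c (semi_mult a b)"
proof -
  obtain e v f w where ab: "a = (e, v)" "b = (f, w)" by (cases a; cases b)
  let ?r = "\<lambda>k i::nat. if i = 0 then c * (k div p) else 0"
  have div: "(e + f) div p = f div p + (e + f mod p) div p"
    using div_add1_eq[of e f p] div_add1_eq[of e "f mod p" p] by simp
  have r: "?r (e + f) i = ?r f i + ?r (e + f mod p) i" for i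
    unfolding div by (simp add: algebra_simps)
  have fix_r: "(jordan ^^ e) (?r f) i = ?r f i" for i
    by (rule jordan_pow_eq[of 0]) auto
  have "[(jordan ^^ e) (\<lambda>i. (w i + ?r f i) mod p) i = (jordan ^^ e) (\<lambda>i. w i + ?r f i) i] (mod p)" for i
    by (rule jordan_pow_cong) (simp add: cong_def)
  then have "[(jordan ^^ e) (\<lambda>i. (w i + ?r f i) mod p) i = (jordan ^^ e) w i + ?r f i] (mod p)" for i
    unfolding jordan_pow_add fix_r .
  then have "[v i + (jordan ^^ e) (\<lambda>i. (w i + ?r f i) mod p) i + ?r (e + f mod p) i
     = v i + ((jordan ^^ e) w i + ?r f i) + ?r (e + f mod p) i] (mod p)" for i
    by (intro cong_add cong_refl)
  then have "[v i + (jordan ^^ e) (\<lambda>i. (w i + ?r f i) mod p) i + ?r (e + f mod p) i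
     = v i + (jordan ^^ e) w i + ?r (e + f) i] (mod p)" for i
    unfolding r by (simp only: ac_simps)
  then show ?thesis
    unfolding ab reduce_def semi_mult_def fst_conv snd_conv cong_def prod.inject by (simp add: mod_simps)
qed

lemma reduce_id:
  "a \<in> carrier (jordan_group p d c) \<Longrightarrow> reduce p c a = a"
  by (cases a) (auto simp: jordan_group_def reduce_def fun_eq_iff)

lemma reduce_closed:
  "(\<And>i. d \<le> i \<Longrightarrow> snd a i = 0) \<Longrightarrow> reduce p c a \<in> carrier (jordan_group p d c)"
  using d by (auto simp: jordan_group_def reduce_def)

lemma jordan_carrierD:
  assumes "a \<in> carrier (jordan_group p d c)"
  shows "fst a < p" "snd a i < p" "d \<le> i \<Longrightarrow> snd a i = 0"
  using assms by (auto simp: jordan_group_def)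

lemma semi_mult_support:
  "(\<And>i. d \<le> i \<Longrightarrow> snd a i = 0) \<Longrightarrow> (\<And>i. d \<le> i \<Longrightarrow> snd b i = 0) \<Longrightarrow> d \<le> i \<Longrightarrow> snd (semi_mult a b) i = 0"
  unfolding semi_mult_def using jordan_pow_support[of d "snd b" i "fst a"] by simp

lemma jordan_mult: "a \<otimes>\<^bsub>jordan_group p d c\<^esub> b = reduce p c (semi_mult a b)"
  by (simp add: jordan_group_def)

lemma jordan_one: "\<one>\<^bsub>jordan_group p d c\<^esub> = (0, \<lambda>i. 0)"
  by (simp add: jordan_group_def)

lemma jordan_is_group: "group (jordan_group p d c)"
proof (rule groupI)
  let ?Q = "jordan_group p d c"
  show "a \<otimes>\<^bsub>?Q\<^esub> b \<in> carrier ?Q" if "a \<in> carrier ?Q" "b \<in> carrier ?Q" for a b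
    unfolding jordan_mult using that jordan_carrierD(3) by (intro reduce_closed semi_mult_support)
  show "\<one>\<^bsub>?Q\<^esub> \<in> carrier ?Q" using d by (auto simp: jordan_group_def)
  show "a \<otimes>\<^bsub>?Q\<^esub> b \<otimes>\<^bsub>?Q\<^esub> e = a \<otimes>\<^bsub>?Q\<^esub> (b \<otimes>\<^bsub>?Q\<^esub> e)"
    if "a \<in> carrier ?Q" "b \<in> carrier ?Q" "e \<in> carrier ?Q" for a b e
    unfolding jordan_mult using that jordan_carrierD(3)
    by (simp add: reduce_left reduce_right semi_mult_assoc)
  show "\<one>\<^bsub>?Q\<^esub> \<otimes>\<^bsub>?Q\<^esub> a = a" if "a \<in> carrier ?Q" for a
    using reduce_id[OF that] unfolding jordan_mult jordan_one by (simp add: semi_mult_def)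
  show "\<exists>b\<in>carrier ?Q. b \<otimes>\<^bsub>?Q\<^esub> a = \<one>\<^bsub>?Q\<^esub>" if a: "a \<in> carrier ?Q" for a
  proof -
    obtain e v where ev: "a = (e, v)" by (cases a)
    \<comment> \<open>Since \<open>f + e = p * e\<close>, the exponents cancel with carry
      \<open>e\<close>. The vector \<open>u\<close> collects what is then left over, and the factor
      \<open>p - 1\<close> acts as minus one modulo \<open>p\<close>.\<close>
    define f where "f = (p - 1) * e"
    define u where "u = (\<lambda>i. (jordan ^^ f) v i + (if i = 0 then c * e else 0))"
    define b where "b = (f, \<lambda>i. (p - 1) * u i)"
    have b: "snd b i = 0" if "d \<le> i" for i
      using that jordan_carrierD(3)[OF a] d ev jordan_pow_support[of d v i f] by (simp add: b_def u_def)
    have "f + e = p * e" using d by (simp add: f_def algebra_simps)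
    then have div: "(f + e) mod p = 0" "(f + e) div p = e" using d by simp_all
    have "(p - 1) * u i + u i = p * u i" for i using d by (cases p) auto
    then have inner: "(p - 1) * u i + (jordan ^^ f) v i + (if i = 0 then c * e else 0) = p * u i" for i
      by (simp add: u_def add.assoc)
    have "reduce p c (semi_mult b a) = (0, \<lambda>i. 0)"
      unfolding reduce_def semi_mult_def b_def ev fst_conv snd_conv div inner by simp
    then have "reduce p c b \<otimes>\<^bsub>?Q\<^esub> a = \<one>\<^bsub>?Q\<^esub>"
      unfolding jordan_mult jordan_one using reduce_left[OF jordan_carrierD(3)[OF a]] by simp
    then show ?thesis using reduce_closed[OF b] by blast
  qed
qed

lemma jordan_order: "order (jordan_group p d c) = p ^ Suc d"
proof -
  let ?V = "{v. (\<forall>i. v i < p) \<and> (\<forall>i\<ge>d. v i = 0)}"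
  have "bij_betw (\<lambda>v. restrict v {..<d}) ?V ({..<d} \<rightarrow>\<^sub>E {..<p})"
  proof (rule bij_betwI[where g = "\<lambda>v i. if i < d then v i else 0"])
    show "(\<lambda>v i. if i < d then v i else 0) \<in> ({..<d} \<rightarrow>\<^sub>E {..<p}) \<rightarrow> ?V" using d by (auto simp: PiE_iff)
  qed (use d in \<open>auto simp: fun_eq_iff PiE_iff extensional_def\<close>)
  then have "card ?V = p ^ d" by (simp add: bij_betw_same_card card_PiE)
  then show ?thesis by (simp add: order_def jordan_group_def card_cartesian_product)
qed

lemma jordan_mult_first:
  assumes "a \<in> carrier (jordan_group p d c)" "b \<in> carrier (jordan_group p d c)" "0 < i"
  shows "snd (a \<otimes>\<^bsub>jordan_group p d c\<^esub> b) i = (snd a i + (jordan ^^ fst a) (snd b) i) mod p"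
    "fst (a \<otimes>\<^bsub>jordan_group p d c\<^esub> b) = (fst a + fst b) mod p"
  using assms(3) by (simp_all add: jordan_mult reduce_def semi_mult_def)

text \<open>The vectors killed by the \<open>k\<close>-fold shift; they bound the lower central
  series from above.\<close>

definition jordan_layer :: "nat \<Rightarrow> (nat \<times> (nat \<Rightarrow> nat)) set" where
  "jordan_layer k = {a \<in> carrier (jordan_group p d c). fst a = 0 \<and> (\<forall>i\<ge>k. snd a i = 0)}"

lemma jordan_layer_mult:
  assumes "a \<in> jordan_layer k" "b \<in> carrier (jordan_group p d c)"
  shows "a \<otimes>\<^bsub>jordan_group p d c\<^esub> b = (fst b, \<lambda>i. (snd a i + snd b i) mod p)"
  using assms d by (auto simp: jordan_mult reduce_def semi_mult_def jordan_layer_def fun_eq_iff dest: jordan_carrierD(1))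

lemma jordan_layer_subgroup: "subgroup (jordan_layer k) (jordan_group p d c)"
proof (rule group.subgroupI[OF jordan_is_group])
  let ?Q = "jordan_group p d c"
  interpret Q: group ?Q by (rule jordan_is_group)
  show "jordan_layer k \<subseteq> carrier ?Q" by (auto simp: jordan_layer_def)
  have "\<one>\<^bsub>?Q\<^esub> \<in> jordan_layer k" using Q.one_closed by (simp add: jordan_layer_def jordan_one)
  then show "jordan_layer k \<noteq> {}" by blast
  show "a \<otimes>\<^bsub>?Q\<^esub> b \<in> jordan_layer k" if ab: "a \<in> jordan_layer k" "b \<in> jordan_layer k" for a b
  proof -
    have c: "a \<in> carrier ?Q" "b \<in> carrier ?Q" using ab by (auto simp: jordan_layer_def)
    show ?thesis using ab Q.m_closed[OF c] unfolding jordan_layer_mult[OF ab(1) c(2)]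
      by (auto simp: jordan_layer_def)
  qed
  show "inv\<^bsub>?Q\<^esub> a \<in> jordan_layer k" if a: "a \<in> jordan_layer k" for a
  proof -
    have c: "a \<in> carrier ?Q" using a by (auto simp: jordan_layer_def)
    have ic: "inv\<^bsub>?Q\<^esub> a \<in> carrier ?Q" using c by simp
    have eq: "(fst (inv\<^bsub>?Q\<^esub> a), \<lambda>i. (snd a i + snd (inv\<^bsub>?Q\<^esub> a) i) mod p) = (0, \<lambda>i. 0)"
      using jordan_layer_mult[OF a ic] c by (simp add: jordan_one)
    have "snd (inv\<^bsub>?Q\<^esub> a) i = 0" if "k \<le> i" for i
    proof -
      have "(snd a i + snd (inv\<^bsub>?Q\<^esub> a) i) mod p = 0" using eq by (auto dest: fun_cong)
      then show ?thesis using a that jordan_carrierD(2)[OF ic, of i] by (simp add: jordan_layer_def)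
    qed
    then show ?thesis using eq ic by (simp add: jordan_layer_def)
  qed
qed

text \<open>The products in both orders agree in the entries from \<open>k\<close> on, because the
  action fixes those entries of a vector supported up to \<open>k\<close>. Positivity of
  \<open>k\<close> keeps clear of entry 0, which receives the carry.\<close>

lemma jordan_commutator_layer:
  assumes h: "h \<in> carrier (jordan_group p d c)" and g: "g \<in> carrier (jordan_group p d c)"
    and k: "0 < k" "\<And>i. k < i \<Longrightarrow> snd h i = 0" "fst h = 0 \<or> (\<forall>i>k. snd g i = 0)"
  shows "group.commutator (jordan_group p d c) h g \<in> jordan_layer k"
proof -
  let ?Q = "jordan_group p d c"
  interpret Q: group ?Q by (rule jordan_is_group)
  define z a b where "z = Q.commutator h g" and "a = g \<otimes>\<^bsub>?Q\<^esub> h" and "b = h \<otimes>\<^bsub>?Q\<^esub> g"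
  have cc: "z \<in> carrier ?Q" "a \<in> carrier ?Q" "b \<in> carrier ?Q" using h g by (auto simp: z_def a_def b_def)
  have zab: "z \<otimes>\<^bsub>?Q\<^esub> a = b" using h g by (simp add: z_def a_def b_def Q.commutator_def Q.word_simps)
  have "fst a = fst b" using jordan_mult_first(2)[OF g h k(1)] jordan_mult_first(2)[OF h g k(1)]
    by (simp add: a_def b_def add.commute)
  moreover have "(fst z + fst a) mod p = fst b"
    using jordan_mult_first(2)[OF cc(1,2) k(1)] zab by simp
  ultimately have "(fst z + fst a) mod p = (0 + fst a) mod p"
    using jordan_carrierD(1)[OF cc(2)] by simp
  then have "[fst z + fst a = 0 + fst a] (mod p)" by (simp add: cong_def)
  then have "[fst z = 0] (mod p)" using cong_add_rcancel_nat by blast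
  then have z0: "fst z = 0" using jordan_carrierD(1)[OF cc(1)] by (simp add: cong_def)
  have "snd z i = 0" if i: "k \<le> i" for i
  proof -
    have i0: "0 < i" using i k by simp
    have "(jordan ^^ fst g) (snd h) i = snd h i" by (rule jordan_pow_eq[of k]) (use k i in auto)
    moreover have "(jordan ^^ fst h) (snd g) i = snd g i"
      using k(3) by (rule disjE) (use i in \<open>auto intro!: jordan_pow_eq[of k]\<close>)
    ultimately have "snd a i = snd b i"
      using jordan_mult_first(1)[OF g h i0] jordan_mult_first(1)[OF h g i0] by (simp add: a_def b_def add.commute)
    moreover have "(snd z i + snd a i) mod p = snd b i"
      using jordan_mult_first(1)[OF cc(1,2) i0] zab z0 by simp
    ultimately have "[snd z i + snd a i = 0 + snd a i] (mod p)"
      using jordan_carrierD(2)[OF cc(2), of i] by (simp add: cong_def)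
    then have "[snd z i = 0] (mod p)" using cong_add_rcancel_nat by blast
    then show ?thesis using jordan_carrierD(2)[OF cc(1), of i] by (simp add: cong_def)
  qed
  then show ?thesis using z0 cc(1) by (simp add: jordan_layer_def z_def)
qed

lemma jordan_lower_central_upper:
  "Suc i \<le> d \<Longrightarrow> lower_central (jordan_group p d c) (Suc i) \<subseteq> jordan_layer (d - Suc i)"
proof (induction i)
  let ?Q = "jordan_group p d c"
  interpret Q: group ?Q by (rule jordan_is_group)
  case 0
  show ?case
  proof (rule Q.lower_central_generate_incl[OF jordan_layer_subgroup])
    fix h g assume hg: "h \<in> lower_central ?Q 0" "g \<in> carrier ?Q"
    then have c: "h \<in> carrier ?Q" by simp
    show "Q.commutator h g \<in> jordan_layer (d - Suc 0)"
      by (rule jordan_commutator_layer[OF c hg(2)])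
        (use d jordan_carrierD(3)[OF c] jordan_carrierD(3)[OF hg(2)] in auto)
  qed
next
  let ?Q = "jordan_group p d c"
  interpret Q: group ?Q by (rule jordan_is_group)
  case (Suc i)
  show ?case
  proof (rule Q.lower_central_generate_incl[OF jordan_layer_subgroup])
    fix h g assume hg: "h \<in> lower_central ?Q (Suc i)" "g \<in> carrier ?Q"
    then have h: "h \<in> jordan_layer (d - Suc i)" using Suc by auto
    then have c: "h \<in> carrier ?Q" "fst h = 0" "\<And>j. d - Suc i \<le> j \<Longrightarrow> snd h j = 0" by (auto simp: jordan_layer_def)
    show "Q.commutator h g \<in> jordan_layer (d - Suc (Suc i))"
    proof (cases "Suc (Suc i) = d")
      case False
      then show ?thesis using Suc.prems c by (intro jordan_commutator_layer[OF c(1) hg(2)]) auto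
    next
      \<comment> \<open>The bottom layer would need \<open>k = 0\<close>. Here \<open>h\<close> is
        supported on entry 0, so it is fixed by the action and central.\<close>
      case True
      have hz: "fst h = 0" "\<And>j. 0 < j \<Longrightarrow> snd h j = 0" using c True by auto
      have fixed: "(jordan ^^ e) (snd h) = snd h" for e using jordan_pow_eq[of 0 "snd h" _ e] hz by (auto simp: fun_eq_iff)
      have "h \<otimes>\<^bsub>?Q\<^esub> g = g \<otimes>\<^bsub>?Q\<^esub> h"
        unfolding jordan_mult semi_mult_def using hz(1) fixed by (simp add: add.commute)
      then have "Q.commutator h g = \<one>\<^bsub>?Q\<^esub>" using c(1) hg(2) by (simp add: Q.commutator_def Q.word_simps)
      then show ?thesis using Q.subgroup_closed(1)[OF jordan_layer_subgroup] by metis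
    qed
  qed
qed

text \<open>The commutator with the generator \<open>s\<close> applies the shift, which moves a unit
  vector down by one entry.\<close>

lemma jordan_lower_central_lower:
  "i < d \<Longrightarrow> (0, \<lambda>j. if j = d - Suc i then 1 else 0) \<in> lower_central (jordan_group p d c) i"
proof (induction i)
  case 0
  then show ?case using d by (auto simp: jordan_group_def)
next
  let ?Q = "jordan_group p d c"
  interpret Q: group ?Q by (rule jordan_is_group)
  case (Suc i)
  define h z s :: "nat \<times> (nat \<Rightarrow> nat)" where "h = (0, \<lambda>j. if j = d - Suc i then 1 else 0)"
    and "z = (0, \<lambda>j. if j = d - Suc (Suc i) then 1 else 0)" and "s = (1, \<lambda>j. 0)"
  have cc: "h \<in> carrier ?Q" "z \<in> carrier ?Q" "s \<in> carrier ?Q"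
    using d Suc.prems by (auto simp: jordan_group_def h_def z_def s_def)
  have "z \<otimes>\<^bsub>?Q\<^esub> (h \<otimes>\<^bsub>?Q\<^esub> s) = s \<otimes>\<^bsub>?Q\<^esub> h"
    using d Suc.prems by (auto simp: h_def z_def s_def jordan_mult reduce_def semi_mult_def jordan_apply fun_eq_iff)
  then have "z = s \<otimes>\<^bsub>?Q\<^esub> h \<otimes>\<^bsub>?Q\<^esub> inv\<^bsub>?Q\<^esub> (h \<otimes>\<^bsub>?Q\<^esub> s)"
    using cc Q.inv_solve_right by simp
  then have "z = Q.commutator s h" using cc by (simp add: Q.commutator_def Q.inv_mult_group Q.m_assoc)
  then have "z \<in> lower_central ?Q (Suc i)"
    using Q.lower_central_commutator(2)[OF _ cc(3)] Suc h_def by (metis Suc_lessD)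
  then show ?case by (simp add: z_def)
qed

lemma jordan_maximal_class: "maximal_class p (Suc d) (jordan_group p d c)"
proof -
  let ?Q = "jordan_group p d c"
  interpret Q: group ?Q by (rule jordan_is_group)
  have "jordan_layer 0 = {\<one>\<^bsub>?Q\<^esub>}"
    using Q.one_closed by (auto simp: jordan_layer_def jordan_one fun_eq_iff)
  then have triv: "lower_central ?Q d = {\<one>\<^bsub>?Q\<^esub>}"
    using jordan_lower_central_upper[of "d - 1"] d Q.subgroup_closed(1)[OF Q.lower_central_subgroup, of d] by auto
  have "nilpotency_class ?Q = d"
    unfolding nilpotency_class_def
  proof (rule Least_equality[of "\<lambda>e. lower_central ?Q e = {\<one>\<^bsub>?Q\<^esub>}" d, OF triv])
    fix e assume e: "lower_central ?Q e = {\<one>\<^bsub>?Q\<^esub>}"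
    show "d \<le> e"
    proof (rule ccontr)
      assume "\<not> d \<le> e"
      then have "(0, \<lambda>j. if j = d - Suc e then 1 else 0) \<in> {\<one>\<^bsub>?Q\<^esub>}"
        using jordan_lower_central_lower[of e] e by simp
      then have "(\<lambda>j. if j = d - Suc e then 1 else 0 :: nat) = (\<lambda>j. 0)" by (simp add: jordan_one)
      from fun_cong[OF this, of "d - Suc e"] show False by simp
    qed
  qed
  then show ?thesis
    using jordan_order triv p by (auto simp: maximal_class_def nilpotent_def)
qed

lemma jordan_pow_vector:
  assumes "(0, v) \<in> carrier (jordan_group p d c)"
  shows "(0, v) [^]\<^bsub>jordan_group p d c\<^esub> (m::nat) = (0, \<lambda>i. (m * v i) mod p)"
proof (induction m)
  case (Suc m)
  then show ?case
    by (simp add: jordan_mult reduce_def semi_mult_def mod_simps add.commute fun_eq_iff cong: if_cong)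
qed (simp add: jordan_one)

lemma jordan_pow_generator:
  "(e, \<lambda>i. 0) [^]\<^bsub>jordan_group p d c\<^esub> (m::nat) = reduce p c (m * e, \<lambda>i. 0)"
proof (induction m)
  case 0
  then show ?case by (simp add: jordan_one reduce_def)
next
  case (Suc m)
  have "(e, \<lambda>i. 0) [^]\<^bsub>jordan_group p d c\<^esub> Suc m = reduce p c (semi_mult (reduce p c (m * e, \<lambda>i. 0)) (e, \<lambda>i. 0))"
    using Suc by (simp add: jordan_mult)
  also have "\<dots> = reduce p c (semi_mult (m * e, \<lambda>i. 0) (e, \<lambda>i. 0))" by (rule reduce_left) simp
  finally show ?case by (simp add: semi_mult_def add.commute)
qed

lemma jordan_generator_closed: "e < p \<Longrightarrow> (e, \<lambda>i. 0) \<in> carrier (jordan_group p d c)"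
  by (auto simp: jordan_group_def)

end

text \<open>For \<open>c = 0\<close> the extension splits. Each element is a vector times a power of
  \<open>s\<close>, both killed by \<open>p\<close>, and \<open>p\<close>-th powers are
  multiplicative since the order is at most \<open>p ^ p\<close>.\<close>

lemma jordan_exponent_prime:
  assumes p: "Factorial_Ring.prime p" and d: "2 \<le> d" "d < p"
  shows "group_exponent (jordan_group p d 0) = p"
proof -
  let ?Q = "jordan_group p d 0"
  interpret Q: maximal_class_group ?Q p "Suc d"
    unfolding maximal_class_group_def maximal_class_group_axioms_def
    using jordan_is_group[OF p d] jordan_maximal_class[OF p d] d by auto
  show ?thesis
  proof (rule Q.group_exponent_prime)
    fix x assume x: "x \<in> carrier ?Q"
    obtain e v where ev: "x = (e, v)" by (cases x)
    have v: "(0, v) \<in> carrier ?Q" and e: "e < p" using x ev by (auto simp: jordan_group_def)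
    have s: "(e, \<lambda>i. 0) \<in> carrier ?Q" by (rule jordan_generator_closed[OF p d e])
    have "x = (0, v) \<otimes>\<^bsub>?Q\<^esub> (e, \<lambda>i. 0)"
      unfolding ev jordan_mult[OF p d] reduce_def semi_mult_def
      using e jordan_carrierD(2)[OF p d v] by (simp add: fun_eq_iff)
    then have "x [^]\<^bsub>?Q\<^esub> p = (0, v) [^]\<^bsub>?Q\<^esub> p \<otimes>\<^bsub>?Q\<^esub> (e, \<lambda>i. 0) [^]\<^bsub>?Q\<^esub> p"
      using Q.pow_prime_hom[OF s v] d by simp
    also have "(0, v) [^]\<^bsub>?Q\<^esub> p = \<one>\<^bsub>?Q\<^esub>"
      using jordan_pow_vector[OF p d v, of p] by (simp add: jordan_one[OF p d])
    also have "(e, \<lambda>i. 0) [^]\<^bsub>?Q\<^esub> p = \<one>\<^bsub>?Q\<^esub>"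
      using jordan_pow_generator[OF p d, of 0 e p] by (simp add: jordan_one[OF p d] reduce_def)
    finally show "x [^]\<^bsub>?Q\<^esub> p = \<one>\<^bsub>?Q\<^esub>" by simp
  qed
qed

text \<open>For \<open>c = 1\<close> the element \<open>s ^ p\<close> is the first unit vector,
  which is nontrivial.\<close>

lemma jordan_exponent_square:
  assumes p: "Factorial_Ring.prime p" and d: "2 \<le> d" "d < p"
  shows "group_exponent (jordan_group p d 1) = p ^ 2"
proof -
  let ?Q = "jordan_group p d 1"
  interpret Q: maximal_class_group ?Q p "Suc d"
    unfolding maximal_class_group_def maximal_class_group_axioms_def
    using jordan_is_group[OF p d] jordan_maximal_class[OF p d] d by auto
  show ?thesis
  proof (rule Q.group_exponent_square)
    show "(1, \<lambda>i. 0) \<in> carrier ?Q" using d by (intro jordan_generator_closed[OF p d]) simp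
    have "snd ((1, \<lambda>i. 0) [^]\<^bsub>?Q\<^esub> p) 0 = 1"
      using jordan_pow_generator[OF p d, of 1 1 p] d by (simp add: reduce_def)
    then show "(1, \<lambda>i. 0) [^]\<^bsub>?Q\<^esub> p \<noteq> \<one>\<^bsub>?Q\<^esub>" by (auto simp: jordan_one[OF p d])
  qed (use d in simp)
qed

section \<open>Transport along isomorphisms, and the final assembly\<close>

lemma lower_central_iso_image:
  assumes G: "group G" and H: "group H" and f: "f \<in> iso G H"
  shows "lower_central H i = f ` lower_central G i"
proof -
  interpret G: group G by fact
  interpret H: group H by fact
  interpret f: group_hom G H f
    using f G H by (simp add: group_hom_def group_hom_axioms_def iso_def)
  have surj: "f ` carrier G = carrier H" using f by (auto simp: iso_def bij_betw_def)
  show ?thesis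
  proof (induction i)
    case 0
    then show ?case using surj by simp
  next
    case (Suc i)
    have sub: "lower_central G i \<subseteq> carrier G" using G.lower_central_subgroup subgroup.subset by blast
    let ?S = "\<Union>h\<in>lower_central G i. \<Union>g\<in>carrier G. {G.commutator h g}"
    have comm: "f (G.commutator h g) = H.commutator (f h) (f g)" if "h \<in> carrier G" "g \<in> carrier G" for h g
      using that by (simp add: G.commutator_def H.commutator_def)
    have "(\<Union>h\<in>f ` lower_central G i. \<Union>g\<in>f ` carrier G. {H.commutator h g})
        = (\<Union>h\<in>lower_central G i. \<Union>g\<in>carrier G. {H.commutator (f h) (f g)})"
      by simp
    also have "\<dots> = (\<Union>h\<in>lower_central G i. \<Union>g\<in>carrier G. {f (G.commutator h g)})"
      using sub by (intro SUP_cong refl) (simp add: comm subset_iff)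
    also have "\<dots> = f ` ?S" by (simp add: image_UN)
    finally have "(\<Union>h\<in>f ` lower_central G i. \<Union>g\<in>f ` carrier G. {H.commutator h g}) = f ` ?S" .
    moreover have "?S \<subseteq> carrier G" using sub by auto
    ultimately show ?case
      unfolding G.lower_central_Suc H.lower_central_Suc Suc surj[symmetric] using f.generate_img by metis
  qed
qed

text \<open>The examples live on pairs of a number and a function, whereas the final statement asks
  for natural numbers; a finite group can be copied along an injection.\<close>

lemma nat_copy:
  assumes G: "maximal_class p n G"
  shows "\<exists>Q :: nat monoid. maximal_class p n Q \<and> group_exponent Q = group_exponent G"
proof -
  interpret G: group G using G by (simp add: maximal_class_def)
  have "0 < order G" using G prime_gt_0_nat by (auto simp: maximal_class_def)
  then have fin: "finite (carrier G)" using G.order_gt_0_iff_finite by blast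
  obtain f :: "'a \<Rightarrow> nat" where f: "inj_on f (carrier G)" using finite_imp_inj_to_nat_seg[OF fin] by blast
  define g where "g = inv_into (carrier G) f"
  have gf: "g (f x) = x" if "x \<in> carrier G" for x using f that by (simp add: g_def)
  define Q :: "nat monoid" where
    "Q = \<lparr>carrier = f ` carrier G, monoid.mult = (\<lambda>a b. f (g a \<otimes>\<^bsub>G\<^esub> g b)), one = f \<one>\<^bsub>G\<^esub>\<rparr>"
  have Q: "carrier Q = f ` carrier G" "\<one>\<^bsub>Q\<^esub> = f \<one>\<^bsub>G\<^esub>" by (simp_all add: Q_def)
  have hom: "f (x \<otimes>\<^bsub>G\<^esub> y) = f x \<otimes>\<^bsub>Q\<^esub> f y" if "x \<in> carrier G" "y \<in> carrier G" for x y
    using that gf by (simp add: Q_def)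
  have grp: "group Q"
  proof (rule groupI)
    fix a assume "a \<in> carrier Q"
    then obtain x where x: "x \<in> carrier G" "a = f x" by (auto simp: Q)
    then have "f (inv\<^bsub>G\<^esub> x) \<otimes>\<^bsub>Q\<^esub> a = \<one>\<^bsub>Q\<^esub>" using hom[of "inv\<^bsub>G\<^esub> x" x] by (simp add: Q)
    then show "\<exists>b\<in>carrier Q. b \<otimes>\<^bsub>Q\<^esub> a = \<one>\<^bsub>Q\<^esub>" using x by (auto simp: Q)
  qed (auto simp: Q G.m_assoc simp flip: hom)
  have iso: "f \<in> iso G Q" using f hom by (auto simp: iso_def hom_def bij_betw_def Q)
  interpret f: group_hom G Q f
    using iso G.is_group grp by (simp add: group_hom_def group_hom_axioms_def iso_def)
  have lc: "lower_central Q i = {\<one>\<^bsub>Q\<^esub>} \<longleftrightarrow> lower_central G i = {\<one>\<^bsub>G\<^esub>}" for i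
  proof -
    have sub: "lower_central G i \<subseteq> carrier G" using G.lower_central_subgroup subgroup.subset by blast
    have "lower_central Q i = {\<one>\<^bsub>Q\<^esub>} \<longleftrightarrow> f ` lower_central G i = f ` {\<one>\<^bsub>G\<^esub>}"
      unfolding lower_central_iso_image[OF G.is_group grp iso, of i] Q(2) image_insert image_empty ..
    also have "\<dots> \<longleftrightarrow> lower_central G i = {\<one>\<^bsub>G\<^esub>}" by (rule inj_on_image_eq_iff[OF f sub]) simp
    finally show ?thesis .
  qed
  have "order Q = order G" using card_image[OF f] by (simp add: order_def Q)
  then have "maximal_class p n Q"
    using G grp by (simp add: maximal_class_def nilpotent_def nilpotency_class_def lc)
  moreover have "(\<forall>a\<in>carrier Q. a [^]\<^bsub>Q\<^esub> e = \<one>\<^bsub>Q\<^esub>) \<longleftrightarrow> (\<forall>x\<in>carrier G. x [^]\<^bsub>G\<^esub> e = \<one>\<^bsub>G\<^esub>)" for e :: nat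
  proof -
    have "f x [^]\<^bsub>Q\<^esub> e = \<one>\<^bsub>Q\<^esub> \<longleftrightarrow> x [^]\<^bsub>G\<^esub> e = \<one>\<^bsub>G\<^esub>" if "x \<in> carrier G" for x
      using inj_on_eq_iff[OF f, of "x [^]\<^bsub>G\<^esub> e" "\<one>\<^bsub>G\<^esub>"] that by (simp add: f.hom_nat_pow flip: Q(2))
    then show ?thesis by (simp add: Q(1))
  qed
  ultimately show ?thesis unfolding group_exponent_def by auto
qed

theorem theorem1:
  fixes p n :: nat
  assumes "Factorial_Ring.prime p" and "p > 2" and "n > 2"
  shows "(\<forall>P :: ('a, 'b) monoid_scheme. maximal_class p n P \<longrightarrow>
            (n > p + 1 \<longrightarrow>
               group_exponent P = p ^ nat \<lceil>(real n - 1) / (real p - 1)\<rceil>) \<and>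
            (n = p + 1 \<longrightarrow> group_exponent P = p ^ 2) \<and>
            (n \<le> p \<longrightarrow> group_exponent P = p \<or> group_exponent P = p ^ 2))
       \<and> (n \<le> p \<longrightarrow>
            (\<exists>Q :: nat monoid. maximal_class p n Q \<and> group_exponent Q = p) \<and>
            (\<exists>Q :: nat monoid. maximal_class p n Q \<and> group_exponent Q = p ^ 2))"
proof (intro conjI allI impI)
  fix P :: "('a, 'b) monoid_scheme" assume P: "maximal_class p n P"
  interpret P: maximal_class_group P p n
    unfolding maximal_class_group_def maximal_class_group_axioms_def
    using P assms by (auto simp: maximal_class_def)
  show "group_exponent P = p ^ nat \<lceil>(real n - 1) / (real p - 1)\<rceil>" if n: "p + 1 < n"
  proof (rule P.group_exponent_large)
    define r where "r = (real n - 1) / (real p - 1)"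
    define k where "k = nat \<lceil>r\<rceil>"
    have p1: "0 < real p - 1" using assms by simp
    have r0: "0 < r" using p1 n by (simp add: r_def)
    \<comment> \<open>These bounds for the ceiling become the two conditions on \<open>k\<close>
      after clearing the denominator.\<close>
    have k: "real k - 1 < r" "r \<le> real k" using r0 by (simp_all add: k_def) linarith+
    have "real n - 1 \<le> real k * (real p - 1)" using k(2) p1 by (simp add: r_def divide_simps)
    then have "real (n - 1) \<le> real (k * (p - 1))" using assms by (simp add: of_nat_diff)
    then show "n - 1 \<le> nat \<lceil>(real n - 1) / (real p - 1)\<rceil> * (p - 1)"
      unfolding of_nat_le_iff k_def r_def .
    have k1: "1 \<le> k" using k(2) r0 by (cases k) auto
    have "(real k - 1) * (real p - 1) < real n - 1" using k(1) p1 by (simp add: r_def divide_simps)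
    then have "real ((k - 1) * (p - 1)) < real (n - 1)" using assms k1 by (simp add: of_nat_diff)
    then show "(nat \<lceil>(real n - 1) / (real p - 1)\<rceil> - 1) * (p - 1) < n - 1"
      unfolding of_nat_less_iff k_def r_def .
  qed (use assms n in auto)
  \<comment> \<open>Here \<open>k = 2\<close>, since \<open>p - 1 < p\<close> and
    \<open>p <= 2 * (p - 1)\<close>.\<close>
  show "group_exponent P = p ^ 2" if n: "n = p + 1"
    by (rule P.group_exponent_large) (use assms n in auto)
  show "group_exponent P = p \<or> group_exponent P = p ^ 2" if n: "n \<le> p"
    using P.group_exponent_prime P.group_exponent_square[OF n] by blast
next
  assume n: "n \<le> p"
  have d: "2 \<le> n - 1" "n - 1 < p" "Suc (n - 1) = n" using assms n by auto
  show "\<exists>Q :: nat monoid. maximal_class p n Q \<and> group_exponent Q = p"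
    using nat_copy[OF jordan_maximal_class[OF assms(1) d(1,2), of 0]] jordan_exponent_prime[OF assms(1) d(1,2)] d(3)
    by simp
  show "\<exists>Q :: nat monoid. maximal_class p n Q \<and> group_exponent Q = p ^ 2"
    using nat_copy[OF jordan_maximal_class[OF assms(1) d(1,2), of 1]] jordan_exponent_square[OF assms(1) d(1,2)] d(3)
    by simp
qed

end
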